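(* Let $\eta_1,\eta_2$ be defined from the five elastic constants as in the context, with $\eta_1,\eta_2>0$. The operator $\mathcal{L}$ with Fourier symbol $$\frac{\eta_1\eta_2|k|^3}{\eta_2k_1^2+\eta_1k_2^2}$$ has, acting on $w\in\mathcal{S}(\mathbb{R}^2)$, the integral form $$\mathcal{L}w(x)=-\frac1{4\pi}\int_{\mathbb{R}^2}\big(w(x-y)+w(x+y)-2w(x)\big)K(y)\,dy,$$ where $$K(z)=\eta_1\eta_2\frac{Az_1^4+Bz_1^2z_2^2+Cz_2^4}{|z|(\eta_1z_1^2+\eta_2z_2^2)^3},$$ with $A=3\eta_1^2-2\eta_1\eta_2$, $B=2(3\eta_1^2-5\eta_1\eta_2+3\eta_2^2)$, $C=3\eta_2^2-2\eta_1\eta_2$, is the unique solution in $C^\infty(\mathbb{R}^2\setminus\{0\})$ to the PDE $$(\eta_2\partial_1^2+\eta_1\partial_2^2)K(z)=\eta_1\eta_2(\partial_1^2+\partial_2^2)\left[\frac1{|z|^3}\right].$$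
   Context: The five real elastic constants $C_{11},C_{13},C_{33},C_{44},C_{66}$ satisfy $0<C_{66}<C_{11}$, $C_{13}^2<C_{33}(C_{11}-C_{66})$, $C_{44}>0$, and $\eta_1=2\sqrt{C_{44}C_{66}}$, $$\eta_2=\frac1\tau\left(C_{11}-C_{13}-C_{44}+\frac{C_{13}C_{44}}{C_{33}}+\frac{\sqrt{C_{11}C_{33}}(C_{33}-C_{13})(C_{44}+C_{13})}{C_{33}^2}\right),\quad \tau=\frac{\sqrt{\sqrt{C_{11}C_{33}}-C_{13}}\sqrt{\sqrt{C_{11}C_{33}}+C_{13}+2C_{44}}}{2\sqrt{C_{33}C_{44}}}.$$ $x,z,k\in\mathbb{R}^2$ with coordinates indexed $1,2$; $\mathcal{S}(\mathbb{R}^2)$ is the Schwartz class; $\hat w(k)=\int_{\mathbb{R}^2}e^{-\imath x\cdot k}w(x)\,dx$, and $\mathcal{L}$ acts by multiplying $\hat w$ by the symbol.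
   Formalization: Uniqueness is proved only among smooth solutions K that are even and for which (w(x-y)+w(x+y)-2w(x))K(y) is absolutely integrable in y for all Schwartz w and all x; without such conditions it fails, since K+c solves the same PDE for every constant c. *)

theory Defs
  imports "HOL-Analysis.Analysis"
begin

definition eta1 :: "real \<Rightarrow> real \<Rightarrow> real" where
  "eta1 C44 C66 = 2 * sqrt (C44 * C66)"

definition tau :: "real \<Rightarrow> real \<Rightarrow> real \<Rightarrow> real \<Rightarrow> real" where
  "tau C11 C13 C33 C44 =
     sqrt (sqrt (C11 * C33) - C13) * sqrt (sqrt (C11 * C33) + C13 + 2 * C44)
       / (2 * sqrt (C33 * C44))"

definition eta2 :: "real \<Rightarrow> real \<Rightarrow> real \<Rightarrow> real \<Rightarrow> real" where
  "eta2 C11 C13 C33 C44 =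
     1 / tau C11 C13 C33 C44 *
       (C11 - C13 - C44 + C13 * C44 / C33
        + sqrt (C11 * C33) * (C33 - C13) * (C44 + C13) / C33\<^sup>2)"

definition partial :: "2 \<Rightarrow> (real^2 \<Rightarrow> 'b::real_normed_vector) \<Rightarrow> real^2 \<Rightarrow> 'b" where
  "partial i f x = frechet_derivative f (at x) (axis i 1)"

text \<open>The predicates below are meant for open sets only: \<^const>\<open>partial\<close> uses the
  unrestricted derivative at each point.\<close>

primrec Ck_on :: "nat \<Rightarrow> (real^2 \<Rightarrow> 'b::real_normed_vector) \<Rightarrow> (real^2) set \<Rightarrow> bool" where
  "Ck_on 0 f S \<longleftrightarrow> continuous_on S f"
| "Ck_on (Suc n) f S \<longleftrightarrow> f differentiable_on S \<and> (\<forall>i. Ck_on n (partial i f) S)"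

definition smooth_on :: "(real^2 \<Rightarrow> 'b::real_normed_vector) \<Rightarrow> (real^2) set \<Rightarrow> bool" where
  "smooth_on f S \<longleftrightarrow> (\<forall>n. Ck_on n f S)"

definition schwartz :: "(real^2 \<Rightarrow> complex) \<Rightarrow> bool" where
  "schwartz w \<longleftrightarrow> smooth_on w UNIV \<and>
     (\<forall>N a b. \<exists>M. \<forall>x. norm x ^ N * norm ((partial 1 ^^ a) ((partial 2 ^^ b) w) x) \<le> M)"

definition fourier :: "(real^2 \<Rightarrow> complex) \<Rightarrow> real^2 \<Rightarrow> complex" where
  "fourier w k = (LINT x|lborel. exp (- \<i> * complex_of_real (x \<bullet> k)) * w x)"

definition inv_fourier :: "(real^2 \<Rightarrow> complex) \<Rightarrow> real^2 \<Rightarrow> complex" where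
  "inv_fourier g x =
     complex_of_real (1 / (2 * pi)\<^sup>2) * (LINT k|lborel. exp (\<i> * complex_of_real (x \<bullet> k)) * g k)"

definition fourier_multiplier ::
    "(real^2 \<Rightarrow> real) \<Rightarrow> (real^2 \<Rightarrow> complex) \<Rightarrow> real^2 \<Rightarrow> complex" where
  "fourier_multiplier m w = inv_fourier (\<lambda>k. complex_of_real (m k) * fourier w k)"

text \<open>At \<open>k = 0\<close> division by zero gives the value \<open>0\<close>, the continuous extension.\<close>

definition symbol :: "real \<Rightarrow> real \<Rightarrow> real^2 \<Rightarrow> real" where
  "symbol \<eta>1 \<eta>2 k = \<eta>1 * \<eta>2 * norm k ^ 3 / (\<eta>2 * (k$1)\<^sup>2 + \<eta>1 * (k$2)\<^sup>2)"

definition elastic_kernel :: "real \<Rightarrow> real \<Rightarrow> real^2 \<Rightarrow> real" where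
  "elastic_kernel \<eta>1 \<eta>2 z =
     (let A = 3 * \<eta>1\<^sup>2 - 2 * \<eta>1 * \<eta>2;
          B = 2 * (3 * \<eta>1\<^sup>2 - 5 * \<eta>1 * \<eta>2 + 3 * \<eta>2\<^sup>2);
          C = 3 * \<eta>2\<^sup>2 - 2 * \<eta>1 * \<eta>2
      in \<eta>1 * \<eta>2 * ((A * (z$1) ^ 4 + B * (z$1)\<^sup>2 * (z$2)\<^sup>2 + C * (z$2) ^ 4)
           / (norm z * (\<eta>1 * (z$1)\<^sup>2 + \<eta>2 * (z$2)\<^sup>2) ^ 3)))"

definition second_difference_integrand ::
    "(real^2 \<Rightarrow> real) \<Rightarrow> (real^2 \<Rightarrow> complex) \<Rightarrow> real^2 \<Rightarrow> real^2 \<Rightarrow> complex" where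
  "second_difference_integrand K w x y =
     (w (x - y) + w (x + y) - 2 * w x) * complex_of_real (K y)"

text \<open>The PDE alone does not determine its solution on the punctured plane: one may add constants
  and other solutions of the homogeneous equation. Uniqueness is understood among kernels for
  which the second-difference integral converges absolutely; odd parts of \<open>K\<close> do not contribute
  to that integral, so the kernel is normalised to be even. No homogeneity, pointwise bound, or
  relation to the operator is imposed.\<close>

definition admissible_kernel :: "(real^2 \<Rightarrow> real) \<Rightarrow> bool" where
  "admissible_kernel K \<longleftrightarrow>
     (\<forall>z. z \<noteq> 0 \<longrightarrow> K (- z) = K z) \<and>
     (\<forall>w x. schwartz w \<longrightarrow> integrable lborel (second_difference_integrand K w x))"

definition smooth_kernel_solution :: "real \<Rightarrow> real \<Rightarrow> (real^2 \<Rightarrow> real) \<Rightarrow> bool" where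
  "smooth_kernel_solution \<eta>1 \<eta>2 K \<longleftrightarrow>
     smooth_on K (- {0}) \<and>
     (\<forall>z. z \<noteq> 0 \<longrightarrow>
        \<eta>2 * partial 1 (partial 1 K) z + \<eta>1 * partial 2 (partial 2 K) z
        = \<eta>1 * \<eta>2 * (partial 1 (partial 1 (\<lambda>y. 1 / norm y ^ 3)) z
                   + partial 2 (partial 2 (\<lambda>y. 1 / norm y ^ 3)) z))"

end

theory Submission
  imports Defs "HOL-Probability.Probability" "HOL-Real_Asymp.Real_Asymp"
begin

text \<open>
  Write \<open>a\<close>, \<open>b\<close> for the two positive parameters \<open>\<eta>1\<close>, \<open>\<eta>2\<close>, \<open>\<sigma>\<close> for the symbol and \<open>K\<close> for the kernel. Both
  functions are even, and they are homogeneous of degree \<open>1\<close> and \<open>-3\<close>.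

  The integral form. By Fourier inversion the second difference of \<open>w\<close> in the direction \<open>y\<close> has Fourier
  transform \<open>- 2 * (1 - cos (k \<bullet> y))\<close> times that of \<open>w\<close>, so by Fubini's theorem everything reduces to the
  identity that the integral of \<open>(1 - cos (k \<bullet> y)) * K y\<close> over the plane is \<open>2 * pi * \<sigma> k\<close>
  (\<open>elastic_kernel_cos_integral\<close>). Put \<open>y = (s, s * t)\<close>. The Jacobian is \<open>\<bar>s\<bar>\<close> and \<open>K y\<close> is
  \<open>\<bar>s\<bar> ^ (-3) * K (1, t)\<close>, so the integral over \<open>s\<close> equals \<open>pi * \<bar>k$1 + k$2 * t\<bar>\<close>. The coefficients of \<open>K\<close> are such
  that \<open>K (1, t)\<close> is the second derivative of \<open>h t = \<sigma> (t, 1)\<close> (\<open>DERIV_profile'\<close>). Two integrations by parts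
  leave \<open>2 * \<bar>k$2\<bar>\<close> times the value of \<open>h\<close> at the zero of \<open>k$1 + k$2 * t\<close>, and by homogeneity and symmetry
  this is \<open>2 * \<sigma> k\<close>. Absolute convergence, which is the admissibility of \<open>K\<close>, comes out of the same application of Fubini's theorem
  (\<open>elastic_operator\<close>).

  The equation. Both sides are explicit, and over a common denominator they agree as polynomials
  (\<open>ker_num_pde\<close>).

  Uniqueness. Let \<open>D\<close> be the difference of two admissible solutions. It is even and solves the homogeneous
  equation off the origin. Admissibility, tested on a Gaussian at the origin, makes \<open>D\<close> integrable against a
  weight comparable to \<open>min 1 ((norm y)\<^sup>2)\<close>. In logarithmic polar coordinates \<open>(\<rho>, \<theta>)\<close>, adapted to the ellipse
  of the equation, \<open>D\<close> becomes harmonic and periodic in \<open>\<theta>\<close>, so its \<open>n\<close>-th Fourier coefficient is a combination of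
  \<open>exp (n * \<rho>)\<close> and \<open>exp (- n * \<rho>)\<close>, or affine if \<open>n = 0\<close>. With the area element included the weight is of order
  \<open>exp (2 * \<rho>)\<close> at infinity and \<open>exp (4 * \<rho>)\<close> at the puncture. Integrability at infinity leaves only
  \<open>exp (- n * \<rho>)\<close> with \<open>n > 2\<close>, and integrability at the puncture only \<open>n < 4\<close>. The remaining case \<open>n = 3\<close> is odd
  and therefore absent. All Fourier coefficients vanish, and \<open>D = 0\<close> by the Stone-Weierstrass theorem
  (\<open>vanishes\<close>).
\<close>

section \<open>Partial derivatives and smoothness\<close>

lemma partial_eq_derivative:
  assumes "(f has_derivative f') (at z)"
  shows "partial i f z = f' (axis i 1)"
  using assms unfolding partial_def by (simp add: frechet_derivative_at[symmetric])

lemma partial_line_derivative: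
  assumes "f differentiable (at (z + t *\<^sub>R axis i 1))"
  shows "((\<lambda>t. f (z + t *\<^sub>R axis i 1)) has_vector_derivative partial i f (z + t *\<^sub>R axis i 1)) (at t)"
proof -
  have "(f has_derivative frechet_derivative f (at (z + t *\<^sub>R axis i 1))) (at (z + t *\<^sub>R axis i 1))"
    using assms frechet_derivative_works by blast
  moreover have "((\<lambda>t. z + t *\<^sub>R axis i 1) has_derivative (\<lambda>s. s *\<^sub>R axis i 1)) (at t)"
    by (auto intro!: derivative_eq_intros)
  ultimately have "((\<lambda>t. f (z + t *\<^sub>R axis i 1)) has_derivative
      (\<lambda>s. frechet_derivative f (at (z + t *\<^sub>R axis i 1)) (s *\<^sub>R axis i 1))) (at t)"
    using has_derivative_compose by blast
  moreover have "linear (frechet_derivative f (at (z + t *\<^sub>R axis i 1)))"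
    using assms by (rule linear_frechet_derivative)
  ultimately show ?thesis
    by (simp add: has_vector_derivative_def partial_def linear_scale)
qed

lemma partial_eqI:
  fixes f :: "real^2 \<Rightarrow> real"
  assumes "f differentiable (at z)"
    and "((\<lambda>t. f (z + t *\<^sub>R axis i 1)) has_real_derivative d) (at 0)"
  shows "partial i f z = d"
proof -
  have "((\<lambda>t. f (z + t *\<^sub>R axis i 1)) has_vector_derivative partial i f z) (at 0)"
    using partial_line_derivative[of f z 0 i] assms(1) by simp
  with assms(2) show ?thesis
    by (metis has_real_derivative_iff_has_vector_derivative vector_derivative_unique_at)
qed

lemma partial_transform_open:
  assumes "open S" "z \<in> S" "\<And>x. x \<in> S \<Longrightarrow> f x = g x"
  shows "partial i f z = partial i g z"
proof -
  have "(f has_derivative F) (at z) \<longleftrightarrow> (g has_derivative F) (at z)" for F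
    using assms has_derivative_transform_within_open[of f F z UNIV S g]
      has_derivative_transform_within_open[of g F z UNIV S f] by auto
  then show ?thesis unfolding partial_def frechet_derivative_def by simp
qed

lemma differentiable_on_cong_open:
  assumes "\<And>x. x \<in> S \<Longrightarrow> f x = g x"
  shows "f differentiable_on S \<longleftrightarrow> g differentiable_on S"
  unfolding differentiable_on_def differentiable_def
  using assms has_derivative_transform[of _ S f g] has_derivative_transform[of _ S g f] by (metis)

lemma Ck_on_transform_open:
  assumes "open S" "\<And>x. x \<in> S \<Longrightarrow> f x = g x"
  shows "Ck_on n f S \<longleftrightarrow> Ck_on n g S"
  using assms(2)
proof (induction n arbitrary: f g)
  case 0 then show ?case by (simp cong: continuous_on_cong)
next
  case (Suc n)
  have "partial i f x = partial i g x" if "x \<in> S" for i x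
    using partial_transform_open[OF assms(1) that] Suc.prems by blast
  then show ?case
    using Suc.IH[of "partial i f" "partial i g" for i] differentiable_on_cong_open[of S f g] Suc.prems by auto
qed

text \<open>Iterated partial derivatives of a member of a family that differentiation maps into itself, up to
  values outside the open set, stay in the family. Each smoothness proof below exhibits such a family.\<close>
lemma smooth_on_stable_class:
  assumes "open S"
    and diff: "\<And>f x. f \<in> \<F> \<Longrightarrow> x \<in> S \<Longrightarrow> f differentiable (at x)"
    and part: "\<And>f i. f \<in> \<F> \<Longrightarrow> \<exists>g\<in>\<F>. \<forall>x\<in>S. partial i f x = g x"
    and "f \<in> \<F>"
  shows "smooth_on f S"
proof -
  have D: "f differentiable_on S" if "f \<in> \<F>" for f
    using diff[OF that] by (simp add: differentiable_at_imp_differentiable_on)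
  have "Ck_on n f S" if "f \<in> \<F>" for n f
    using that
  proof (induction n arbitrary: f)
    case 0 then show ?case using D differentiable_imp_continuous_on by auto
  next
    case (Suc n)
    have "Ck_on n (partial i f) S" for i
    proof -
      obtain g where g: "g \<in> \<F>" "\<forall>x\<in>S. partial i f x = g x" using part[OF Suc.prems] by blast
      then show ?thesis using Suc.IH[OF g(1)] Ck_on_transform_open[OF \<open>open S\<close>, of "partial i f" g] by auto
    qed
    then show ?case using D Suc.prems by simp
  qed
  then show ?thesis using \<open>f \<in> \<F>\<close> by (simp add: smooth_on_def)
qed

lemma smooth_on_differentiable_at:
  assumes "smooth_on f S" "open S" "x \<in> S"
  shows "f differentiable (at x)"
proof -
  have "Ck_on (Suc 0) f S" using assms unfolding smooth_on_def by blast
  then have "f differentiable_on S" by simp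
  then show ?thesis using assms at_within_open[of x S] unfolding differentiable_on_def by auto
qed

lemma smooth_on_partial: "smooth_on f S \<Longrightarrow> smooth_on (partial i f) S"
  unfolding smooth_on_def by (metis Ck_on.simps(2))

lemma smooth_on_continuous_on: "smooth_on f S \<Longrightarrow> continuous_on S f"
  unfolding smooth_on_def by (metis Ck_on.simps(1))

section \<open>The kernel solves the equation\<close>

text \<open>With \<open>Q\<close> a quadratic form, this family contains the elastic kernel and \<open>1 / norm z ^ 3\<close>, and it is
  stable under differentiation off the origin: the derivatives of \<open>1 / norm z\<close> and \<open>1 / Q z\<close> are
  \<open>- z$i / norm z ^ 3\<close> and a linear form over \<open>(Q z)\<^sup>2\<close>.\<close>
inductive_set rational_class :: "(real^2 \<Rightarrow> real) \<Rightarrow> (real^2 \<Rightarrow> real) set" for Q where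
  const: "(\<lambda>z. c) \<in> rational_class Q"
| coord: "(\<lambda>z. z$i) \<in> rational_class Q"
| inv_norm: "(\<lambda>z. inverse (norm z)) \<in> rational_class Q"
| inv_den: "(\<lambda>z. inverse (Q z)) \<in> rational_class Q"
| add: "f \<in> rational_class Q \<Longrightarrow> g \<in> rational_class Q \<Longrightarrow> (\<lambda>z. f z + g z) \<in> rational_class Q"
| mult: "f \<in> rational_class Q \<Longrightarrow> g \<in> rational_class Q \<Longrightarrow> (\<lambda>z. f z * g z) \<in> rational_class Q"

lemma rational_class_power: "f \<in> rational_class Q \<Longrightarrow> (\<lambda>z. f z ^ n) \<in> rational_class Q"
  by (induction n) (auto intro: rational_class.intros)

definition quad :: "real \<Rightarrow> real \<Rightarrow> real^2 \<Rightarrow> real" where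
  "quad a b z = a * (z$1)\<^sup>2 + b * (z$2)\<^sup>2"

lemma norm_real2: "norm (z::real^2) = sqrt ((z$1)\<^sup>2 + (z$2)\<^sup>2)"
  by (simp add: norm_vec_def L2_set_def UNIV_2)

lemma real2_nonzero_iff: "(z::real^2) \<noteq> 0 \<longleftrightarrow> z$1 \<noteq> 0 \<or> z$2 \<noteq> 0"
  by (auto simp: vec_eq_iff forall_2)

lemma quad_pos: "a > 0 \<Longrightarrow> b > 0 \<Longrightarrow> z \<noteq> 0 \<Longrightarrow> quad a b z > 0"
  unfolding quad_def real2_nonzero_iff
  by (smt (verit) mult_nonneg_nonneg mult_pos_pos zero_le_power2 zero_less_power2)

lemma has_derivative_coord: "((\<lambda>z::real^2. z$i) has_derivative (\<lambda>h. h$i)) (at z)"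
  by (rule bounded_linear_imp_has_derivative) (rule bounded_linear_vec_nth)

lemma rational_class_derivative:
  assumes "a > 0" "b > 0" "f \<in> rational_class (quad a b)"
  shows "\<exists>g1\<in>rational_class (quad a b). \<exists>g2\<in>rational_class (quad a b).
    \<forall>z. z \<noteq> 0 \<longrightarrow> (f has_derivative (\<lambda>h. g1 z * h$1 + g2 z * h$2)) (at z)"
  using assms(3)
proof induction
  case (const c)
  show ?case by (rule bexI[of _ "\<lambda>z. 0"], rule bexI[of _ "\<lambda>z. 0"]) (auto intro: rational_class.intros)
next
  case (coord i)
  show ?case
  proof (cases "i = 1")
    case True
    show ?thesis unfolding True
      by (rule bexI[of _ "\<lambda>z. 1"], rule bexI[of _ "\<lambda>z. 0"]) (auto intro: rational_class.intros has_derivative_coord)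
  next
    case False
    then have i2: "i = 2" using exhaust_2 by blast
    show ?thesis unfolding i2
      by (rule bexI[of _ "\<lambda>z. 0"], rule bexI[of _ "\<lambda>z. 1"]) (auto intro: rational_class.intros has_derivative_coord)
  qed
next
  case inv_norm
  let ?g = "\<lambda>i z. (-1) * (z$i) * inverse (norm z) ^ 3"
  have "((\<lambda>z. inverse (norm z)) has_derivative (\<lambda>h. ?g 1 z * h$1 + ?g 2 z * h$2)) (at z)"
    if "z \<noteq> 0" for z :: "real^2"
    apply (rule has_derivative_eq_rhs[OF Deriv.has_derivative_inverse[OF _ has_derivative_norm[OF that]]])
    using that by (auto simp: fun_eq_iff sgn_div_norm inner_vec_def UNIV_2 divide_simps power3_eq_cube algebra_simps)
  note d = this
  have m: "?g i \<in> rational_class (quad a b)" for i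
    by (intro rational_class.intros rational_class_power)
  show ?case
    by (rule bexI[OF bexI[OF _ m[of 2]] m[of 1]], intro allI impI, rule d)
next
  case inv_den
  let ?g = "\<lambda>c i z. (-2 * c) * (z$i) * inverse (quad a b z) ^ 2"
  have "((\<lambda>z. inverse (quad a b z)) has_derivative (\<lambda>h. ?g a 1 z * h$1 + ?g b 2 z * h$2)) (at z)"
    if "z \<noteq> 0" for z :: "real^2"
  proof -
    have q: "(quad a b has_derivative (\<lambda>h. 2 * a * z$1 * h$1 + 2 * b * z$2 * h$2)) (at z)"
      unfolding quad_def by (rule derivative_eq_intros has_derivative_coord refl)+ (simp add: algebra_simps)
    show ?thesis
      apply (rule has_derivative_eq_rhs[OF Deriv.has_derivative_inverse[OF _ q]])
      using quad_pos[OF assms(1,2) that] by (auto simp: fun_eq_iff divide_simps power2_eq_square algebra_simps)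
  qed
  note d = this
  have m: "?g c i \<in> rational_class (quad a b)" for c i
    by (intro rational_class.intros rational_class_power)
  show ?case
    by (rule bexI[OF bexI[OF _ m[of b 2]] m[of a 1]], intro allI impI, rule d)
next
  case (add f g)
  then obtain f1 f2 g1 g2 where [intro]: "f1 \<in> rational_class (quad a b)" "f2 \<in> rational_class (quad a b)"
      "g1 \<in> rational_class (quad a b)" "g2 \<in> rational_class (quad a b)"
    and d: "\<And>z. z \<noteq> 0 \<Longrightarrow> (f has_derivative (\<lambda>h. f1 z * h$1 + f2 z * h$2)) (at z)"
      "\<And>z. z \<noteq> 0 \<Longrightarrow> (g has_derivative (\<lambda>h. g1 z * h$1 + g2 z * h$2)) (at z)"
    by blast
  show ?case
    apply (rule bexI[of _ "\<lambda>z. f1 z + g1 z"], rule bexI[of _ "\<lambda>z. f2 z + g2 z"], intro allI impI)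
    by (auto intro!: rational_class.intros derivative_eq_intros d simp: algebra_simps)
next
  case (mult f g)
  then obtain f1 f2 g1 g2 where [intro]: "f1 \<in> rational_class (quad a b)" "f2 \<in> rational_class (quad a b)"
      "g1 \<in> rational_class (quad a b)" "g2 \<in> rational_class (quad a b)"
    and d: "\<And>z. z \<noteq> 0 \<Longrightarrow> (f has_derivative (\<lambda>h. f1 z * h$1 + f2 z * h$2)) (at z)"
      "\<And>z. z \<noteq> 0 \<Longrightarrow> (g has_derivative (\<lambda>h. g1 z * h$1 + g2 z * h$2)) (at z)"
    by blast
  note [intro] = mult.hyps
  show ?case
    apply (rule bexI[of _ "\<lambda>z. f1 z * g z + f z * g1 z"], rule bexI[of _ "\<lambda>z. f2 z * g z + f z * g2 z"], intro allI impI)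
    by (auto intro!: rational_class.intros derivative_eq_intros d simp: algebra_simps)
qed

lemma rational_class_smooth:
  assumes "a > 0" "b > 0" "f \<in> rational_class (quad a b)"
  shows "smooth_on f (- {0})"
proof (rule smooth_on_stable_class[OF _ _ _ assms(3)])
  show "f differentiable at x" if "f \<in> rational_class (quad a b)" "x \<in> - {0}" for f x
    using rational_class_derivative[OF assms(1,2) that(1)] that(2) unfolding differentiable_def by blast
  show "\<exists>g\<in>rational_class (quad a b). \<forall>x\<in>- {0}. partial i f x = g x" if fc: "f \<in> rational_class (quad a b)" for f i
  proof -
    obtain g1 g2 where g: "g1 \<in> rational_class (quad a b)" "g2 \<in> rational_class (quad a b)"
       "\<And>z. z \<noteq> 0 \<Longrightarrow> (f has_derivative (\<lambda>h. g1 z * h$1 + g2 z * h$2)) (at z)"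
      using rational_class_derivative[OF assms(1,2) fc] by blast
    have "partial 1 f x = g1 x" "partial 2 f x = g2 x" if "x \<noteq> 0" for x
      using partial_eq_derivative[OF g(3)[OF that]] by (auto simp: axis_def)
    then show ?thesis using g(1,2) exhaust_2[of i] by auto
  qed
qed auto

lemma elastic_kernel_eq:
  "elastic_kernel a b z = a * b * ((3 * a\<^sup>2 - 2 * a * b) * (z$1) ^ 4 + 2 * (3 * a\<^sup>2 - 5 * a * b + 3 * b\<^sup>2) * ((z$1)\<^sup>2 * (z$2)\<^sup>2)
      + (3 * b\<^sup>2 - 2 * a * b) * (z$2) ^ 4) * inverse (norm z) * inverse (quad a b z) ^ 3"
  unfolding elastic_kernel_def Let_def quad_def by (simp add: divide_simps)

lemma elastic_kernel_smooth:
  assumes "a > 0" "b > 0"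
  shows "smooth_on (elastic_kernel a b) (- {0})"
proof -
  have "elastic_kernel a b \<in> rational_class (quad a b)"
    unfolding elastic_kernel_eq[abs_def]
    by (intro rational_class.mult rational_class.add rational_class.intros rational_class_power)
  then show ?thesis using rational_class_smooth assms by blast
qed

text \<open>With \<open>\<rho> = norm z ^ 2\<close> along a coordinate line, differentiation raises the exponent of \<open>norm z\<close> by
  two and that of \<open>Q\<close> by one. Only the numerator needs bookkeeping, so the second derivatives of the
  kernel reduce to polynomials.\<close>
lemma DERIV_weighted_quotient:
  assumes "(P has_real_derivative P') (at t)" "(\<rho> has_real_derivative 2 * \<rho>') (at t)"
    "(Q has_real_derivative Q') (at t)" "\<rho> t > 0" "Q t \<noteq> 0"
  shows "((\<lambda>t. P t / (sqrt (\<rho> t) ^ m * Q t ^ n)) has_real_derivative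
     (P' * \<rho> t * Q t - P t * (real m * \<rho>' * Q t + real n * Q' * \<rho> t)) / (sqrt (\<rho> t) ^ (m + 2) * Q t ^ (n + 1))) (at t)"
proof -
  have s: "((\<lambda>t. sqrt (\<rho> t)) has_real_derivative \<rho>' / sqrt (\<rho> t)) (at t)"
    using DERIV_real_sqrt_generic[of "\<rho> t"] assms(4)
    by (auto intro!: derivative_eq_intros assms(2) simp: divide_simps)
  have [simp]: "sqrt (\<rho> t) > 0" using assms(4) by simp
  have r: "\<rho> t = sqrt (\<rho> t) * sqrt (\<rho> t)" using assms(4) by simp
  define R where "R = sqrt (\<rho> t)"
  have R: "R \<noteq> 0" "\<rho> t = R * R" using r assms(4) by (auto simp: R_def)
  have m: "real m * R ^ (m - Suc 0) * R = real m * R ^ m" by (cases m) auto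
  have n: "real n * Q t ^ (n - Suc 0) * Q t = real n * Q t ^ n" by (cases n) auto
  have "((\<lambda>t. P t / (sqrt (\<rho> t) ^ m * Q t ^ n)) has_real_derivative
    (P' * (R ^ m * Q t ^ n) - P t * ((real m * (\<rho>' / R * R ^ (m - Suc 0))) * Q t ^ n + R ^ m * (real n * (Q' * Q t ^ (n - Suc 0)))))
      / ((R ^ m * Q t ^ n) * (R ^ m * Q t ^ n))) (at t)"
    apply (rule DERIV_cong)
     apply (rule DERIV_divide DERIV_mult DERIV_power assms(1,3) s)+
    using assms(5) R(1) by (auto simp: R_def[symmetric] algebra_simps)
  also have "(P' * (R ^ m * Q t ^ n) - P t * ((real m * (\<rho>' / R * R ^ (m - Suc 0))) * Q t ^ n + R ^ m * (real n * (Q' * Q t ^ (n - Suc 0)))))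
      / ((R ^ m * Q t ^ n) * (R ^ m * Q t ^ n))
    = (P' * \<rho> t * Q t - P t * (real m * \<rho>' * Q t + real n * Q' * \<rho> t)) / (R ^ (m + 2) * Q t ^ (n + 1))"
  proof -
    have M: "real m * (\<rho>' / R * R ^ (m - Suc 0)) = real m * \<rho>' * R ^ m / (R * R)"
      using m R(1) by (simp add: field_simps)
    have N: "real n * (Q' * Q t ^ (n - Suc 0)) = real n * Q' * Q t ^ n / Q t"
      using n assms(5) by (simp add: field_simps)
    show ?thesis unfolding M N
      using R assms(5) by (simp add: divide_simps) (simp add: algebra_simps)
  qed
  finally show ?thesis by (simp add: R_def)
qed

abbreviation ker_A :: "real \<Rightarrow> real \<Rightarrow> real" where
  "ker_A a b \<equiv> 3 * a\<^sup>2 - 2 * a * b"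

abbreviation ker_B :: "real \<Rightarrow> real \<Rightarrow> real" where
  "ker_B a b \<equiv> 3 * a\<^sup>2 - 5 * a * b + 3 * b\<^sup>2"

text \<open>The kernel is \<open>a * b * ker_num / (norm z * Q ^ 3)\<close>. The polynomials \<open>ker_num1\<close> and \<open>ker_num11\<close> are the
  numerators of its first and second derivative in the first coordinate, over \<open>norm z ^ 3 * Q ^ 4\<close> and
  \<open>norm z ^ 5 * Q ^ 5\<close>. Derivatives in the second coordinate come from exchanging \<open>(a, x)\<close> with
  \<open>(b, y)\<close>, which leaves the kernel invariant.\<close>
definition ker_num :: "real \<Rightarrow> real \<Rightarrow> real \<Rightarrow> real \<Rightarrow> real" where
  "ker_num a b x y = ker_A a b * x ^ 4 + 2 * ker_B a b * (x\<^sup>2 * y\<^sup>2)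
      + ker_A b a * y ^ 4"

definition ker_num1 :: "real \<Rightarrow> real \<Rightarrow> real \<Rightarrow> real \<Rightarrow> real" where
  "ker_num1 a b x y = (let P = ker_num a b x y; Q = a * x\<^sup>2 + b * y\<^sup>2; \<rho> = x\<^sup>2 + y\<^sup>2;
       P' = 4 * ker_A a b * x ^ 3 + 4 * ker_B a b * (x * y\<^sup>2)
     in P' * \<rho> * Q - P * (x * Q + 6 * a * x * \<rho>))"

definition ker_num11 :: "real \<Rightarrow> real \<Rightarrow> real \<Rightarrow> real \<Rightarrow> real" where
  "ker_num11 a b x y = (let P = ker_num a b x y; Q = a * x\<^sup>2 + b * y\<^sup>2; \<rho> = x\<^sup>2 + y\<^sup>2;
       P' = 4 * ker_A a b * x ^ 3 + 4 * ker_B a b * (x * y\<^sup>2);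
       P'' = 12 * ker_A a b * x\<^sup>2 + 4 * ker_B a b * y\<^sup>2;
       P1' = P'' * \<rho> * Q + P' * (2 * x * Q + \<rho> * (2 * a * x)) - P' * (x * Q + 6 * a * x * \<rho>)
             - P * (Q + x * (2 * a * x) + 6 * a * \<rho> + 12 * a * x\<^sup>2)
     in P1' * \<rho> * Q - ker_num1 a b x y * (3 * x * Q + 8 * a * x * \<rho>))"

text \<open>The PDE multiplied by the common denominator: its right-hand side is \<open>9 * a * b / norm z ^ 5\<close>,
  since the Laplacian of \<open>norm z ^ (-3)\<close> in the plane is \<open>9 / norm z ^ 5\<close>.\<close>
lemma ker_num_pde:
  "b * ker_num11 a b x y + a * ker_num11 b a y x = 9 * (a * x\<^sup>2 + b * y\<^sup>2) ^ 5"
  unfolding ker_num11_def ker_num1_def ker_num_def Let_def by algebra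

lemma ker_num_sym: "ker_num b a y x = ker_num a b x y"
  unfolding ker_num_def by (simp add: algebra_simps)

lemma ker_deriv1:
  assumes "x\<^sup>2 + y\<^sup>2 > 0" "a * x\<^sup>2 + b * y\<^sup>2 > 0"
  shows "((\<lambda>x. ker_num a b x y / (sqrt (x\<^sup>2 + y\<^sup>2) ^ 1 * (a * x\<^sup>2 + b * y\<^sup>2) ^ 3)) has_real_derivative
     ker_num1 a b x y / (sqrt (x\<^sup>2 + y\<^sup>2) ^ 3 * (a * x\<^sup>2 + b * y\<^sup>2) ^ 4)) (at x)"
proof -
  have P: "((\<lambda>x. ker_num a b x y) has_real_derivative
    4 * ker_A a b * x ^ 3 + 4 * ker_B a b * (x * y\<^sup>2)) (at x)"
    unfolding ker_num_def by (rule derivative_eq_intros refl)+ (simp add: algebra_simps)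
  have r: "((\<lambda>x. x\<^sup>2 + y\<^sup>2) has_real_derivative 2 * x) (at x)"
    and Q: "((\<lambda>x. a * x\<^sup>2 + b * y\<^sup>2) has_real_derivative 2 * a * x) (at x)"
    by (auto intro!: derivative_eq_intros)
  show ?thesis
    using DERIV_weighted_quotient[OF P r Q, of 1 3] assms
    unfolding ker_num1_def Let_def by (simp add: algebra_simps eval_nat_numeral)
qed

lemma ker_deriv2:
  assumes "x\<^sup>2 + y\<^sup>2 > 0" "a * x\<^sup>2 + b * y\<^sup>2 > 0"
  shows "((\<lambda>x. ker_num1 a b x y / (sqrt (x\<^sup>2 + y\<^sup>2) ^ 3 * (a * x\<^sup>2 + b * y\<^sup>2) ^ 4)) has_real_derivative
     ker_num11 a b x y / (sqrt (x\<^sup>2 + y\<^sup>2) ^ 5 * (a * x\<^sup>2 + b * y\<^sup>2) ^ 5)) (at x)"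
proof -
  define P' where "P' x = 4 * ker_A a b * x ^ 3 + 4 * ker_B a b * (x * y\<^sup>2)" for x
  have P: "((\<lambda>x. ker_num a b x y) has_real_derivative P' x) (at x)"
    unfolding ker_num_def P'_def by (rule derivative_eq_intros refl)+ (simp add: algebra_simps)
  have P': "(P' has_real_derivative
     12 * ker_A a b * x\<^sup>2 + 4 * ker_B a b * y\<^sup>2) (at x)"
    unfolding P'_def by (rule derivative_eq_intros refl)+ (simp add: algebra_simps)
  have r: "((\<lambda>x. x\<^sup>2 + y\<^sup>2) has_real_derivative 2 * x) (at x)"
    and Q: "((\<lambda>x. a * x\<^sup>2 + b * y\<^sup>2) has_real_derivative 2 * a * x) (at x)"
    by (auto intro!: derivative_eq_intros)
  have P1: "((\<lambda>x. ker_num1 a b x y) has_real_derivative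
     (12 * ker_A a b * x\<^sup>2 + 4 * ker_B a b * y\<^sup>2) * (x\<^sup>2 + y\<^sup>2) * (a * x\<^sup>2 + b * y\<^sup>2)
       + P' x * (2 * x * (a * x\<^sup>2 + b * y\<^sup>2) + (x\<^sup>2 + y\<^sup>2) * (2 * a * x)) - P' x * (x * (a * x\<^sup>2 + b * y\<^sup>2) + 6 * a * x * (x\<^sup>2 + y\<^sup>2))
       - ker_num a b x y * ((a * x\<^sup>2 + b * y\<^sup>2) + x * (2 * a * x) + 6 * a * (x\<^sup>2 + y\<^sup>2) + 12 * a * x\<^sup>2)) (at x)"
    unfolding ker_num1_def Let_def P'_def[symmetric]
    by (rule derivative_eq_intros P P' refl)+ (simp add: algebra_simps power2_eq_square)
  show ?thesis
    using DERIV_weighted_quotient[OF P1 r Q, of 3 4] assms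
    unfolding ker_num11_def Let_def P'_def by (simp add: algebra_simps eval_nat_numeral)
qed

lemma real2_axis_shift [simp]:
  "(z + t *\<^sub>R axis 1 1 :: real^2) $ 1 = z$1 + t" "(z + t *\<^sub>R axis 1 1 :: real^2) $ 2 = z$2"
  "(z + t *\<^sub>R axis 2 1 :: real^2) $ 1 = z$1" "(z + t *\<^sub>R axis 2 1 :: real^2) $ 2 = z$2 + t"
  by (auto simp: axis_def)

lemma DERIV_shift_0: "(f has_real_derivative d) (at (x::real)) \<Longrightarrow> ((\<lambda>t. f (x + t)) has_real_derivative d) (at 0)"
  using DERIV_shift[of f d 0 x] by (simp add: add.commute)

lemma partial_partial_eqI:
  fixes f :: "real^2 \<Rightarrow> real"
  assumes "smooth_on f (- {0})" "z \<noteq> 0"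
    and 1: "\<And>z. z \<noteq> 0 \<Longrightarrow> ((\<lambda>t. f (z + t *\<^sub>R axis i 1)) has_real_derivative g z) (at 0)"
    and 2: "((\<lambda>t. g (z + t *\<^sub>R axis i 1)) has_real_derivative d) (at 0)"
  shows "partial i (partial i f) z = d"
proof -
  have g: "partial i f z = g z" if "z \<noteq> 0" for z
    using partial_eqI[OF smooth_on_differentiable_at[OF assms(1)] 1] that by auto
  have c: "partial i (partial i f) z = partial i g z"
    using partial_transform_open[of "- {0}" z "partial i f" g] g assms(2) by auto
  have "g differentiable_on (- {0})"
    using differentiable_on_cong_open[of "-{0}" "partial i f" g] g smooth_on_partial[OF assms(1), of i]
    by (metis ComplD Ck_on.simps(2) singletonI smooth_on_def)
  then have "g differentiable (at z)"
    using assms(2) at_within_open[of z "- {0}"] unfolding differentiable_on_def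
    by (metis ComplI empty_iff insert_iff open_Compl closed_singleton)
  then show ?thesis using partial_eqI 2 c by simp
qed

lemma elastic_kernel_ker_num:
  "elastic_kernel a b z = a * b * (ker_num a b (z$1) (z$2) / (sqrt ((z$1)\<^sup>2 + (z$2)\<^sup>2) ^ 1 * (a * (z$1)\<^sup>2 + b * (z$2)\<^sup>2) ^ 3))"
  unfolding elastic_kernel_eq ker_num_def norm_real2 quad_def by (simp add: divide_simps)

lemma sum_squares_pos: "(z::real^2) \<noteq> 0 \<Longrightarrow> (z$1)\<^sup>2 + (z$2)\<^sup>2 > 0"
  by (metis real2_nonzero_iff sum_power2_gt_zero_iff)

lemma elastic_kernel_partial11:
  assumes "a > 0" "b > 0" "z \<noteq> 0"
  shows "partial 1 (partial 1 (elastic_kernel a b)) z =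
    a * b * (ker_num11 a b (z$1) (z$2) / (norm z ^ 5 * quad a b z ^ 5))"
proof -
  let ?g = "\<lambda>z. a * b * (ker_num1 a b (z$1) (z$2) / (sqrt ((z$1)\<^sup>2 + (z$2)\<^sup>2) ^ 3 * (a * (z$1)\<^sup>2 + b * (z$2)\<^sup>2) ^ 4))"
  show ?thesis
  proof (rule partial_partial_eqI[where g="?g"])
    show "((\<lambda>t. elastic_kernel a b (z + t *\<^sub>R axis 1 1)) has_real_derivative ?g z) (at 0)" if "z \<noteq> 0" for z
      unfolding elastic_kernel_ker_num real2_axis_shift
      by (intro DERIV_cmult DERIV_shift_0[where f="\<lambda>x. ker_num a b x (z$2) / (sqrt (x\<^sup>2 + (z$2)\<^sup>2) ^ 1 * (a * x\<^sup>2 + b * (z$2)\<^sup>2) ^ 3)"]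
         ker_deriv1 sum_squares_pos that quad_pos[OF assms(1,2) that, unfolded quad_def])
    show "((\<lambda>t. ?g (z + t *\<^sub>R axis 1 1)) has_real_derivative
       a * b * (ker_num11 a b (z$1) (z$2) / (norm z ^ 5 * quad a b z ^ 5))) (at 0)"
      unfolding real2_axis_shift norm_real2 quad_def
      by (intro DERIV_cmult DERIV_shift_0[where f="\<lambda>x. ker_num1 a b x (z$2) / (sqrt (x\<^sup>2 + (z$2)\<^sup>2) ^ 3 * (a * x\<^sup>2 + b * (z$2)\<^sup>2) ^ 4)"]
         ker_deriv2 sum_squares_pos assms quad_pos[OF assms, unfolded quad_def])
  qed (use assms elastic_kernel_smooth in auto)
qed

lemma elastic_kernel_partial22:
  assumes "a > 0" "b > 0" "z \<noteq> 0"
  shows "partial 2 (partial 2 (elastic_kernel a b)) z =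
    a * b * (ker_num11 b a (z$2) (z$1) / (norm z ^ 5 * quad a b z ^ 5))"
proof -
  let ?g = "\<lambda>z. a * b * (ker_num1 b a (z$2) (z$1) / (sqrt ((z$2)\<^sup>2 + (z$1)\<^sup>2) ^ 3 * (b * (z$2)\<^sup>2 + a * (z$1)\<^sup>2) ^ 4))"
  show ?thesis
  proof (rule partial_partial_eqI[where g="?g"])
    have q: "b * (z$2)\<^sup>2 + a * (z$1)\<^sup>2 > 0" "(z$2)\<^sup>2 + (z$1)\<^sup>2 > 0" if "z \<noteq> 0" for z :: "real^2"
      using sum_squares_pos[OF that] quad_pos[OF assms(1,2) that] by (auto simp: quad_def add.commute)
    have k: "elastic_kernel a b z = a * b * (ker_num b a (z$2) (z$1) / (sqrt ((z$2)\<^sup>2 + (z$1)\<^sup>2) ^ 1 * (b * (z$2)\<^sup>2 + a * (z$1)\<^sup>2) ^ 3))" for z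
      unfolding elastic_kernel_ker_num by (simp add: ker_num_sym add.commute)
    show "((\<lambda>t. elastic_kernel a b (z + t *\<^sub>R axis 2 1)) has_real_derivative ?g z) (at 0)" if "z \<noteq> 0" for z
      unfolding k real2_axis_shift
      by (intro DERIV_cmult DERIV_shift_0[where f="\<lambda>x. ker_num b a x (z$1) / (sqrt (x\<^sup>2 + (z$1)\<^sup>2) ^ 1 * (b * x\<^sup>2 + a * (z$1)\<^sup>2) ^ 3)"]
         ker_deriv1 q that)
    have n: "norm z = sqrt ((z$2)\<^sup>2 + (z$1)\<^sup>2)" "quad a b z = b * (z$2)\<^sup>2 + a * (z$1)\<^sup>2"
      by (auto simp: norm_real2 quad_def add.commute)
    show "((\<lambda>t. ?g (z + t *\<^sub>R axis 2 1)) has_real_derivative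
       a * b * (ker_num11 b a (z$2) (z$1) / (norm z ^ 5 * quad a b z ^ 5))) (at 0)"
      unfolding real2_axis_shift n
      by (intro DERIV_cmult DERIV_shift_0[where f="\<lambda>x. ker_num1 b a x (z$1) / (sqrt (x\<^sup>2 + (z$1)\<^sup>2) ^ 3 * (b * x\<^sup>2 + a * (z$1)\<^sup>2) ^ 4)"]
         ker_deriv2 q assms)
  qed (use assms elastic_kernel_smooth in auto)
qed

lemma inverse_cube_smooth: "smooth_on (\<lambda>z::real^2. 1 / norm z ^ 3) (- {0})"
proof -
  have "(\<lambda>z::real^2. inverse (norm z) ^ 3) \<in> rational_class (quad 1 1)"
    by (intro rational_class.intros rational_class_power)
  then show ?thesis using rational_class_smooth[of 1 1] by (simp add: power_inverse divide_inverse)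
qed

lemma inverse_cube_derivs:
  assumes "x\<^sup>2 + y\<^sup>2 > (0::real)"
  shows "((\<lambda>x. 1 / sqrt (x\<^sup>2 + y\<^sup>2) ^ 3) has_real_derivative -3 * x / sqrt (x\<^sup>2 + y\<^sup>2) ^ 5) (at x)"
    and "((\<lambda>x. -3 * x / sqrt (x\<^sup>2 + y\<^sup>2) ^ 5) has_real_derivative (12 * x\<^sup>2 - 3 * y\<^sup>2) / sqrt (x\<^sup>2 + y\<^sup>2) ^ 7) (at x)"
proof -
  have r: "((\<lambda>x. x\<^sup>2 + y\<^sup>2) has_real_derivative 2 * x) (at x)"
    and l: "((\<lambda>x. -3 * x) has_real_derivative -3) (at x)"
    by (auto intro!: derivative_eq_intros)
  show "((\<lambda>x. 1 / sqrt (x\<^sup>2 + y\<^sup>2) ^ 3) has_real_derivative -3 * x / sqrt (x\<^sup>2 + y\<^sup>2) ^ 5) (at x)"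
    using DERIV_weighted_quotient[OF DERIV_const[of 1] r DERIV_const[of 1], of 3 0] assms by simp
  show "((\<lambda>x. -3 * x / sqrt (x\<^sup>2 + y\<^sup>2) ^ 5) has_real_derivative (12 * x\<^sup>2 - 3 * y\<^sup>2) / sqrt (x\<^sup>2 + y\<^sup>2) ^ 7) (at x)"
    using DERIV_weighted_quotient[OF l r DERIV_const[of 1], of 5 0] assms
    by (simp add: algebra_simps power2_eq_square)
qed

lemma inverse_cube_laplacian:
  assumes "z \<noteq> (0::real^2)"
  shows "partial 1 (partial 1 (\<lambda>y. 1 / norm y ^ 3)) z + partial 2 (partial 2 (\<lambda>y. 1 / norm y ^ 3)) z = 9 / norm z ^ 5"
proof -
  have n1: "norm z = sqrt ((z$1)\<^sup>2 + (z$2)\<^sup>2)" and n2: "norm z = sqrt ((z$2)\<^sup>2 + (z$1)\<^sup>2)" for z :: "real^2"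
    by (auto simp: norm_real2 add.commute)
  have 1: "partial 1 (partial 1 (\<lambda>y. 1 / norm y ^ 3)) z = (12 * (z$1)\<^sup>2 - 3 * (z$2)\<^sup>2) / norm z ^ 7"
  proof (rule partial_partial_eqI[OF inverse_cube_smooth assms, where g="\<lambda>z. -3 * z$1 / norm z ^ 5"])
    show "((\<lambda>t. 1 / norm (z + t *\<^sub>R axis 1 1) ^ 3) has_real_derivative -3 * z$1 / norm z ^ 5) (at 0)" if "z \<noteq> 0" for z :: "real^2"
      unfolding n1 real2_axis_shift
      by (rule DERIV_shift_0[where f="\<lambda>x. 1 / sqrt (x\<^sup>2 + (z$2)\<^sup>2) ^ 3"]) (intro inverse_cube_derivs sum_squares_pos that)
    show "((\<lambda>t. -3 * (z + t *\<^sub>R axis 1 1)$1 / norm (z + t *\<^sub>R axis 1 1) ^ 5) has_real_derivative (12 * (z$1)\<^sup>2 - 3 * (z$2)\<^sup>2) / norm z ^ 7) (at 0)"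
      unfolding n1 real2_axis_shift
      by (rule DERIV_shift_0[where f="\<lambda>x. -3 * x / sqrt (x\<^sup>2 + (z$2)\<^sup>2) ^ 5"]) (intro inverse_cube_derivs sum_squares_pos assms)
  qed
  have q: "(z$2)\<^sup>2 + (z$1)\<^sup>2 > 0" if "z \<noteq> 0" for z :: "real^2"
    using sum_squares_pos[OF that] by (simp add: add.commute)
  have 2: "partial 2 (partial 2 (\<lambda>y. 1 / norm y ^ 3)) z = (12 * (z$2)\<^sup>2 - 3 * (z$1)\<^sup>2) / norm z ^ 7"
  proof (rule partial_partial_eqI[OF inverse_cube_smooth assms, where g="\<lambda>z. -3 * z$2 / norm z ^ 5"])
    show "((\<lambda>t. 1 / norm (z + t *\<^sub>R axis 2 1) ^ 3) has_real_derivative -3 * z$2 / norm z ^ 5) (at 0)" if "z \<noteq> 0" for z :: "real^2"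
      unfolding n2 real2_axis_shift
      by (rule DERIV_shift_0[where f="\<lambda>x. 1 / sqrt (x\<^sup>2 + (z$1)\<^sup>2) ^ 3"]) (intro inverse_cube_derivs q that)
    show "((\<lambda>t. -3 * (z + t *\<^sub>R axis 2 1)$2 / norm (z + t *\<^sub>R axis 2 1) ^ 5) has_real_derivative (12 * (z$2)\<^sup>2 - 3 * (z$1)\<^sup>2) / norm z ^ 7) (at 0)"
      unfolding n2 real2_axis_shift
      by (rule DERIV_shift_0[where f="\<lambda>x. -3 * x / sqrt (x\<^sup>2 + (z$1)\<^sup>2) ^ 5"]) (intro inverse_cube_derivs q assms)
  qed
  have "(norm z)\<^sup>2 = (z$1)\<^sup>2 + (z$2)\<^sup>2" using sum_squares_pos[OF assms] by (simp add: norm_real2)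
  moreover have "norm z ^ 7 = norm z ^ 5 * (norm z)\<^sup>2" by (simp flip: power_add)
  ultimately show ?thesis
    unfolding 1 2 add_divide_distrib[symmetric] using sum_squares_pos[OF assms] assms
    by (simp add: divide_simps) (auto simp: real2_nonzero_iff)
qed

lemma elastic_kernel_solution:
  assumes "a > 0" "b > 0"
  shows "smooth_kernel_solution a b (elastic_kernel a b)"
  unfolding smooth_kernel_solution_def
proof (intro conjI allI impI elastic_kernel_smooth assms)
  fix z :: "real^2" assume z: "z \<noteq> 0"
  have "b * (a * b * (ker_num11 a b (z$1) (z$2) / (norm z ^ 5 * quad a b z ^ 5)))
      + a * (a * b * (ker_num11 b a (z$2) (z$1) / (norm z ^ 5 * quad a b z ^ 5)))
    = a * b * ((b * ker_num11 a b (z$1) (z$2) + a * ker_num11 b a (z$2) (z$1)) / (norm z ^ 5 * quad a b z ^ 5))"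
    by (simp add: algebra_simps add_divide_distrib)
  also have "\<dots> = a * b * (9 / norm z ^ 5)"
    using quad_pos[OF assms z] unfolding ker_num_pde quad_def by simp
  finally show "b * partial 1 (partial 1 (elastic_kernel a b)) z + a * partial 2 (partial 2 (elastic_kernel a b)) z
        = a * b * (partial 1 (partial 1 (\<lambda>y. 1 / norm y ^ 3)) z + partial 2 (partial 2 (\<lambda>y. 1 / norm y ^ 3)) z)"
    unfolding inverse_cube_laplacian[OF z] elastic_kernel_partial11[OF assms z] elastic_kernel_partial22[OF assms z] .
qed

section \<open>Slope coordinates in the plane\<close>

abbreviation lborel2 :: "('a::euclidean_space \<times> 'b::euclidean_space) measure" where
  "lborel2 \<equiv> lborel \<Otimes>\<^sub>M lborel"

definition plane :: "real \<times> real \<Rightarrow> real^2" where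
  "plane p = fst p *\<^sub>R axis 1 1 + snd p *\<^sub>R axis 2 1"

lemma plane_nth [simp]: "plane p $ 1 = fst p" "plane p $ 2 = snd p"
  by (auto simp: plane_def axis_def)

lemma plane_measurable [measurable]: "plane \<in> borel_measurable borel"
  unfolding plane_def[abs_def] by (intro borel_measurable_continuous_onI continuous_intros)

lemma plane_measurable_pair [measurable]: "plane \<in> borel_measurable lborel2"
  using plane_measurable by (simp add: lborel_prod)

lemma Basis_real2: "(Basis :: (real^2) set) = {axis 1 1, axis 2 1}"
  unfolding Basis_vec_def by (auto simp: exhaust_2) (metis exhaust_2)

lemma axis_1_neq_2: "(axis 1 1 :: real^2) \<noteq> axis 2 1"
  by (simp add: axis_eq_axis)

lemma lborel_plane: "lborel = distr lborel2 borel plane"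
proof (rule lborel_eqI)
  fix l u :: "real^2" assume lu: "\<And>b. b \<in> Basis \<Longrightarrow> l \<bullet> b \<le> u \<bullet> b"
  have "plane -` box l u \<inter> space lborel2 = {l$1<..<u$1} \<times> {l$2<..<u$2}"
    by (auto simp: mem_box Basis_real2 inner_axis space_pair_measure)
  moreover have "l$1 \<le> u$1" "l$2 \<le> u$2"
    using lu[of "axis 1 1"] lu[of "axis 2 1"] by (auto simp: Basis_real2 inner_axis)
  ultimately show "emeasure (distr lborel2 borel plane) (box l u) = ennreal (\<Prod>b\<in>Basis. (u - l) \<bullet> b)"
    using axis_1_neq_2
    by (simp add: emeasure_distr lborel.emeasure_pair_measure_Times Basis_real2 inner_axis inner_diff_left ennreal_mult)
qed simp

text \<open>On each vertical line with abscissa \<open>s \<noteq> 0\<close> the substitution \<open>y$2 = s * t\<close> scales Lebesgue measure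
  by \<open>\<bar>s\<bar>\<close>. In these coordinates a function that is homogeneous of degree \<open>-3\<close> splits into \<open>\<bar>s\<bar> ^ (-3)\<close>
  times a function of the slope \<open>t\<close>.\<close>
lemma lborel_slope:
  "lborel = distr (density lborel2 (\<lambda>(t, s). ennreal \<bar>s\<bar>)) borel (\<lambda>(t, s). plane (s, s * t))"
proof (rule measure_eqI)
  fix A :: "(real^2) set" assume "A \<in> sets lborel"
  then have [measurable]: "A \<in> sets borel" by simp
  have [measurable]: "(\<lambda>(t, s). plane (s, s * t)) \<in> borel_measurable lborel2"
    by measurable
  have "emeasure (distr (density lborel2 (\<lambda>(t, s). ennreal \<bar>s\<bar>)) borel (\<lambda>(t, s). plane (s, s * t))) A
      = (\<integral>\<^sup>+ y. indicator A y \<partial>distr (density lborel2 (\<lambda>(t, s). ennreal \<bar>s\<bar>)) borel (\<lambda>(t, s). plane (s, s * t)))"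
    by simp
  also have "\<dots> = (\<integral>\<^sup>+ p. (case p of (t, s) \<Rightarrow> ennreal \<bar>s\<bar>) * indicator A (case p of (t, s) \<Rightarrow> plane (s, s * t)) \<partial>lborel2)"
    by (subst nn_integral_distr, simp, simp) (subst nn_integral_density, auto)
  also have "\<dots> = (\<integral>\<^sup>+ s. (\<integral>\<^sup>+ t. ennreal \<bar>s\<bar> * indicator A (plane (s, s * t)) \<partial>lborel) \<partial>lborel)"
    by (subst lborel_pair.nn_integral_snd[symmetric]) auto
  also have "\<dots> = (\<integral>\<^sup>+ s. (\<integral>\<^sup>+ t. indicator A (plane (s, t)) \<partial>lborel) \<partial>lborel)"
  proof (rule nn_integral_cong_AE)
    show "AE s in lborel. (\<integral>\<^sup>+ t. ennreal \<bar>s\<bar> * indicator A (plane (s, s * t)) \<partial>lborel) = (\<integral>\<^sup>+ t. indicator A (plane (s, t)) \<partial>lborel)"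
      using AE_lborel_singleton[of "0::real"]
    proof eventually_elim
      case (elim s)
      show ?case
        using nn_integral_real_affine[of "\<lambda>t. indicator A (plane (s, t))" s 0] elim
        by (simp add: nn_integral_cmult)
    qed
  qed
  also have "\<dots> = (\<integral>\<^sup>+ p. indicator A (plane p) \<partial>lborel2)"
    by (subst lborel.nn_integral_fst[symmetric]) auto
  also have "\<dots> = (\<integral>\<^sup>+ y. indicator A y \<partial>distr lborel2 borel plane)"
    by (subst nn_integral_distr) auto
  also have "\<dots> = emeasure lborel A"
    by (simp add: lborel_plane[symmetric])
  finally show "emeasure lborel A = emeasure (distr (density lborel2 (\<lambda>(t, s). ennreal \<bar>s\<bar>)) borel (\<lambda>(t, s). plane (s, s * t))) A"
    by simp
qed simp

lemma slope_integral:
  fixes f :: "real^2 \<Rightarrow> 'b::{banach, second_countable_topology}"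
  assumes [measurable]: "f \<in> borel_measurable borel"
  shows "integrable lborel f \<longleftrightarrow> integrable lborel2 (\<lambda>(t, s). \<bar>s\<bar> *\<^sub>R f (plane (s, s * t)))" (is ?A)
    and "(LINT y|lborel. f y) = (LINT p|lborel2. (case p of (t, s) \<Rightarrow> \<bar>s\<bar> *\<^sub>R f (plane (s, s * t))))" (is ?B)
proof -
  have [measurable]: "(\<lambda>(t, s). plane (s, s * t)) \<in> borel_measurable lborel2"
    by measurable
  have "integrable lborel f \<longleftrightarrow> integrable (distr (density lborel2 (\<lambda>(t, s). ennreal \<bar>s\<bar>)) borel (\<lambda>(t, s). plane (s, s * t))) f"
    by (rule arg_cong[OF lborel_slope])
  also have "\<dots> \<longleftrightarrow> integrable (density lborel2 (\<lambda>p. ennreal \<bar>snd p\<bar>)) (\<lambda>p. f (plane (snd p, snd p * fst p)))"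
    by (subst integrable_distr_eq) (auto simp: case_prod_beta')
  also have "\<dots> \<longleftrightarrow> integrable lborel2 (\<lambda>p. \<bar>snd p\<bar> *\<^sub>R f (plane (snd p, snd p * fst p)))"
    by (rule integrable_density) auto
  finally show ?A by (simp add: case_prod_beta')
  have "(LINT y|lborel. f y) = (LINT y|distr (density lborel2 (\<lambda>(t, s). ennreal \<bar>s\<bar>)) borel (\<lambda>(t, s). plane (s, s * t)). f y)"
    by (rule arg_cong[OF lborel_slope])
  also have "\<dots> = (LINT p|density lborel2 (\<lambda>p. ennreal \<bar>snd p\<bar>). f (plane (snd p, snd p * fst p)))"
    by (subst integral_distr) (auto simp: case_prod_beta')
  also have "\<dots> = (LINT p|lborel2. \<bar>snd p\<bar> *\<^sub>R f (plane (snd p, snd p * fst p)))"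
    by (rule integral_density) auto
  finally show ?B by (simp add: case_prod_beta')
qed

lemma product_integrable_plane:
  assumes "integrable lborel f" "integrable lborel g"
  shows "integrable lborel (\<lambda>y::real^2. (f (y$1) * g (y$2) :: complex))"
    and "(LINT y::real^2|lborel. f (y$1) * g (y$2)) = (LINT s|lborel. f s) * (LINT t|lborel. g t)"
proof -
  have [measurable]: "f \<in> borel_measurable borel" "g \<in> borel_measurable borel"
    using assms by (auto dest: borel_measurable_integrable)
  have [measurable]: "(\<lambda>y::real^2. y$i) \<in> borel_measurable borel" for i
    by (intro borel_measurable_continuous_onI continuous_intros)
  have i: "integrable lborel2 (\<lambda>p. f (fst p) * g (snd p))"
  proof (rule lborel_pair.Fubini_integrable)
    show "integrable lborel (\<lambda>x. LINT y|lborel. norm (f (fst (x, y)) * g (snd (x, y))))"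
      using assms by (simp add: norm_mult)
    show "AE x in lborel. integrable lborel (\<lambda>y. f (fst (x, y)) * g (snd (x, y)))"
      using assms by simp
  qed measurable
  show "integrable lborel (\<lambda>y::real^2. f (y$1) * g (y$2))"
    by (subst lborel_plane, subst integrable_distr_eq) (use i in auto)
  show "(LINT y::real^2|lborel. f (y$1) * g (y$2)) = (LINT s|lborel. f s) * (LINT t|lborel. g t)"
    by (subst lborel_plane, subst integral_distr, simp, simp, simp add: lborel_pair.integral_fst'[OF i, symmetric])
qed

lemma integrable_inverse_1_plus_square_real: "integrable lborel (\<lambda>x::real. inverse (1 + x\<^sup>2))"
  using integrable_inverse_1_plus_square by (simp add: set_integrable_def)

text \<open>For \<open>c = 1\<close> an antiderivative on the half-line is \<open>Si s - (1 - cos s) / s\<close>, which runs from \<open>0\<close> to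
  \<open>pi / 2\<close>; evenness and scaling give the rest.\<close>
lemma integral_one_minus_cos:
  "has_bochner_integral lborel (\<lambda>s::real. (1 - cos (c * s)) / s\<^sup>2) (pi * \<bar>c\<bar>)"
proof -
  let ?F = "\<lambda>s. Si s - (1 - cos s) / s"
  have D: "(?F has_real_derivative (1 - cos x) / x\<^sup>2) (at x)" if "0 < ereal x" for x
    using that by (auto intro!: derivative_eq_intros DERIV_Si simp: field_simps power2_eq_square)
  have C: "isCont (\<lambda>x. (1 - cos x) / x\<^sup>2) x" if "0 < ereal x" for x :: real
    using that by (auto intro!: continuous_intros)
  have "(Si \<longlongrightarrow> Si 0) (at_right 0)"
    using isCont_Si[of 0] by (auto simp: isCont_def intro: tendsto_mono[OF at_le])
  moreover have Si0: "Si 0 = 0" by (simp add: Si_def zero_ereal_def)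
  ultimately have "(?F \<longlongrightarrow> 0 - 0) (at_right 0)"
    by (intro tendsto_diff) (simp, real_asymp)
  from this[simplified] have L0: "((?F \<circ> real_of_ereal) \<longlongrightarrow> 0) (at_right 0)"
    unfolding zero_ereal_def ereal_tendsto_simps .
  have "(?F \<longlongrightarrow> pi / 2 - 0) at_top"
    by (intro tendsto_diff Si_at_top) real_asymp
  then have L1: "((?F \<circ> real_of_ereal) \<longlongrightarrow> pi / 2) (at_left \<infinity>)"
    by (simp add: ereal_tendsto_simps)
  have *: "set_integrable lborel (einterval 0 \<infinity>) (\<lambda>s::real. (1 - cos s) / s\<^sup>2)"
    by (rule interval_integral_FTC_nonneg(1)[OF _ D C _ L0 L1]) auto
  have **: "(LBINT s=0..\<infinity>. (1 - cos s) / s\<^sup>2) = pi / 2 - 0"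
    by (rule interval_integral_FTC_nonneg(2)[OF _ D C _ L0 L1]) auto
  have "has_bochner_integral lborel (\<lambda>s::real. indicator {0..} s *\<^sub>R ((1 - cos s) / s\<^sup>2)) (pi / 2)"
  proof -
    have e: "indicator {0..} s *\<^sub>R ((1 - cos s) / s\<^sup>2) = indicator {0<..} s *\<^sub>R ((1 - cos s) / s\<^sup>2)" for s :: real
      by (auto simp: indicator_def)
    have "einterval 0 \<infinity> = {0::real<..}" by (auto simp: einterval_def)
    then show ?thesis
      using * ** unfolding e has_bochner_integral_iff
      by (simp add: set_integrable_def interval_lebesgue_integral_def set_lebesgue_integral_def)
  qed
  from has_bochner_integral_even_function[OF this]
  have 1: "has_bochner_integral lborel (\<lambda>s::real. (1 - cos s) / s\<^sup>2) pi" by simp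
  show ?thesis
  proof (cases "c = 0")
    case False
    have h: "has_bochner_integral lborel (\<lambda>s. (1 - cos (0 + c * s)) / (0 + c * s)\<^sup>2) (pi /\<^sub>R \<bar>c\<bar>)"
      using lborel_has_bochner_integral_real_affine_iff[OF False, of "\<lambda>s. (1 - cos s) / s\<^sup>2" pi 0] 1 by simp
    have e1: "c\<^sup>2 * ((1 - cos (0 + c * s)) / (0 + c * s)\<^sup>2) = (1 - cos (c * s)) / s\<^sup>2" for s
      using False by (simp add: power_mult_distrib)
    have e2: "c\<^sup>2 * (pi /\<^sub>R \<bar>c\<bar>) = pi * \<bar>c\<bar>"
      using False by (simp add: field_simps flip: power2_eq_square)
    show ?thesis
      using has_bochner_integral_mult_right[of "c\<^sup>2", OF h] unfolding e1 e2 .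
  qed (simp add: has_bochner_integral_zero)
qed

section \<open>The kernel as second derivative of the symbol\<close>

text \<open>The symbol at \<open>(t, 1)\<close>, its derivative in \<open>t\<close>, and the kernel at \<open>(1, t)\<close>. The line on which the kernel is
  read off is the rotation by a right angle of the line on which the symbol is.\<close>
definition profile :: "real \<Rightarrow> real \<Rightarrow> real \<Rightarrow> real" where
  "profile a b t = a * b * sqrt (1 + t\<^sup>2) ^ 3 / (a + b * t\<^sup>2)"

definition profile' :: "real \<Rightarrow> real \<Rightarrow> real \<Rightarrow> real" where
  "profile' a b t = a * b * t * sqrt (1 + t\<^sup>2) * (3 * a - 2 * b + b * t\<^sup>2) / (a + b * t\<^sup>2)\<^sup>2"

definition slope_kernel :: "real \<Rightarrow> real \<Rightarrow> real \<Rightarrow> real" where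
  "slope_kernel a b t = a * b * ker_num a b 1 t / (sqrt (1 + t\<^sup>2) * (a + b * t\<^sup>2) ^ 3)"

lemma one_plus_sq_pos: "1 + (t::real)\<^sup>2 > 0"
  by (smt (verit) zero_le_power2)

locale positive_moduli =
  fixes a b :: real
  assumes a: "a > 0" and b: "b > 0"
begin

lemma den_pos: "a + b * t\<^sup>2 > 0"
  using a b by (meson add_pos_nonneg less_imp_le mult_nonneg_nonneg zero_le_power2)

lemma DERIV_profile: "(profile a b has_real_derivative profile' a b t) (at t)"
proof -
  have P: "((\<lambda>t. a * b * (1 + t\<^sup>2)\<^sup>2) has_real_derivative a * b * (4 * t * (1 + t\<^sup>2))) (at t)"
    by (auto intro!: derivative_eq_intros)
  have r: "((\<lambda>t. 1 + t\<^sup>2) has_real_derivative 2 * t) (at t)"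
    and Q: "((\<lambda>t. a + b * t\<^sup>2) has_real_derivative 2 * b * t) (at t)"
    by (auto intro!: derivative_eq_intros)
  have s: "sqrt (1 + t\<^sup>2) ^ 2 = 1 + t\<^sup>2" "sqrt (1 + t\<^sup>2) > 0" for t :: real
    using one_plus_sq_pos[of t] by auto
  have e: "profile a b t = a * b * (1 + t\<^sup>2)\<^sup>2 / (sqrt (1 + t\<^sup>2) ^ 1 * (a + b * t\<^sup>2) ^ 1)" for t
  proof -
    have "sqrt (1 + t\<^sup>2) ^ 3 = (1 + t\<^sup>2)\<^sup>2 / sqrt (1 + t\<^sup>2)"
    proof -
      have "r ^ 3 = (r\<^sup>2)\<^sup>2 / r" if "r > 0" for r :: real
        using that by (simp add: field_simps eval_nat_numeral)
      from this[OF s(2)[of t]] show ?thesis unfolding s(1) .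
    qed
    then show ?thesis by (simp add: profile_def)
  qed
  have "(a * b * (4 * t * (1 + t\<^sup>2)) * (1 + t\<^sup>2) * (a + b * t\<^sup>2) -
      a * b * (1 + t\<^sup>2)\<^sup>2 * (real 1 * t * (a + b * t\<^sup>2) + real 1 * (2 * b * t) * (1 + t\<^sup>2)))
     / (sqrt (1 + t\<^sup>2) ^ (1 + 2) * (a + b * t\<^sup>2) ^ (1 + 1)) = profile' a b t"
  proof -
    have e1: "a * b * (4 * t * (1 + t\<^sup>2)) * (1 + t\<^sup>2) * (a + b * t\<^sup>2) -
      a * b * (1 + t\<^sup>2)\<^sup>2 * (real 1 * t * (a + b * t\<^sup>2) + real 1 * (2 * b * t) * (1 + t\<^sup>2))
      = a * b * t * (3 * a - 2 * b + b * t\<^sup>2) * (1 + t\<^sup>2)\<^sup>2"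
      unfolding of_nat_1 mult_1 by algebra
    have e2: "(1 + t\<^sup>2)\<^sup>2 = sqrt (1 + t\<^sup>2) ^ 3 * sqrt (1 + t\<^sup>2)"
    proof -
      have "(r\<^sup>2)\<^sup>2 = r ^ 3 * r" for r :: real by (simp add: eval_nat_numeral)
      from this[of "sqrt (1 + t\<^sup>2)"] show ?thesis unfolding s(1) .
    qed
    have e3: "x * t * y * (r ^ 3 * r) / (r ^ (1 + 2) * D ^ (1 + 1)) = x * t * r * y / D\<^sup>2" if "r > 0" for x y r D :: real
      using that by (cases "D = 0") (auto simp: eval_nat_numeral field_simps)
    show ?thesis
      unfolding e1 unfolding e2 profile'_def by (rule e3[OF s(2)])
  qed
  then show ?thesis
    using DERIV_weighted_quotient[OF P r Q one_plus_sq_pos, of 1 1] den_pos[of t] unfolding e[abs_def] by simp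
qed

text \<open>This is where the coefficients \<open>A\<close>, \<open>B\<close>, \<open>C\<close> of the kernel come from: on corresponding lines the kernel
  is the second derivative of the symbol.\<close>
lemma DERIV_profile': "(profile' a b has_real_derivative slope_kernel a b t) (at t)"
proof -
  have P: "((\<lambda>t. a * b * t * (1 + t\<^sup>2) * (3 * a - 2 * b + b * t\<^sup>2)) has_real_derivative
      a * b * ((1 + 3 * t\<^sup>2) * (3 * a - 2 * b + b * t\<^sup>2) + (t + t ^ 3) * (2 * b * t))) (at t)"
    by (rule derivative_eq_intros refl)+ (simp add: algebra_simps power2_eq_square power3_eq_cube)
  have r: "((\<lambda>t. 1 + t\<^sup>2) has_real_derivative 2 * t) (at t)"
    and Q: "((\<lambda>t. a + b * t\<^sup>2) has_real_derivative 2 * b * t) (at t)"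
    by (auto intro!: derivative_eq_intros)
  have s: "sqrt (1 + t\<^sup>2) ^ 2 = 1 + t\<^sup>2" "sqrt (1 + t\<^sup>2) > 0" for t :: real
    using one_plus_sq_pos[of t] by auto
  have e: "profile' a b t = a * b * t * (1 + t\<^sup>2) * (3 * a - 2 * b + b * t\<^sup>2) / (sqrt (1 + t\<^sup>2) ^ 1 * (a + b * t\<^sup>2) ^ 2)" for t
  proof -
    have "x * sqrt (1 + t\<^sup>2) * y / D = x * (1 + t\<^sup>2) * y / (sqrt (1 + t\<^sup>2) * D)" for x y D
      using s[of t] by (cases "D = 0") (auto simp: divide_simps simp flip: power2_eq_square)
    then show ?thesis unfolding profile'_def power_one_right .
  qed
  have "(a * b * ((1 + 3 * t\<^sup>2) * (3 * a - 2 * b + b * t\<^sup>2) + (t + t ^ 3) * (2 * b * t)) * (1 + t\<^sup>2) * (a + b * t\<^sup>2) -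
      a * b * t * (1 + t\<^sup>2) * (3 * a - 2 * b + b * t\<^sup>2) * (real 1 * t * (a + b * t\<^sup>2) + real 2 * (2 * b * t) * (1 + t\<^sup>2)))
     / (sqrt (1 + t\<^sup>2) ^ (1 + 2) * (a + b * t\<^sup>2) ^ (2 + 1)) = slope_kernel a b t"
  proof -
    have "a * b * ((1 + 3 * t\<^sup>2) * (3 * a - 2 * b + b * t\<^sup>2) + (t + t ^ 3) * (2 * b * t)) * (1 + t\<^sup>2) * (a + b * t\<^sup>2) -
      a * b * t * (1 + t\<^sup>2) * (3 * a - 2 * b + b * t\<^sup>2) * (real 1 * t * (a + b * t\<^sup>2) + real 2 * (2 * b * t) * (1 + t\<^sup>2))
      = a * b * ker_num a b 1 t * (1 + t\<^sup>2)"
      unfolding ker_num_def of_nat_1 of_nat_numeral power_one mult_1_right mult_1 by algebra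
    moreover have "sqrt (1 + t\<^sup>2) ^ (1 + 2) = sqrt (1 + t\<^sup>2) * (1 + t\<^sup>2)"
      by (subst (2) s(1)[symmetric]) (simp add: power3_eq_cube power2_eq_square)
    ultimately show ?thesis
      using s[of t] den_pos[of t] one_plus_sq_pos[of t] by (simp add: slope_kernel_def)
  qed
  then show ?thesis
    using DERIV_weighted_quotient[OF P r Q one_plus_sq_pos, of 1 2] den_pos[of t] unfolding e[abs_def] by simp
qed

lemma elastic_kernel_slope:
  assumes "s \<noteq> 0"
  shows "elastic_kernel a b (plane (s, s * t)) = slope_kernel a b t / \<bar>s\<bar> ^ 3"
proof -
  have "s\<^sup>2 + (s * t)\<^sup>2 = s\<^sup>2 * (1 + t\<^sup>2)" by (simp add: algebra_simps)
  then have 1: "sqrt (s\<^sup>2 + (s * t)\<^sup>2) = \<bar>s\<bar> * sqrt (1 + t\<^sup>2)"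
    by (simp add: real_sqrt_mult)
  have 2: "a * s\<^sup>2 + b * (s * t)\<^sup>2 = s\<^sup>2 * (a + b * t\<^sup>2)" by (simp add: algebra_simps)
  have 3: "ker_num a b s (s * t) = s ^ 4 * ker_num a b 1 t"
    by (simp add: ker_num_def algebra_simps eval_nat_numeral)
  have 4: "\<bar>s\<bar> * (s\<^sup>2) ^ 3 = s ^ 4 * \<bar>s\<bar> ^ 3"
    by (simp add: eval_nat_numeral)
  have "a * b * (s ^ 4 * ker_num a b 1 t / (\<bar>s\<bar> * sqrt (1 + t\<^sup>2) * (s\<^sup>2 * (a + b * t\<^sup>2)) ^ 3))
    = a * b * (s ^ 4 * ker_num a b 1 t / ((\<bar>s\<bar> * (s\<^sup>2) ^ 3) * (sqrt (1 + t\<^sup>2) * (a + b * t\<^sup>2) ^ 3)))"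
    by (simp add: power_mult_distrib mult_ac)
  also have "\<dots> = slope_kernel a b t / \<bar>s\<bar> ^ 3"
    unfolding 4 slope_kernel_def using assms by (simp add: field_simps)
  finally show ?thesis
    unfolding elastic_kernel_ker_num plane_nth fst_conv snd_conv 1 2 3 by simp
qed

text \<open>The numerator is at most of order \<open>(1 + t\<^sup>2)\<^sup>2\<close> and the denominator at least of order
  \<open>sqrt (1 + t\<^sup>2) * (1 + t\<^sup>2) ^ 3\<close>. This decay of order three makes \<open>\<bar>k1 + k2 * t\<bar>\<close> integrable against
  the kernel.\<close>
lemma slope_kernel_bound: "\<exists>M>0. \<forall>t. \<bar>slope_kernel a b t\<bar> * sqrt (1 + t\<^sup>2) \<le> M * inverse (1 + t\<^sup>2)"
proof -
  define N where "N = \<bar>ker_A a b\<bar> + \<bar>2 * ker_B a b\<bar> + \<bar>ker_A b a\<bar> + 1"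
  define m where "m = min a b"
  have m: "m > 0" using a b by (simp add: m_def)
  have "N > 0" by (simp add: N_def)
  show ?thesis
  proof (intro exI[of _ "a * b * N / m ^ 3"] conjI allI)
    show "a * b * N / m ^ 3 > 0" using a b m \<open>N > 0\<close> by simp
    fix t :: real
    define q where "q = 1 + t\<^sup>2"
    have q: "q > 0" using one_plus_sq_pos[of t] by (simp add: q_def)
    have "m * q \<le> a + b * t\<^sup>2"
      unfolding q_def distrib_left by (intro add_mono mult_right_mono) (auto simp: m_def)
    then have den: "(m * q) ^ 3 \<le> (a + b * t\<^sup>2) ^ 3" using m q by (intro power_mono) auto
    have q2: "q\<^sup>2 = 1 + 2 * t\<^sup>2 + t ^ 4" by (simp add: q_def power2_eq_square algebra_simps eval_nat_numeral)
    have t: "1 \<le> q\<^sup>2" "t\<^sup>2 \<le> q\<^sup>2" "t ^ 4 \<le> q\<^sup>2" unfolding q2 by auto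
    have "\<bar>ker_num a b 1 t\<bar> \<le> \<bar>ker_A a b\<bar> * 1 + \<bar>2 * ker_B a b\<bar> * t\<^sup>2 + \<bar>ker_A b a\<bar> * t ^ 4"
      unfolding ker_num_def by (rule order_trans[OF abs_triangle_ineq] add_mono)+ (auto simp: abs_mult)
    also have "\<dots> \<le> \<bar>ker_A a b\<bar> * q\<^sup>2 + \<bar>2 * ker_B a b\<bar> * q\<^sup>2 + \<bar>ker_A b a\<bar> * q\<^sup>2"
      by (intro add_mono mult_left_mono t) auto
    also have "\<dots> \<le> N * q\<^sup>2" by (simp add: N_def algebra_simps)
    finally have num: "\<bar>ker_num a b 1 t\<bar> \<le> N * q\<^sup>2" .
    have "\<bar>slope_kernel a b t\<bar> * sqrt q = a * b * \<bar>ker_num a b 1 t\<bar> / (a + b * t\<^sup>2) ^ 3"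
      using a b den_pos[of t] q by (simp add: slope_kernel_def abs_mult q_def[symmetric])
    also have "\<dots> \<le> a * b * (N * q\<^sup>2) / (m * q) ^ 3"
      using a b m q num den by (intro frac_le mult_left_mono) (auto intro!: mult_pos_pos)
    also have "\<dots> = a * b * N / m ^ 3 * inverse q"
      using q m by (simp add: field_simps eval_nat_numeral)
    finally show "\<bar>slope_kernel a b t\<bar> * sqrt (1 + t\<^sup>2) \<le> a * b * N / m ^ 3 * inverse (1 + t\<^sup>2)"
      by (simp add: q_def)
  qed
qed

lemma slope_kernel_continuous: "continuous_on UNIV (slope_kernel a b)"
proof -
  have "sqrt (1 + t\<^sup>2) \<noteq> 0" "a + b * t\<^sup>2 \<noteq> 0" for t :: real
    using one_plus_sq_pos[of t] den_pos[of t] by auto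
  then show ?thesis
    unfolding slope_kernel_def[abs_def] ker_num_def by (intro continuous_intros) auto
qed

lemma slope_kernel_measurable [measurable]: "slope_kernel a b \<in> borel_measurable borel"
  using slope_kernel_continuous by (rule borel_measurable_continuous_onI)

lemma abs_linear_le: "\<bar>k1 + k2 * t\<bar> \<le> sqrt (k1\<^sup>2 + k2\<^sup>2) * sqrt (1 + (t::real)\<^sup>2)"
proof -
  have "(k1 + k2 * t)\<^sup>2 \<le> (k1\<^sup>2 + k2\<^sup>2) * (1 + t\<^sup>2)"
    using zero_le_power2[of "k1 * t - k2"] by (simp add: power2_eq_square algebra_simps)
  then show ?thesis by (metis real_sqrt_abs real_sqrt_le_iff real_sqrt_mult)
qed

lemma slope_kernel_moment_bound:
  assumes M: "\<And>t. \<bar>slope_kernel a b t\<bar> * sqrt (1 + t\<^sup>2) \<le> M * inverse (1 + t\<^sup>2)"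
  shows "\<bar>k1 + k2 * t\<bar> * \<bar>slope_kernel a b t\<bar> \<le> sqrt (k1\<^sup>2 + k2\<^sup>2) * (M * inverse (1 + t\<^sup>2))"
proof -
  have "\<bar>k1 + k2 * t\<bar> * \<bar>slope_kernel a b t\<bar> \<le> (sqrt (k1\<^sup>2 + k2\<^sup>2) * sqrt (1 + t\<^sup>2)) * \<bar>slope_kernel a b t\<bar>"
    by (intro mult_right_mono abs_linear_le) auto
  also have "\<dots> \<le> sqrt (k1\<^sup>2 + k2\<^sup>2) * (M * inverse (1 + t\<^sup>2))"
    using mult_left_mono[OF M[of t], of "sqrt (k1\<^sup>2 + k2\<^sup>2)"] by (simp add: mult_ac)
  finally show ?thesis .
qed

lemma slope_moment_integrable: "integrable lborel (\<lambda>t. (k1 + k2 * t) * slope_kernel a b t)"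
proof -
  obtain M where M: "\<And>t. \<bar>slope_kernel a b t\<bar> * sqrt (1 + t\<^sup>2) \<le> M * inverse (1 + t\<^sup>2)"
    using slope_kernel_bound by blast
  show ?thesis
  proof (rule Bochner_Integration.integrable_bound)
    show "integrable lborel (\<lambda>t::real. sqrt (k1\<^sup>2 + k2\<^sup>2) * (M * inverse (1 + t\<^sup>2)))"
      by (intro integrable_mult_right integrable_inverse_1_plus_square_real)
    show "AE t in lborel. norm ((k1 + k2 * t) * slope_kernel a b t) \<le> norm (sqrt (k1\<^sup>2 + k2\<^sup>2) * (M * inverse (1 + t\<^sup>2)))"
      unfolding real_norm_def abs_mult[of "k1 + k2 * t" for t]
      by (intro AE_I2 order_trans[OF slope_kernel_moment_bound[OF M] abs_ge_self])
  qed measurable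
qed

text \<open>The profile is asymptotic to \<open>a * \<bar>t\<bar>\<close>, and its tangent lines have intercepts tending to \<open>0\<close>; these are
  the boundary terms of the integration by parts that follows.\<close>
lemma profile_limits:
  "((\<lambda>t. profile' a b t) \<longlongrightarrow> a) at_top" "((\<lambda>t. profile' a b t) \<longlongrightarrow> - a) at_bot"
  "((\<lambda>t. profile a b t - t * profile' a b t) \<longlongrightarrow> 0) at_top"
  "((\<lambda>t. profile a b t - t * profile' a b t) \<longlongrightarrow> 0) at_bot"
proof -
  show 1: "((\<lambda>t. profile' a b t) \<longlongrightarrow> a) at_top"
  proof -
    have "a * b * b * inverse (b\<^sup>2) = a * (b\<^sup>2 * inverse (b\<^sup>2))"
      by (simp only: power2_eq_square mult.assoc)
    also have "\<dots> = a" using b by (subst right_inverse) auto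
    finally have c: "a * b * b * inverse (b\<^sup>2) = a" .
    show ?thesis unfolding profile'_def using a b by real_asymp (simp only: c)
  qed
  have s: "sqrt (1 + t\<^sup>2) ^ 3 = sqrt (1 + t\<^sup>2) * (1 + t\<^sup>2)" for t :: real
    using one_plus_sq_pos[of t] by (simp add: power3_eq_cube)
  have e: "profile a b t - t * profile' a b t = a * b * sqrt (1 + t\<^sup>2) * (a + (3 * b - 2 * a) * t\<^sup>2) / (a + b * t\<^sup>2)\<^sup>2" for t
    using den_pos[of t] unfolding profile_def profile'_def s
    by (simp add: divide_simps) (simp add: algebra_simps power2_eq_square)
  show 2: "((\<lambda>t. profile a b t - t * profile' a b t) \<longlongrightarrow> 0) at_top"
    unfolding e using a b by real_asymp
  have odd: "profile' a b (- t) = - profile' a b t" "profile a b (- t) = profile a b t" for t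
    by (simp_all add: profile'_def profile_def)
  show "((\<lambda>t. profile' a b t) \<longlongrightarrow> - a) at_bot"
    unfolding filterlim_at_bot_mirror odd by (intro tendsto_minus 1)
  show "((\<lambda>t. profile a b t - t * profile' a b t) \<longlongrightarrow> 0) at_bot"
    unfolding filterlim_at_bot_mirror odd using 2 by simp
qed

text \<open>Since \<open>slope_kernel\<close> is the second derivative of \<open>profile\<close>, the function \<open>F\<close> is an antiderivative of
  the integrand, with limits \<open>a * k1\<close> and \<open>- a * k1\<close> at the two ends.\<close>
lemma slope_moment_halves:
  fixes k1 k2 t0
  defines "F \<equiv> \<lambda>t. (k1 + k2 * t) * profile' a b t - k2 * profile a b t"
  shows "(LINT t|lborel. indicator {t0<..} t *\<^sub>R ((k1 + k2 * t) * slope_kernel a b t)) = a * k1 - F t0"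
    and "(LINT t|lborel. indicator {..<t0} t *\<^sub>R ((k1 + k2 * t) * slope_kernel a b t)) = F t0 + a * k1"
proof -
  have D: "(F has_vector_derivative (k1 + k2 * t) * slope_kernel a b t) (at t)" for t
    unfolding F_def has_real_derivative_iff_has_vector_derivative[symmetric]
    by (auto intro!: derivative_eq_intros DERIV_profile DERIV_profile')
  have C: "isCont (\<lambda>t. (k1 + k2 * t) * slope_kernel a b t) t" for t
    using slope_kernel_continuous by (auto intro!: continuous_intros simp: continuous_on_eq_continuous_at)
  have I: "set_integrable lborel S (\<lambda>t. (k1 + k2 * t) * slope_kernel a b t)" if "S \<in> sets lborel" for S
    unfolding set_integrable_def using integrable_mult_indicator[OF that slope_moment_integrable] .
  have e: "F = (\<lambda>t. k1 * profile' a b t - k2 * (profile a b t - t * profile' a b t))"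
    by (auto simp: F_def algebra_simps)
  have "(F \<longlongrightarrow> k1 * a - k2 * 0) at_top" "(F \<longlongrightarrow> k1 * (- a) - k2 * 0) at_bot"
    unfolding e by (intro tendsto_intros profile_limits)+
  then have T: "(F \<longlongrightarrow> a * k1) at_top" "(F \<longlongrightarrow> - a * k1) at_bot"
    by (simp_all add: mult.commute)
  have "isCont F t0" using D has_vector_derivative_continuous by blast
  then have R: "(F \<longlongrightarrow> F t0) (at_right t0)" "(F \<longlongrightarrow> F t0) (at_left t0)"
    by (auto simp: isCont_def intro: tendsto_mono[OF at_le])
  have "(LBINT t=ereal t0..\<infinity>. (k1 + k2 * t) * slope_kernel a b t) = a * k1 - F t0"
    by (rule interval_integral_FTC_integrable[OF _ D C I]) (use T R in \<open>simp_all add: ereal_tendsto_simps\<close>)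
  then show "(LINT t|lborel. indicator {t0<..} t *\<^sub>R ((k1 + k2 * t) * slope_kernel a b t)) = a * k1 - F t0"
    by (simp add: interval_lebesgue_integral_def set_lebesgue_integral_def einterval_eq)
  have "(LBINT t=-\<infinity>..ereal t0. (k1 + k2 * t) * slope_kernel a b t) = F t0 - (- a * k1)"
    by (rule interval_integral_FTC_integrable[OF _ D C I]) (use T R in \<open>simp_all add: ereal_tendsto_simps\<close>)
  then show "(LINT t|lborel. indicator {..<t0} t *\<^sub>R ((k1 + k2 * t) * slope_kernel a b t)) = F t0 + a * k1"
    by (simp add: interval_lebesgue_integral_def set_lebesgue_integral_def einterval_eq)
qed

lemma symbol_profile:
  assumes "k$2 \<noteq> 0"
  shows "symbol a b k = \<bar>k$2\<bar> * profile a b (- (k$1) / k$2)"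
proof -
  have n: "norm k = \<bar>k$2\<bar> * sqrt (1 + (- (k$1) / k$2)\<^sup>2)"
  proof -
    have e: "(k$1)\<^sup>2 + (k$2)\<^sup>2 = (k$2)\<^sup>2 * (1 + (- (k$1) / k$2)\<^sup>2)"
      using assms by (simp add: power_divide distrib_left)
    show ?thesis unfolding norm_real2 e real_sqrt_mult real_sqrt_abs ..
  qed
  have d: "b * (k$1)\<^sup>2 + a * (k$2)\<^sup>2 = (k$2)\<^sup>2 * (a + b * (- (k$1) / k$2)\<^sup>2)"
    using assms by (simp add: power_divide distrib_left)
  have c: "\<bar>k$2\<bar> ^ 3 = (k$2)\<^sup>2 * \<bar>k$2\<bar>" by (simp add: power3_eq_cube power2_eq_square)
  have "x * (y\<^sup>2 * z * w) / (y\<^sup>2 * q) = z * (x * w / q)" if "y \<noteq> 0" for x y z w q :: real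
    using that by simp
  from this[OF assms] show ?thesis
    unfolding symbol_def profile_def n d power_mult_distrib c .
qed

text \<open>As a function of \<open>t\<close>, \<open>\<bar>k$1 + k$2 * t\<bar>\<close> has second derivative \<open>2 * \<bar>k$2\<bar>\<close> times the point mass at its zero
  \<open>t0\<close>. Integrating by parts twice against the second derivative of the profile therefore returns
  \<open>2 * \<bar>k$2\<bar> * profile t0\<close>, which is twice the symbol; the boundary terms at infinity cancel. For
  \<open>k$2 = 0\<close> there is no kink and the boundary terms are the whole value.\<close>
lemma slope_moment_integral:
  "(LINT t|lborel. \<bar>k$1 + k$2 * t\<bar> * slope_kernel a b t) = 2 * symbol a b k"
proof -
  have ind: "integrable lborel (\<lambda>t. indicator {t0<..} t *\<^sub>R ((k1 + k2 * t) * slope_kernel a b t))"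
    "integrable lborel (\<lambda>t. indicator {..<t0} t *\<^sub>R ((k1 + k2 * t) * slope_kernel a b t))" for t0 k1 k2
    by (intro integrable_mult_indicator slope_moment_integrable; simp)+
  show ?thesis
  proof (cases "k$2 = 0")
    case True
    have "(LINT t|lborel. \<bar>k$1 + k$2 * t\<bar> * slope_kernel a b t)
      = (LINT t|lborel. \<bar>k$1\<bar> * (indicator {0<..} t *\<^sub>R ((1 + 0 * t) * slope_kernel a b t) + indicator {..<0} t *\<^sub>R ((1 + 0 * t) * slope_kernel a b t)))"
    proof (rule integral_cong_AE)
      show "AE t in lborel. \<bar>k$1 + k$2 * t\<bar> * slope_kernel a b t = \<bar>k$1\<bar> * (indicator {0<..} t *\<^sub>R ((1 + 0 * t) * slope_kernel a b t) + indicator {..<0} t *\<^sub>R ((1 + 0 * t) * slope_kernel a b t))"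
        using AE_lborel_singleton[of "0::real"]
      proof eventually_elim
        case (elim t)
        then show ?case using True by (cases "t > 0") (simp_all add: indicator_def)
      qed
    qed measurable
    also have "\<dots> = \<bar>k$1\<bar> * (2 * a)"
      unfolding integral_mult_right_zero Bochner_Integration.integral_add[OF ind(1) ind(2)] slope_moment_halves by simp
    also have "\<dots> = 2 * symbol a b k"
    proof (cases "k$1 = 0")
      case False
      have c: "\<bar>k$1\<bar> ^ 3 = (k$1)\<^sup>2 * \<bar>k$1\<bar>" by (simp add: power3_eq_cube power2_eq_square)
      have n: "norm k = \<bar>k$1\<bar>" using True by (simp add: norm_real2)
      show ?thesis using True b False unfolding symbol_def n c by simp
    qed (use True in \<open>simp add: symbol_def norm_real2\<close>)
    finally show ?thesis .
  next
    case False
    \<comment> \<open>the kink of the integrand\<close>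
  define t0 where "t0 = - (k$1) / k$2"
    have z: "k$1 + k$2 * t0 = 0" using False by (simp add: t0_def)
    have "\<bar>k$1 + k$2 * t\<bar> * slope_kernel a b t = sgn (k$2) * (indicator {t0<..} t *\<^sub>R ((k$1 + k$2 * t) * slope_kernel a b t) - indicator {..<t0} t *\<^sub>R ((k$1 + k$2 * t) * slope_kernel a b t))" for t
    proof -
      have e: "k$1 + k$2 * t = k$2 * (t - t0)" using z by (simp add: right_diff_distrib)
      have "\<bar>k$2\<bar> = sgn (k$2) * k$2" by (simp add: abs_sgn mult.commute)
      then show ?thesis unfolding e abs_mult
        by (cases t t0 rule: linorder_cases) (auto simp: indicator_def algebra_simps)
    qed
    then have "(LINT t|lborel. \<bar>k$1 + k$2 * t\<bar> * slope_kernel a b t)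
      = sgn (k$2) * ((LINT t|lborel. indicator {t0<..} t *\<^sub>R ((k$1 + k$2 * t) * slope_kernel a b t)) - (LINT t|lborel. indicator {..<t0} t *\<^sub>R ((k$1 + k$2 * t) * slope_kernel a b t)))"
      by (simp only: integral_mult_right_zero Bochner_Integration.integral_diff[OF ind(1) ind(2)])
    also have "\<dots> = sgn (k$2) * (2 * (k$2 * profile a b t0))"
      unfolding slope_moment_halves z by simp
    also have "\<dots> = 2 * symbol a b k"
      unfolding symbol_profile[OF False] t0_def by (simp add: abs_sgn mult_ac)
    finally show ?thesis .
  qed
qed

lemma kernel_slope_integrand:
  "\<bar>s\<bar> *\<^sub>R ((1 - cos (k \<bullet> plane (s, s * t))) * elastic_kernel a b (plane (s, s * t)))
     = (1 - cos ((k$1 + k$2 * t) * s)) / s\<^sup>2 * slope_kernel a b t"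
proof (cases "s = 0")
  case False
  have "k \<bullet> plane (s, s * t) = (k$1 + k$2 * t) * s"
    by (simp add: inner_vec_def UNIV_2 algebra_simps)
  moreover have "\<bar>s\<bar> * (x * (y / \<bar>s\<bar> ^ 3)) = x / s\<^sup>2 * y" for x y :: real
  proof -
    have "r * (x * (y / r ^ 3)) = x / r\<^sup>2 * y" if "r \<noteq> 0" for r :: real
      using that by (simp add: field_simps eval_nat_numeral)
    from this[of "\<bar>s\<bar>"] show ?thesis using False by simp
  qed
  ultimately show ?thesis using False by (simp add: elastic_kernel_slope)
qed auto

lemma elastic_kernel_measurable [measurable]: "elastic_kernel a b \<in> borel_measurable borel"
proof -
  have [measurable]: "(\<lambda>y::real^2. y$i) \<in> borel_measurable borel" for i
    by (intro borel_measurable_continuous_onI continuous_intros)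
  show ?thesis unfolding elastic_kernel_def[abs_def] Let_def by measurable
qed

text \<open>In slope coordinates the integral over \<open>s\<close> gives \<open>pi * \<bar>k$1 + k$2 * t\<bar>\<close>, and the integral over \<open>t\<close> that
  remains is the moment just computed. The bound on the absolute integral is what Fubini's theorem
  requires, as the kernel may change sign.\<close>
lemma elastic_kernel_cos_integral:
  obtains M where "\<And>k. integrable lborel (\<lambda>y. (1 - cos (k \<bullet> y)) * elastic_kernel a b y)"
    "\<And>k. (LINT y|lborel. (1 - cos (k \<bullet> y)) * elastic_kernel a b y) = 2 * pi * symbol a b k"
    "\<And>k. (LINT y|lborel. \<bar>(1 - cos (k \<bullet> y)) * elastic_kernel a b y\<bar>) \<le> M * norm k"
proof -
  let ?J = "\<lambda>(k::real^2) t s. (1 - cos ((k$1 + k$2 * t) * s)) / s\<^sup>2 * slope_kernel a b t" and ?K = "\<lambda>(k::real^2) y. (1 - cos (k \<bullet> y)) * elastic_kernel a b y"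
  obtain M where M: "\<And>t. \<bar>slope_kernel a b t\<bar> * sqrt (1 + t\<^sup>2) \<le> M * inverse (1 + t\<^sup>2)"
    using slope_kernel_bound by blast
  define L where "L = (LINT t|lborel. M * inverse (1 + (t::real)\<^sup>2))"
  have J: "(LINT s|lborel. (1 - cos (c * s)) / s\<^sup>2 * x) = pi * (\<bar>c\<bar> * x)"
    "integrable lborel (\<lambda>s. (1 - cos (c * s)) / s\<^sup>2 * x)" for c x :: real
    using integral_one_minus_cos[of c] has_bochner_integral_mult_left[of x, OF integral_one_minus_cos[of c]]
    by (auto simp: has_bochner_integral_iff mult.assoc)
  have N: "\<bar>(1 - cos u) / s\<^sup>2 * x\<bar> = (1 - cos u) / s\<^sup>2 * \<bar>x\<bar>" for u s x :: real
    by (simp add: abs_mult)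
  have int: "integrable lborel2 (\<lambda>(t, s). ?J k t s)" for k :: "real^2"
  proof (rule lborel_pair.Fubini_integrable)
    have "(LINT s|lborel. norm (?J k t s)) = pi * \<bar>(k$1 + k$2 * t) * slope_kernel a b t\<bar>" for t
      unfolding real_norm_def N unfolding J abs_mult ..
    then show "integrable lborel (\<lambda>t. LINT s|lborel. norm (case (t, s) of (t, s) \<Rightarrow> ?J k t s))"
      using slope_moment_integrable by simp
    show "AE t in lborel. integrable lborel (\<lambda>s. case (t, s) of (t, s) \<Rightarrow> ?J k t s)"
      using J(2) by auto
  qed measurable
  have meas [measurable]: "(\<lambda>y. ?K k y) \<in> borel_measurable borel" for k
    by measurable
  show ?thesis
  proof (rule that)
    fix k :: "real^2"
    show "integrable lborel (\<lambda>y. ?K k y)"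
      using int[of k] by (subst slope_integral(1)[OF meas]) (simp only: kernel_slope_integrand)
    have "(LINT y|lborel. ?K k y)
       = (LINT p|lborel2. (case p of (t, s) \<Rightarrow> ?J k t s))"
      by (subst slope_integral(2)[OF meas]) (simp only: kernel_slope_integrand)
    also have "\<dots> = (LINT t|lborel. LINT s|lborel. ?J k t s)"
      by (subst lborel_pair.integral_fst'[OF int, symmetric]) simp
    also have "\<dots> = (LINT t|lborel. pi * (\<bar>k$1 + k$2 * t\<bar> * slope_kernel a b t))"
      unfolding J ..
    also have "\<dots> = 2 * pi * symbol a b k"
      by (simp add: slope_moment_integral)
    finally show "(LINT y|lborel. ?K k y) = 2 * pi * symbol a b k" .
    have absm: "(\<lambda>y. \<bar>?K k y\<bar>) \<in> borel_measurable borel"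
      by measurable
    have ae: "\<bar>s\<bar> *\<^sub>R \<bar>(1 - cos (k \<bullet> plane (s, s * t))) * elastic_kernel a b (plane (s, s * t))\<bar>
      = \<bar>?J k t s\<bar>" for s t
      unfolding kernel_slope_integrand[symmetric] by (simp add: abs_mult)
    have int': "integrable lborel2 (\<lambda>(t, s). \<bar>?J k t s\<bar>)"
      using integrable_abs[OF int[of k]] by (simp add: case_prod_beta')
    have "(LINT y|lborel. \<bar>?K k y\<bar>)
       = (LINT p|lborel2. (case p of (t, s) \<Rightarrow> \<bar>?J k t s\<bar>))"
      by (subst slope_integral(2)[OF absm]) (simp only: ae)
    also have "\<dots> = (LINT t|lborel. LINT s|lborel. \<bar>?J k t s\<bar>)"
      by (subst lborel_pair.integral_fst'[OF int', symmetric]) simp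
    also have "\<dots> = (LINT t|lborel. pi * \<bar>(k$1 + k$2 * t) * slope_kernel a b t\<bar>)"
      unfolding N unfolding J abs_mult ..
    also have "\<dots> \<le> (LINT t|lborel. pi * (norm k * (M * inverse (1 + t\<^sup>2))))"
    proof (rule integral_mono)
      show "integrable lborel (\<lambda>t. pi * \<bar>(k$1 + k$2 * t) * slope_kernel a b t\<bar>)"
        using slope_moment_integrable by simp
      show "integrable lborel (\<lambda>t::real. pi * (norm k * (M * inverse (1 + t\<^sup>2))))"
        by (intro integrable_mult_right integrable_inverse_1_plus_square_real)
      show "pi * \<bar>(k$1 + k$2 * t) * slope_kernel a b t\<bar> \<le> pi * (norm k * (M * inverse (1 + t\<^sup>2)))" for t
        using slope_kernel_moment_bound[OF M] unfolding norm_real2 abs_mult by simp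
    qed
    also have "\<dots> = (pi * L) * norm k" by (simp add: L_def)
    finally show "(LINT y|lborel. \<bar>?K k y\<bar>) \<le> (pi * L) * norm k" .
  qed
qed

end

section \<open>Fourier transforms of Schwartz functions\<close>

lemma smooth_on_partial_funpow: "smooth_on f S \<Longrightarrow> smooth_on ((partial i ^^ n) f) S"
  by (induction n) (auto intro: smooth_on_partial)

lemma coord_measurable [measurable]: "(\<lambda>y::real^2. y$i) \<in> borel_measurable borel"
  by (intro borel_measurable_continuous_onI continuous_intros)

text \<open>The hypothesis dominates \<open>f\<close> by a multiple of \<open>1 / ((1 + (x$1)\<^sup>2) * (1 + (x$2)\<^sup>2))\<close>, a product of
  integrable functions of one variable.\<close>
lemma integrable_of_product_weight:
  fixes f :: "real^2 \<Rightarrow> 'b::{banach, second_countable_topology}"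
  assumes [measurable]: "f \<in> borel_measurable borel"
    and le: "\<And>x. norm (f x) * ((1 + (x$1)\<^sup>2) * (1 + (x$2)\<^sup>2)) \<le> C"
  shows "integrable lborel f"
proof (rule Bochner_Integration.integrable_bound)
  let ?g = "\<lambda>x::real^2. of_real C * (of_real (inverse (1 + (x$1)\<^sup>2)) * of_real (inverse (1 + (x$2)\<^sup>2)) :: complex)"
  have "integrable lborel (\<lambda>x::real. of_real (inverse (1 + x\<^sup>2)) :: complex)"
    by (rule integrable_of_real[OF integrable_inverse_1_plus_square_real])
  from product_integrable_plane(1)[OF this this] show "integrable lborel ?g"
    by (rule integrable_mult_right)
  show "AE x in lborel. norm (f x) \<le> norm (?g x)"
  proof (rule AE_I2)
    fix x :: "real^2"
    let ?p = "(1 + (x$1)\<^sup>2) * (1 + (x$2)\<^sup>2)"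
    have p: "?p > 0" by (intro mult_pos_pos one_plus_sq_pos)
    have "0 \<le> norm (f x) * ?p" using p by (intro mult_nonneg_nonneg) auto
    then have "C \<ge> 0" using le[of x] by linarith
    then have "norm (?g x) = C / ?p"
      using one_plus_sq_pos[of "x$1"] one_plus_sq_pos[of "x$2"] unfolding norm_mult norm_of_real
      by (simp add: divide_inverse)
    also have "\<dots> \<ge> norm (f x)" using le[of x] p by (simp add: pos_le_divide_eq)
    finally show "norm (f x) \<le> norm (?g x)" .
  qed
qed measurable

lemma integrable_of_quartic_decay:
  fixes f :: "real^2 \<Rightarrow> complex"
  assumes cont: "continuous_on UNIV f" and b0: "\<And>x. norm (f x) \<le> M0" and b4: "\<And>x. norm x ^ 4 * norm (f x) \<le> M4"
  shows "integrable lborel f"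
proof (rule integrable_of_product_weight)
  show "f \<in> borel_measurable borel" using cont by (rule borel_measurable_continuous_onI)
  fix x :: "real^2"
  let ?p = "(1 + (x$1)\<^sup>2) * (1 + (x$2)\<^sup>2)"
  have n2: "(norm x)\<^sup>2 = (x$1)\<^sup>2 + (x$2)\<^sup>2" by (simp add: norm_real2)
  have "?p \<le> (1 + (norm x)\<^sup>2)\<^sup>2" unfolding n2 power2_eq_square[of "1 + _"]
    by (intro mult_mono) auto
  also have "\<dots> \<le> 2 * (1 + norm x ^ 4)"
    using zero_le_power2[of "(norm x)\<^sup>2 - 1"] by (simp add: power2_eq_square algebra_simps eval_nat_numeral)
  finally have "norm (f x) * ?p \<le> norm (f x) * (2 * (1 + norm x ^ 4))" by (intro mult_left_mono) auto
  also have "\<dots> = 2 * (norm (f x) + norm x ^ 4 * norm (f x))" by (simp add: algebra_simps)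
  also have "\<dots> \<le> 2 * (M0 + M4)" using b0[of x] b4[of x] by simp
  finally show "norm (f x) * ?p \<le> 2 * (M0 + M4)" .
qed

lemma schwartz_derivative:
  fixes a b :: nat
  assumes "schwartz w"
  defines "f \<equiv> (partial 1 ^^ a) ((partial 2 ^^ b) w)"
  shows "smooth_on f UNIV" "integrable lborel f" "\<exists>M. \<forall>x. norm (f x) \<le> M"
proof -
  show s: "smooth_on f UNIV"
    using assms by (auto simp: schwartz_def intro: smooth_on_partial_funpow)
  have "\<exists>M. \<forall>x. norm x ^ N * norm (f x) \<le> M" for N
    using assms unfolding schwartz_def by blast
  from this[of 0] this[of 4] obtain M0 M4 where M: "\<And>x. norm (f x) \<le> M0" "\<And>x. norm x ^ 4 * norm (f x) \<le> M4"
    by auto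
  then show "integrable lborel f" "\<exists>M. \<forall>x. norm (f x) \<le> M"
    using integrable_of_quartic_decay[OF smooth_on_continuous_on[OF s]] by blast+
qed

lemma lborel_translate:
  fixes f :: "'a::euclidean_space \<Rightarrow> 'b::{banach, second_countable_topology}"
  assumes "f \<in> borel_measurable borel"
  shows "integrable lborel (\<lambda>x. f (c + x)) \<longleftrightarrow> integrable lborel f"
    and "(LINT x|lborel. f (c + x)) = (LINT x|lborel. f x)"
proof -
  have "integrable lborel f \<longleftrightarrow> integrable (distr lborel borel ((+) c)) f"
    by (simp add: lborel_distr_plus)
  also have "\<dots> \<longleftrightarrow> integrable lborel (\<lambda>x. f (c + x))"
    by (rule integrable_distr_eq) (use assms in auto)
  finally show "integrable lborel (\<lambda>x. f (c + x)) \<longleftrightarrow> integrable lborel f" ..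
  have "(LINT x|lborel. f x) = (LINT x|distr lborel borel ((+) c). f x)"
    by (simp add: lborel_distr_plus)
  also have "\<dots> = (LINT x|lborel. f (c + x))"
    by (rule integral_distr) (use assms in auto)
  finally show "(LINT x|lborel. f (c + x)) = (LINT x|lborel. f x)" ..
qed

text \<open>A translation by the unit vector \<open>axis i 1\<close> leaves the integral of \<open>f\<close> unchanged, and the increment of \<open>f\<close>
  is the integral of the derivative over a unit segment. Exchanging the two integrations, the increments
  integrate to the integral of the derivative.\<close>
lemma integral_partial_eq_0:
  fixes f :: "real^2 \<Rightarrow> complex"
  assumes diff: "\<And>x. f differentiable (at x)" and f: "integrable lborel f"
    and g: "integrable lborel (partial i f)" and cont: "continuous_on UNIV (partial i f)"
  shows "(LINT x|lborel. partial i f x) = 0"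
proof -
  let ?g = "partial i f" and ?e = "axis i 1 :: real^2"
  let ?h = "\<lambda>s x. indicator {0..1::real} s *\<^sub>R ?g (s *\<^sub>R ?e + x)"
  have [measurable]: "f \<in> borel_measurable borel" "?g \<in> borel_measurable borel"
    using f g by (auto dest: borel_measurable_integrable)
  have line: "has_bochner_integral lborel (\<lambda>s. ?h s x) (f (?e + x) - f x)" for x
  proof -
    have "has_bochner_integral lborel (\<lambda>s. indicator {0..1::real} s *\<^sub>R ?g (x + s *\<^sub>R ?e)) (f (x + 1 *\<^sub>R ?e) - f (x + 0 *\<^sub>R ?e))"
    proof (rule has_bochner_integral_FTC_Icc)
      show "((\<lambda>s. f (x + s *\<^sub>R ?e)) has_vector_derivative ?g (x + s *\<^sub>R ?e)) (at s within {0..1})" for s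
        using partial_line_derivative[OF diff] has_vector_derivative_at_within by blast
      show "continuous_on {0..1} (\<lambda>s. ?g (x + s *\<^sub>R ?e))"
        by (rule continuous_on_compose2[OF cont]) (auto intro!: continuous_intros)
    qed auto
    then show ?thesis by (simp add: add.commute)
  qed
  have int: "integrable lborel2 (\<lambda>(s, x). ?h s x)"
  proof (rule lborel_pair.Fubini_integrable)
    have "(LINT x|lborel. norm (?h s x)) = indicator {0..1} s * (LINT x|lborel. norm (?g x))" for s
      unfolding norm_scaleR
      by (subst integral_mult_right_zero, subst lborel_translate(2)[of "\<lambda>x. norm (?g x)" "s *\<^sub>R ?e"]) simp_all
    then show "integrable lborel (\<lambda>s. LINT x|lborel. norm (case (s, x) of (s, x) \<Rightarrow> ?h s x))"
      by (simp only: prod.case) (simp add: integrable_mult_left)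
    show "AE s in lborel. integrable lborel (\<lambda>x. case (s, x) of (s, x) \<Rightarrow> ?h s x)"
      using lborel_translate(1)[of ?g] g by auto
  qed measurable
  have "(LINT x|lborel. ?g x) = (LINT s|lborel. indicator {0..1::real} s *\<^sub>R (LINT x|lborel. ?g x))"
    by simp
  also have "\<dots> = (LINT s|lborel. LINT x|lborel. ?h s x)"
    by (simp add: lborel_translate(2))
  also have "\<dots> = (LINT x|lborel. LINT s|lborel. ?h s x)"
    by (rule lborel_pair.Fubini_integral[OF int, symmetric])
  also have "\<dots> = (LINT x|lborel. f (?e + x) - f x)"
    using line by (simp add: has_bochner_integral_iff)
  also have "\<dots> = 0"
    using f by (subst Bochner_Integration.integral_diff) (auto simp: lborel_translate)
  finally show ?thesis .
qed

lemma norm_exp_ii [simp]: "norm (exp (\<i> * complex_of_real r)) = 1" "norm (exp (- (\<i> * complex_of_real r))) = 1"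
  by (simp_all add: norm_exp_eq_Re)

abbreviation cexp :: "real^2 \<Rightarrow> real^2 \<Rightarrow> complex" where
  "cexp k x \<equiv> exp (- \<i> * complex_of_real (x \<bullet> k))"

lemma partial_add_mult_exp:
  fixes f :: "real^2 \<Rightarrow> complex"
  assumes "f differentiable (at x)"
  shows "(\<lambda>x. cexp k x * f x) differentiable (at x)"
    and "partial i (\<lambda>x. cexp k x * f x) x
      = cexp k x * partial i f x - \<i> * of_real (k$i) * (cexp k x * f x)"
proof -
  have f: "(f has_derivative frechet_derivative f (at x)) (at x)"
    using assms frechet_derivative_works by blast
  have e: "((\<lambda>x. cexp k x) has_derivative
     (\<lambda>h. cexp k x * (- \<i> * complex_of_real (h \<bullet> k)))) (at x)"
    using has_derivative_compose[OF has_derivative_mult_right[OF has_derivative_of_real[OF has_derivative_inner_left[OF has_derivative_ident]]]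
        DERIV_exp[unfolded has_field_derivative_def]] .
  note d = has_derivative_mult[OF e f]
  show "(\<lambda>x. cexp k x * f x) differentiable (at x)"
    using d unfolding differentiable_def by blast
  show "partial i (\<lambda>x. cexp k x * f x) x
      = cexp k x * partial i f x - \<i> * of_real (k$i) * (cexp k x * f x)"
    unfolding partial_eq_derivative[OF d] by (simp add: partial_def inner_axis' algebra_simps)
qed

lemma integrable_exp_mult:
  fixes f :: "real^2 \<Rightarrow> complex"
  assumes "integrable lborel f"
  shows "integrable lborel (\<lambda>x. cexp k x * f x)"
    "integrable lborel (\<lambda>x. iexp (x \<bullet> k) * f x)"
proof -
  have [measurable]: "f \<in> borel_measurable borel" using assms by (auto dest: borel_measurable_integrable)
  show "integrable lborel (\<lambda>x. cexp k x * f x)"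
    by (rule Bochner_Integration.integrable_bound[OF assms]) (auto simp: norm_mult)
  show "integrable lborel (\<lambda>x. iexp (x \<bullet> k) * f x)"
    by (rule Bochner_Integration.integrable_bound[OF assms]) (auto simp: norm_mult)
qed

lemma fourier_partial:
  fixes f :: "real^2 \<Rightarrow> complex"
  assumes "smooth_on f UNIV" and f: "integrable lborel f" and g: "integrable lborel (partial i f)"
  shows "fourier (partial i f) k = \<i> * of_real (k$i) * fourier f k"
proof -
  have d: "f differentiable (at x)" for x using smooth_on_differentiable_at[OF assms(1)] by simp
  let ?F = "\<lambda>x. cexp k x * f x"
  have p: "partial i ?F = (\<lambda>x. cexp k x * partial i f x - \<i> * of_real (k$i) * (cexp k x * f x))"
    by (rule ext) (rule partial_add_mult_exp[OF d])
  have c: "continuous_on UNIV f" "continuous_on UNIV (partial i f)"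
    using assms(1) smooth_on_partial smooth_on_continuous_on by blast+
  have "(LINT x|lborel. partial i ?F x) = 0"
  proof (rule integral_partial_eq_0)
    show "?F differentiable (at x)" for x by (rule partial_add_mult_exp[OF d])
    show "integrable lborel ?F" by (rule integrable_exp_mult[OF f])
    show "integrable lborel (partial i ?F)" unfolding p
      by (intro Bochner_Integration.integrable_diff integrable_mult_right integrable_exp_mult f g)
    show "continuous_on UNIV (partial i ?F)" unfolding p by (intro continuous_intros c)
  qed
  also have "(LINT x|lborel. partial i ?F x) = fourier (partial i f) k - \<i> * of_real (k$i) * fourier f k"
    unfolding p fourier_def
    by (subst Bochner_Integration.integral_diff)
      (auto intro!: integrable_mult_right integrable_exp_mult[simplified] f g)
  finally show ?thesis by simp
qed

lemma norm_fourier_le: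
  assumes "integrable lborel f"
  shows "norm (fourier f k) \<le> (LINT x|lborel. norm (f x))"
  unfolding fourier_def by (rule order_trans[OF integral_norm_bound]) (simp add: norm_mult)

lemma fourier_measurable [measurable]:
  assumes [measurable]: "f \<in> borel_measurable borel"
  shows "fourier f \<in> borel_measurable borel"
  unfolding fourier_def[abs_def] by measurable

text \<open>Each derivative of \<open>w\<close> contributes one factor \<open>k$i\<close> to the transform, and the transform of an integrable
  function is bounded.\<close>
lemma fourier_coordinate_decay:
  assumes "schwartz w"
  shows "\<exists>C. \<forall>k. \<bar>k$i\<bar> ^ n * norm (fourier w k) \<le> C"
proof -
  have fact: "smooth_on ((partial i ^^ n) w) UNIV \<and> integrable lborel ((partial i ^^ n) w)" for n
    using schwartz_derivative(1,2)[OF assms, of n 0] schwartz_derivative(1,2)[OF assms, of 0 n] exhaust_2[of i] by auto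
  have "fourier ((partial i ^^ n) w) k = (\<i> * of_real (k$i)) ^ n * fourier w k" for k
  proof (induction n)
    case (Suc n)
    have "fourier (partial i ((partial i ^^ n) w)) k = \<i> * of_real (k$i) * fourier ((partial i ^^ n) w) k"
      using fact[of n] fact[of "Suc n"] by (intro fourier_partial) auto
    then show ?case using Suc by simp
  qed simp
  then have "\<bar>k$i\<bar> ^ n * norm (fourier w k) = norm (fourier ((partial i ^^ n) w) k)" for k
    by (simp add: norm_mult norm_power)
  then show ?thesis using norm_fourier_le fact by metis
qed

lemma schwartz_measurable: "schwartz w \<Longrightarrow> w \<in> borel_measurable borel"
  using schwartz_derivative(2)[of w 0 0] by (auto dest: borel_measurable_integrable)

text \<open>The weight \<open>(1 + norm k) * (1 + (k$1)\<^sup>2) * (1 + (k$2)\<^sup>2)\<close> has order five, so sixth-order decay of the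
  transform in each coordinate dominates the integrand by a product of integrable functions.\<close>
lemma fourier_moment_integrable:
  assumes "schwartz w"
  shows "integrable lborel (\<lambda>k. (1 + norm k) * norm (fourier w k))"
proof -
  obtain C0 C1 C2 where C: "\<And>k. norm (fourier w k) \<le> C0" "\<And>k. \<bar>k$1\<bar> ^ 6 * norm (fourier w k) \<le> C1"
    "\<And>k. \<bar>k$2\<bar> ^ 6 * norm (fourier w k) \<le> C2"
    using fourier_coordinate_decay[OF assms, of 1 0] fourier_coordinate_decay[OF assms, of 1 6]
      fourier_coordinate_decay[OF assms, of 2 6] by auto
  have [measurable]: "w \<in> borel_measurable borel" using schwartz_measurable[OF assms] .
  show ?thesis
  proof (rule integrable_of_product_weight)
    fix k :: "real^2"
    let ?p = "(1 + (k$1)\<^sup>2) * (1 + (k$2)\<^sup>2)"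
    have p: "?p > 0" by (intro mult_pos_pos one_plus_sq_pos)
    \<comment> \<open>the constant 12 below is 3 * 2 * 2, whichever of 1 and m is larger\<close>
    define m where "m = max \<bar>k$1\<bar> \<bar>k$2\<bar>"
    have m: "m \<ge> 0" "\<bar>k$1\<bar> \<le> m" "\<bar>k$2\<bar> \<le> m" by (auto simp: m_def)
    have sq: "(k$i)\<^sup>2 \<le> m\<^sup>2" for i
      using m exhaust_2[of i] by (metis power2_abs power_mono abs_ge_zero)
    have "norm k \<le> 2 * m"
      using norm_le_l1_cart[of k] m by (simp add: UNIV_2)
    then have "(1 + norm k) * ?p \<le> (1 + 2 * m) * ((1 + m\<^sup>2) * (1 + m\<^sup>2))"
      using sq m p by (intro mult_mono) auto
    also have "\<dots> \<le> 12 * (1 + m ^ 6)"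
    proof (cases "m \<le> 1")
      case True
      then have "m\<^sup>2 \<le> 1" using m by (simp add: power_le_one)
      then have "(1 + 2 * m) * ((1 + m\<^sup>2) * (1 + m\<^sup>2)) \<le> 3 * (2 * 2)"
        using True m by (intro mult_mono) auto
      also have "\<dots> \<le> 12 * (1 + m ^ 6)" using m by simp
      finally show ?thesis .
    next
      case False
      then have "1 \<le> m" "1 \<le> m\<^sup>2" by auto
      then have "(1 + 2 * m) * ((1 + m\<^sup>2) * (1 + m\<^sup>2)) \<le> (3 * m) * ((2 * m\<^sup>2) * (2 * m\<^sup>2))"
        by (intro mult_mono) auto
      also have "\<dots> = 12 * m ^ 5" by (simp add: eval_nat_numeral)
      also have "\<dots> \<le> 12 * m ^ 6" using \<open>1 \<le> m\<close> by (simp add: power_increasing)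
      also have "\<dots> \<le> 12 * (1 + m ^ 6)" by simp
      finally show ?thesis .
    qed
    also have "m ^ 6 \<le> \<bar>k$1\<bar> ^ 6 + \<bar>k$2\<bar> ^ 6"
      unfolding m_def max_def by auto
    finally have "norm (fourier w k) * ((1 + norm k) * ?p) \<le> norm (fourier w k) * (12 * (1 + (\<bar>k$1\<bar> ^ 6 + \<bar>k$2\<bar> ^ 6)))"
      by (intro mult_left_mono) auto
    also have "\<dots> = 12 * (norm (fourier w k) + \<bar>k$1\<bar> ^ 6 * norm (fourier w k) + \<bar>k$2\<bar> ^ 6 * norm (fourier w k))"
      by (simp add: algebra_simps)
    also have "\<dots> \<le> 12 * (C0 + C1 + C2)" using C[of k] by simp
    finally show "norm ((1 + norm k) * norm (fourier w k)) * ?p \<le> 12 * (C0 + C1 + C2)" by (simp add: mult_ac)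
  qed measurable
qed

section \<open>Fourier inversion\<close>

definition gauss2 :: "real^2 \<Rightarrow> real" where
  "gauss2 u = std_normal_density (u$1) * std_normal_density (u$2)"

lemma gauss2_eq: "gauss2 u = exp (- (norm u)\<^sup>2 / 2) / (2 * pi)"
proof -
  have "exp (- (u$1)\<^sup>2 / 2) * exp (- (u$2)\<^sup>2 / 2) = exp (- (norm u)\<^sup>2 / 2)"
    by (simp add: norm_real2 exp_add[symmetric] diff_divide_distrib)
  moreover have "sqrt (2 * pi) * sqrt (2 * pi) = 2 * pi" by simp
  ultimately show ?thesis unfolding gauss2_def std_normal_density_def
    by (simp add: mult.assoc divide_simps)
qed

lemma gauss2_nonneg: "gauss2 u \<ge> 0" by (simp add: gauss2_def)

lemma gauss2_measurable [measurable]: "gauss2 \<in> borel_measurable borel"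
  unfolding gauss2_def[abs_def] by measurable

lemma gauss2_continuous: "continuous_on UNIV gauss2"
  unfolding gauss2_eq[abs_def] by (intro continuous_intros) auto

lemma gauss2_le: "gauss2 u \<le> 1 / (2 * pi)"
  unfolding gauss2_eq by (intro divide_right_mono) auto

lemma std_normal_char:
  "integrable lborel (\<lambda>x. of_real (std_normal_density x) * iexp (t * x))"
  "(LINT x|lborel. of_real (std_normal_density x) * iexp (t * x)) = of_real (exp (- t\<^sup>2 / 2))"
proof -
  have "(\<lambda>x. iexp (t * x)) \<in> borel_measurable borel" by measurable
  then show "(LINT x|lborel. of_real (std_normal_density x) * iexp (t * x)) = of_real (exp (- t\<^sup>2 / 2))"
    using fun_cong[OF char_std_normal_distribution, of t] unfolding char_def
    by (subst (asm) integral_density) (auto simp: scaleR_conv_of_real)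
  show "integrable lborel (\<lambda>x. of_real (std_normal_density x) * iexp (t * x))"
    by (rule Bochner_Integration.integrable_bound[OF integrable_normal_density[where \<mu>=0 and \<sigma>=1]]) (auto simp: norm_mult)
qed

lemma gauss2_fourier:
  "integrable lborel (\<lambda>u. iexp (v \<bullet> u) * of_real (gauss2 u))"
  "(LINT u|lborel. iexp (v \<bullet> u) * of_real (gauss2 u)) = of_real (2 * pi * gauss2 v)"
proof -
  have e: "iexp (v \<bullet> u) * of_real (gauss2 u) = (of_real (std_normal_density (u$1)) * iexp (v$1 * u$1)) * (of_real (std_normal_density (u$2)) * iexp (v$2 * u$2))" for u
    by (simp add: gauss2_def inner_vec_def UNIV_2 exp_add[symmetric] algebra_simps mult_exp_exp)
  show "integrable lborel (\<lambda>u. iexp (v \<bullet> u) * of_real (gauss2 u))"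
    unfolding e by (rule product_integrable_plane(1)[OF std_normal_char(1) std_normal_char(1)])
  have "(LINT u|lborel. iexp (v \<bullet> u) * of_real (gauss2 u)) = of_real (exp (- (v$1)\<^sup>2 / 2)) * of_real (exp (- (v$2)\<^sup>2 / 2))"
    unfolding e product_integrable_plane(2)[OF std_normal_char(1) std_normal_char(1)] std_normal_char(2) ..
  also have "\<dots> = of_real (2 * pi * gauss2 v)"
    unfolding gauss2_eq norm_real2 by (simp add: exp_add[symmetric] diff_divide_distrib flip: of_real_mult)
  finally show "(LINT u|lborel. iexp (v \<bullet> u) * of_real (gauss2 u)) = of_real (2 * pi * gauss2 v)" .
qed

lemma gauss2_integrable: "integrable lborel gauss2" "(LINT u|lborel. gauss2 u) = 1"
proof -
  show "integrable lborel gauss2"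
    using gauss2_fourier(1)[of 0] by (simp add: complex_of_real_integrable_eq)
  have "of_real (LINT u|lborel. gauss2 u) = (of_real (2 * pi * gauss2 0) :: complex)"
    using gauss2_fourier(2)[of 0] by simp
  moreover have "gauss2 0 = 1 / (2 * pi)" by (simp add: gauss2_eq)
  ultimately show "(LINT u|lborel. gauss2 u) = 1" unfolding of_real_eq_iff by simp
qed

lemma lborel_affine_real2:
  fixes f :: "real^2 \<Rightarrow> 'b::{banach, second_countable_topology}"
  assumes [measurable]: "f \<in> borel_measurable borel" and c: "c \<noteq> 0"
  shows "integrable lborel f \<longleftrightarrow> integrable lborel (\<lambda>u. f (t + c *\<^sub>R u))"
    and "(LINT y|lborel. f y) = c\<^sup>2 *\<^sub>R (LINT u|lborel. f (t + c *\<^sub>R u))"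
proof -
  have L: "lborel = density (distr lborel borel (\<lambda>u::real^2. t + c *\<^sub>R u)) (\<lambda>_. ennreal (c\<^sup>2))"
    using lborel_affine[OF c, of t] by (simp add: power2_abs)
  have "integrable lborel f \<longleftrightarrow> integrable (density (distr lborel borel (\<lambda>u::real^2. t + c *\<^sub>R u)) (\<lambda>_. ennreal (c\<^sup>2))) f"
    by (rule arg_cong[OF L])
  also have "\<dots> \<longleftrightarrow> integrable (distr lborel borel (\<lambda>u::real^2. t + c *\<^sub>R u)) (\<lambda>y. c\<^sup>2 *\<^sub>R f y)"
    by (rule integrable_density) auto
  also have "\<dots> \<longleftrightarrow> integrable lborel (\<lambda>u. c\<^sup>2 *\<^sub>R f (t + c *\<^sub>R u))"
    by (rule integrable_distr_eq) auto
  also have "\<dots> \<longleftrightarrow> integrable lborel (\<lambda>u. f (t + c *\<^sub>R u))"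
  proof
    assume A: "integrable lborel (\<lambda>u. c\<^sup>2 *\<^sub>R f (t + c *\<^sub>R u))"
    have "integrable lborel (\<lambda>u. inverse (c\<^sup>2) *\<^sub>R (c\<^sup>2 *\<^sub>R f (t + c *\<^sub>R u)))"
      by (rule integrable_scaleR_right) (rule A)
    then show "integrable lborel (\<lambda>u. f (t + c *\<^sub>R u))" using c by simp
  qed (intro integrable_scaleR_right)
  finally show "integrable lborel f \<longleftrightarrow> integrable lborel (\<lambda>u. f (t + c *\<^sub>R u))" .
  have "(LINT y|lborel. f y) = (LINT y|density (distr lborel borel (\<lambda>u::real^2. t + c *\<^sub>R u)) (\<lambda>_. ennreal (c\<^sup>2)). f y)"
    by (rule arg_cong[OF L])
  also have "\<dots> = (LINT y|distr lborel borel (\<lambda>u::real^2. t + c *\<^sub>R u). c\<^sup>2 *\<^sub>R f y)"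
    by (rule integral_density) auto
  also have "\<dots> = (LINT u|lborel. c\<^sup>2 *\<^sub>R f (t + c *\<^sub>R u))"
    by (rule integral_distr) auto
  also have "\<dots> = c\<^sup>2 *\<^sub>R (LINT u|lborel. f (t + c *\<^sub>R u))"
    by simp
  finally show "(LINT y|lborel. f y) = c\<^sup>2 *\<^sub>R (LINT u|lborel. f (t + c *\<^sub>R u))" .
qed

lemma gauss2_scaled_fourier:
  assumes "e > 0"
  shows "integrable lborel (\<lambda>k. gauss2 (e *\<^sub>R k))"
    "(LINT k|lborel. iexp (v \<bullet> k) * of_real (gauss2 (e *\<^sub>R k))) = of_real (2 * pi / e\<^sup>2 * gauss2 (v /\<^sub>R e))"
proof -
  show "integrable lborel (\<lambda>k. gauss2 (e *\<^sub>R k))"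
    using lborel_affine_real2(1)[of gauss2 e 0] gauss2_integrable assms by simp
  have "(LINT u|lborel. iexp ((v /\<^sub>R e) \<bullet> u) * of_real (gauss2 u))
      = e\<^sup>2 *\<^sub>R (LINT u|lborel. iexp ((v /\<^sub>R e) \<bullet> (0 + e *\<^sub>R u)) * of_real (gauss2 (0 + e *\<^sub>R u)))"
    by (rule lborel_affine_real2(2)) (use assms in auto)
  also have "(\<lambda>u. iexp ((v /\<^sub>R e) \<bullet> (0 + e *\<^sub>R u)) * of_real (gauss2 (0 + e *\<^sub>R u))) = (\<lambda>u. iexp (v \<bullet> u) * of_real (gauss2 (e *\<^sub>R u)))"
  proof -
    have "(v /\<^sub>R e) \<bullet> (0 + e *\<^sub>R u) = v \<bullet> u" for u using assms by simp
    then show ?thesis by (simp only: add_0)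
  qed
  finally have "of_real (2 * pi * gauss2 (v /\<^sub>R e)) = e\<^sup>2 *\<^sub>R (LINT u|lborel. iexp (v \<bullet> u) * complex_of_real (gauss2 (e *\<^sub>R u)))"
    unfolding gauss2_fourier(2) .
  then show "(LINT k|lborel. iexp (v \<bullet> k) * of_real (gauss2 (e *\<^sub>R k))) = of_real (2 * pi / e\<^sup>2 * gauss2 (v /\<^sub>R e))"
    using assms by (simp add: scaleR_conv_of_real divide_simps mult_ac)
qed

text \<open>The Gaussian factor makes the double integral over \<open>k\<close> and \<open>y\<close> absolutely convergent. After
  exchanging the integrals the transform of the Gaussian appears, again a Gaussian, and it averages \<open>w\<close> around \<open>x\<close>
  on the scale \<open>e\<close>.\<close>
lemma gaussian_regularised_inversion:
  fixes w :: "real^2 \<Rightarrow> complex"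
  assumes w: "integrable lborel w" and e: "e > 0"
  shows "(LINT k|lborel. (iexp (x \<bullet> k) * fourier w k) * of_real (gauss2 (e *\<^sub>R k)))
     = of_real (2 * pi) * (LINT u|lborel. w (x + (- e) *\<^sub>R u) * of_real (gauss2 u))"
proof -
  let ?g = "\<lambda>k y. cexp k y * w y * (iexp (x \<bullet> k) * of_real (gauss2 (e *\<^sub>R k)))"
  have [measurable]: "w \<in> borel_measurable borel" using w by (auto dest: borel_measurable_integrable)
  have int: "integrable lborel2 (\<lambda>(k, y). ?g k y)"
  proof (rule lborel_pair.Fubini_integrable)
    have "(LINT y|lborel. norm (?g k y))
       = (LINT y|lborel. norm (w y)) * gauss2 (e *\<^sub>R k)" for k
      using gauss2_nonneg by (simp add: norm_mult)
    then show "integrable lborel (\<lambda>k. LINT y|lborel. norm (case (k, y) of (k, y) \<Rightarrow> ?g k y))"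
      using gauss2_scaled_fourier(1)[OF e] by simp
    show "AE k in lborel. integrable lborel (\<lambda>y. case (k, y) of (k, y) \<Rightarrow> ?g k y)"
      by (simp only: prod.case) (intro AE_I2 integrable_mult_left integrable_exp_mult(1)[OF w])
  qed measurable
  have "(LINT k|lborel. (iexp (x \<bullet> k) * fourier w k) * of_real (gauss2 (e *\<^sub>R k)))
    = (LINT k|lborel. LINT y|lborel. ?g k y)"
    unfolding fourier_def integral_mult_left_zero by (simp add: mult_ac)
  also have "\<dots> = (LINT y|lborel. LINT k|lborel. ?g k y)"
    by (rule lborel_pair.Fubini_integral[OF int, symmetric])
  also have "\<dots> = (LINT y|lborel. w y * (LINT k|lborel. iexp ((x - y) \<bullet> k) * of_real (gauss2 (e *\<^sub>R k))))"
    unfolding integral_mult_right_zero[symmetric]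
    by (intro Bochner_Integration.integral_cong refl)
      (simp add: inner_diff_left algebra_simps exp_diff exp_minus divide_inverse)
  also have "\<dots> = (LINT y|lborel. w y * of_real (2 * pi / e\<^sup>2 * gauss2 ((x - y) /\<^sub>R e)))"
    unfolding gauss2_scaled_fourier(2)[OF e] ..
  also have "\<dots> = (- e)\<^sup>2 *\<^sub>R (LINT u|lborel. w (x + (- e) *\<^sub>R u) * of_real (2 * pi / e\<^sup>2 * gauss2 ((x - (x + (- e) *\<^sub>R u)) /\<^sub>R e)))"
    by (rule lborel_affine_real2(2)) (use e in auto)
  also have "\<dots> = (LINT u|lborel. of_real (2 * pi) * (w (x + (- e) *\<^sub>R u) * of_real (gauss2 u)))"
    unfolding integral_scaleR_right[symmetric] using e
    by (intro Bochner_Integration.integral_cong refl) (simp add: scaleR_conv_of_real[where 'a=complex])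
  finally show ?thesis by simp
qed

text \<open>Both sides of the regularised formula converge by dominated convergence as the scale tends to \<open>0\<close>: on the
  left the Gaussian factor tends to the constant \<open>1 / (2 * pi)\<close>, on the right the averages tend to \<open>w x\<close>.\<close>
theorem fourier_inversion:
  fixes w :: "real^2 \<Rightarrow> complex"
  assumes w: "integrable lborel w" and c: "continuous_on UNIV w" and b: "\<And>x. norm (w x) \<le> M"
    and fw: "integrable lborel (fourier w)"
  shows "(LINT k|lborel. iexp (x \<bullet> k) * fourier w k) = of_real ((2 * pi)\<^sup>2) * w x"
proof -
  have [measurable]: "w \<in> borel_measurable borel" using w by (auto dest: borel_measurable_integrable)
  define e where "e n = 1 / real (Suc n)" for n
  have e: "e n > 0" for n by (simp add: e_def)
  have e0: "e \<longlonglongrightarrow> 0" unfolding e_def using LIMSEQ_Suc[OF lim_1_over_n] by simp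
  have iw: "integrable lborel (\<lambda>k. iexp (x \<bullet> k) * fourier w k)"
    using integrable_exp_mult(2)[OF fw, of x] by (simp add: inner_commute)
  have g0: "isCont gauss2 z" for z using gauss2_continuous by (simp add: continuous_on_eq_continuous_at)
  have w0: "isCont w z" for z using c by (simp add: continuous_on_eq_continuous_at)
  have 1: "(\<lambda>n. LINT k|lborel. (iexp (x \<bullet> k) * fourier w k) * of_real (gauss2 (e n *\<^sub>R k))) \<longlonglongrightarrow>
    (LINT k|lborel. (iexp (x \<bullet> k) * fourier w k) * of_real (gauss2 (0 *\<^sub>R k)))"
  proof (rule integral_dominated_convergence)
    show "integrable lborel (\<lambda>k. norm (fourier w k) * (1 / (2 * pi)))" using fw by simp
    show "AE k in lborel. (\<lambda>n. (iexp (x \<bullet> k) * fourier w k) * of_real (gauss2 (e n *\<^sub>R k))) \<longlonglongrightarrow> (iexp (x \<bullet> k) * fourier w k) * of_real (gauss2 (0 *\<^sub>R k))"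
      by (intro AE_I2 tendsto_intros isCont_tendsto_compose[OF g0] e0)
    show "AE k in lborel. norm ((iexp (x \<bullet> k) * fourier w k) * of_real (gauss2 (e n *\<^sub>R k))) \<le> norm (fourier w k) * (1 / (2 * pi))" for n
    proof (rule AE_I2)
      fix k
      have "norm ((iexp (x \<bullet> k) * fourier w k) * of_real (gauss2 (e n *\<^sub>R k))) = norm (fourier w k) * gauss2 (e n *\<^sub>R k)"
        using gauss2_nonneg by (simp add: norm_mult)
      also have "\<dots> \<le> norm (fourier w k) * (1 / (2 * pi))"
        by (intro mult_left_mono gauss2_le) auto
      finally show "norm ((iexp (x \<bullet> k) * fourier w k) * of_real (gauss2 (e n *\<^sub>R k))) \<le> norm (fourier w k) * (1 / (2 * pi))" .
    qed
  qed measurable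
  have 2: "(\<lambda>n. LINT u|lborel. w (x + (- e n) *\<^sub>R u) * of_real (gauss2 u)) \<longlonglongrightarrow> (LINT u|lborel. w (x + (- 0) *\<^sub>R u) * of_real (gauss2 u))"
  proof (rule integral_dominated_convergence)
    show "integrable lborel (\<lambda>u. M * gauss2 u)" using gauss2_integrable by simp
    show "AE u in lborel. (\<lambda>n. w (x + (- e n) *\<^sub>R u) * of_real (gauss2 u)) \<longlonglongrightarrow> w (x + (- 0) *\<^sub>R u) * of_real (gauss2 u)"
      by (intro AE_I2 tendsto_intros isCont_tendsto_compose[OF w0] e0)
    show "AE u in lborel. norm (w (x + (- e n) *\<^sub>R u) * of_real (gauss2 u)) \<le> M * gauss2 u" for n
      using b gauss2_nonneg by (auto simp: norm_mult intro!: mult_right_mono)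
  qed measurable
  have "(LINT k|lborel. (iexp (x \<bullet> k) * fourier w k) * of_real (gauss2 (0 *\<^sub>R k))) = of_real (2 * pi) * (LINT u|lborel. w (x + (- 0) *\<^sub>R u) * of_real (gauss2 u))"
    using 1 tendsto_mult_left[OF 2, of "of_real (2 * pi)"] unfolding gaussian_regularised_inversion[OF w e]
    by (rule LIMSEQ_unique)
  also have "(LINT u|lborel. w (x + (- 0) *\<^sub>R u) * of_real (gauss2 u)) = w x"
    using gauss2_integrable by simp
  also have "(LINT k|lborel. (iexp (x \<bullet> k) * fourier w k) * of_real (gauss2 (0 *\<^sub>R k))) = (LINT k|lborel. iexp (x \<bullet> k) * fourier w k) * of_real (1 / (2 * pi))"
    by (simp add: gauss2_eq)
  finally show ?thesis by (simp add: field_simps power2_eq_square)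
qed

section \<open>The integral form of the operator\<close>

lemma schwartz_fourier_integrable:
  assumes "schwartz w"
  shows "integrable lborel (fourier w)" "integrable lborel (\<lambda>k. norm k * norm (fourier w k))"
proof -
  have [measurable]: "w \<in> borel_measurable borel" using schwartz_measurable[OF assms] .
  show "integrable lborel (fourier w)"
    by (rule Bochner_Integration.integrable_bound[OF fourier_moment_integrable[OF assms]])
      (auto simp: algebra_simps)
  show "integrable lborel (\<lambda>k. norm k * norm (fourier w k))"
    by (rule Bochner_Integration.integrable_bound[OF fourier_moment_integrable[OF assms]])
      (auto simp: algebra_simps)
qed

lemma schwartz_inversion:
  assumes "schwartz w"
  shows "(LINT k|lborel. iexp (x \<bullet> k) * fourier w k) = of_real ((2 * pi)\<^sup>2) * w x"
proof -
  obtain M where "\<And>x. norm (w x) \<le> M" using schwartz_derivative(3)[OF assms, of 0 0] by auto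
  moreover have "continuous_on UNIV w" "integrable lborel w"
    using schwartz_derivative(1,2)[OF assms, of 0 0] by (auto intro: smooth_on_continuous_on)
  ultimately show ?thesis using fourier_inversion schwartz_fourier_integrable(1)[OF assms] by blast
qed

lemma second_difference_fourier:
  assumes "schwartz w"
  shows "w (x - y) + w (x + y) - 2 * w x = of_real (- 2 / (2 * pi)\<^sup>2) * (LINT k|lborel. (iexp (x \<bullet> k) * fourier w k) * of_real (1 - cos (k \<bullet> y)))"
proof -
  have i: "integrable lborel (\<lambda>k. iexp (x \<bullet> k) * fourier w k)" for x
    using integrable_exp_mult(2)[OF schwartz_fourier_integrable(1)[OF assms], of x] by (simp add: inner_commute)
  have e: "(iexp (x \<bullet> k) * fourier w k) * of_real (1 - cos (k \<bullet> y))
     = iexp (x \<bullet> k) * fourier w k - (iexp ((x - y) \<bullet> k) * fourier w k + iexp ((x + y) \<bullet> k) * fourier w k) / 2" for k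
  proof -
    have "of_real (cos (k \<bullet> y)) = (iexp (y \<bullet> k) + iexp (- (y \<bullet> k))) / 2"
      by (simp add: cos_of_real[symmetric] cos_exp_eq inner_commute del: cos_of_real)
    moreover have "iexp ((x - y) \<bullet> k) = iexp (x \<bullet> k) * iexp (- (y \<bullet> k))" "iexp ((x + y) \<bullet> k) = iexp (x \<bullet> k) * iexp (y \<bullet> k)"
      by (simp_all add: inner_diff_left inner_add_left mult_exp_exp algebra_simps)
    ultimately show ?thesis by (simp add: algebra_simps add_divide_distrib)
  qed
  define J where "J = (LINT k|lborel. (iexp (x \<bullet> k) * fourier w k) * of_real (1 - cos (k \<bullet> y)))"
  define P :: complex where "P = of_real ((2 * pi)\<^sup>2)"
  have P: "P \<noteq> 0" "of_real (- 2 / (2 * pi)\<^sup>2) = - 2 / P" by (simp_all add: P_def)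
  have "J = P * w x - (P * w (x - y) + P * w (x + y)) / 2"
    unfolding J_def P_def e using i by (simp add: schwartz_inversion[OF assms])
  then show ?thesis unfolding J_def[symmetric] P(2) using P(1) by (simp add: field_simps)
qed

context positive_moduli
begin

text \<open>Write the second difference by Fourier inversion and exchange the integrals over \<open>k\<close> and \<open>y\<close>. The inner
  integral over \<open>y\<close> is \<open>2 * pi\<close> times the symbol. The same application of Fubini's theorem shows that the
  integral over \<open>y\<close> converges absolutely.\<close>
lemma elastic_operator:
  assumes w: "schwartz w"
  shows "integrable lborel (\<lambda>k. of_real (symbol a b k) * fourier w k)"
    and "integrable lborel (second_difference_integrand (elastic_kernel a b) w x)"
    and "fourier_multiplier (symbol a b) w x = of_real (- 1 / (4 * pi)) * (LINT y|lborel. second_difference_integrand (elastic_kernel a b) w x y)"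
proof -
  let ?K = "elastic_kernel a b"
  let ?L = "\<lambda>k. (LINT y|lborel. \<bar>(1 - cos (k \<bullet> y)) * ?K y\<bar>)"
  let ?g = "\<lambda>k y. (iexp (x \<bullet> k) * fourier w k) * of_real ((1 - cos (k \<bullet> y)) * ?K y)"
  have [measurable]: "w \<in> borel_measurable borel" using schwartz_measurable[OF w] .
  obtain M where M: "\<And>k. integrable lborel (\<lambda>y. (1 - cos (k \<bullet> y)) * ?K y)"
    "\<And>k. (LINT y|lborel. (1 - cos (k \<bullet> y)) * ?K y) = 2 * pi * symbol a b k"
    "\<And>k. ?L k \<le> M * norm k"
    using elastic_kernel_cos_integral by blast
  have [measurable]: "symbol a b \<in> borel_measurable borel" unfolding symbol_def[abs_def] by measurable
  have dom: "integrable lborel (\<lambda>k. norm (fourier w k) * (M * norm k))"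
    using integrable_mult_right[of M, OF schwartz_fourier_integrable(2)[OF w]] by (simp add: mult_ac)
  have sb: "\<bar>2 * pi * symbol a b k\<bar> \<le> M * norm k" for k
    unfolding M(2)[symmetric] by (rule order_trans[OF integral_abs_bound M(3)])
  have sb1: "\<bar>symbol a b k\<bar> \<le> M * norm k" for k
  proof -
    have "1 * \<bar>symbol a b k\<bar> \<le> (2 * pi) * \<bar>symbol a b k\<bar>"
      using pi_gt3 by (intro mult_right_mono) auto
    then show ?thesis using sb[of k] by (simp add: abs_mult)
  qed
  show "integrable lborel (\<lambda>k. of_real (symbol a b k) * fourier w k)"
  proof (rule Bochner_Integration.integrable_bound[OF dom])
    show "AE k in lborel. norm (of_real (symbol a b k) * fourier w k) \<le> norm (norm (fourier w k) * (M * norm k))"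
    proof (rule AE_I2)
      fix k
      have "norm (of_real (symbol a b k) * fourier w k) = norm (fourier w k) * \<bar>symbol a b k\<bar>" by (simp add: norm_mult)
      also have "\<dots> \<le> norm (fourier w k) * (M * norm k)" by (intro mult_left_mono sb1) auto
      also have "\<dots> \<le> norm (norm (fourier w k) * (M * norm k))" by (simp only: real_norm_def abs_ge_self)
      finally show "norm (of_real (symbol a b k) * fourier w k) \<le> norm (norm (fourier w k) * (M * norm k))" .
    qed
  qed measurable
  have int: "integrable lborel2 (\<lambda>(k, y). ?g k y)"
  proof (rule lborel_pair.Fubini_integrable)
    have e: "(LINT y|lborel. norm (?g k y))
      = norm (fourier w k) * ?L k" for k
      by (simp add: norm_mult del: of_real_mult)
    have "integrable lborel (\<lambda>k. norm (fourier w k) * ?L k)"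
    proof (rule Bochner_Integration.integrable_bound[OF dom])
      show "AE k in lborel. norm (norm (fourier w k) * ?L k) \<le> norm (norm (fourier w k) * (M * norm k))"
      proof (rule AE_I2)
        fix k
        have "norm (norm (fourier w k) * ?L k) = norm (fourier w k) * ?L k"
          by (simp add: integral_nonneg_AE del: abs_mult)
        also have "\<dots> \<le> norm (fourier w k) * (M * norm k)" by (intro mult_left_mono M(3)) auto
        also have "\<dots> \<le> norm (norm (fourier w k) * (M * norm k))" by (simp only: real_norm_def abs_ge_self)
        finally show "norm (norm (fourier w k) * ?L k) \<le> norm (norm (fourier w k) * (M * norm k))" .
      qed
    qed measurable
    then show "integrable lborel (\<lambda>k. LINT y|lborel. norm (case (k, y) of (k, y) \<Rightarrow> ?g k y))"
      by (simp only: prod.case e)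
    show "AE k in lborel. integrable lborel (\<lambda>y. case (k, y) of (k, y) \<Rightarrow> ?g k y)"
      by (simp only: prod.case) (intro AE_I2 integrable_mult_right integrable_of_real M(1))
  qed measurable
  have sd: "second_difference_integrand ?K w x y = of_real (- 2 / (2 * pi)\<^sup>2) * (LINT k|lborel. ?g k y)" for y
    unfolding second_difference_integrand_def second_difference_fourier[OF w]
    unfolding mult.assoc integral_mult_left_zero[symmetric] of_real_mult ..
  show "integrable lborel (second_difference_integrand ?K w x)"
    unfolding sd[abs_def] using lborel_pair.integrable_snd[OF int] by (rule integrable_mult_right)
  have "(LINT y|lborel. second_difference_integrand ?K w x y)
    = of_real (- 2 / (2 * pi)\<^sup>2) * (LINT y|lborel. LINT k|lborel. ?g k y)"
    unfolding sd by simp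
  also have "(LINT y|lborel. LINT k|lborel. ?g k y)
    = (LINT k|lborel. LINT y|lborel. ?g k y)"
    by (rule lborel_pair.Fubini_integral[OF int])
  also have "\<dots> = (LINT k|lborel. of_real (2 * pi) * (iexp (x \<bullet> k) * (of_real (symbol a b k) * fourier w k)))"
  proof (intro Bochner_Integration.integral_cong refl)
    fix k
    show "(LINT y|lborel. ?g k y) = of_real (2 * pi) * (iexp (x \<bullet> k) * (of_real (symbol a b k) * fourier w k))"
      unfolding integral_mult_right_zero integral_complex_of_real M(2) by (simp add: mult_ac)
  qed
  also have "\<dots> = of_real (2 * pi) * (LINT k|lborel. iexp (x \<bullet> k) * (of_real (symbol a b k) * fourier w k))"
    by simp
  finally show "fourier_multiplier (symbol a b) w x = of_real (- 1 / (4 * pi)) * (LINT y|lborel. second_difference_integrand ?K w x y)"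
    unfolding fourier_multiplier_def inv_fourier_def by (simp add: power2_eq_square)
qed

lemma elastic_kernel_admissible: "admissible_kernel (elastic_kernel a b)"
  unfolding admissible_kernel_def using elastic_operator(2)
  by (auto simp: elastic_kernel_def Let_def)

end

section \<open>The Gaussian as a Schwartz function\<close>

lemma real_polynomial_function_derivative:
  assumes "real_polynomial_function (p :: real^2 \<Rightarrow> real)"
  shows "\<exists>p1 p2. real_polynomial_function p1 \<and> real_polynomial_function p2 \<and>
    (\<forall>z. (p has_derivative (\<lambda>h. p1 z * h$1 + p2 z * h$2)) (at z))"
  using assms
proof induction
  case (linear f)
  have "f h = f (axis 1 1) * h$1 + f (axis 2 1) * h$2" for h
  proof -
    have "h = h$1 *\<^sub>R axis 1 1 + h$2 *\<^sub>R axis 2 1" by (simp add: vec_eq_iff forall_2 axis_def)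
    then have "f h = f (h$1 *\<^sub>R axis 1 1 + h$2 *\<^sub>R axis 2 1)" by simp
    also have "\<dots> = h$1 *\<^sub>R f (axis 1 1) + h$2 *\<^sub>R f (axis 2 1)"
      using linear by (simp add: bounded_linear.linear linear_add linear_scale)
    finally show ?thesis by (simp add: mult.commute)
  qed
  then have "(f has_derivative (\<lambda>h. f (axis 1 1) * h$1 + f (axis 2 1) * h$2)) (at z)" for z
    using bounded_linear_imp_has_derivative[OF linear, of "at z"] by (metis (no_types, lifting) ext)
  then show ?case
    by (intro exI[of _ "\<lambda>z. f (axis 1 1)"] exI[of _ "\<lambda>z. f (axis 2 1)"]) (auto intro: real_polynomial_function.intros)
next
  case (const c)
  show ?case by (intro exI[of _ "\<lambda>z. 0"]) (auto intro: real_polynomial_function.intros)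
next
  case (add f g)
  then obtain f1 f2 g1 g2 where "real_polynomial_function f1" "real_polynomial_function f2"
      "real_polynomial_function g1" "real_polynomial_function g2"
    and d: "\<And>z. (f has_derivative (\<lambda>h. f1 z * h$1 + f2 z * h$2)) (at z)"
      "\<And>z. (g has_derivative (\<lambda>h. g1 z * h$1 + g2 z * h$2)) (at z)"
    by blast
  moreover have "((\<lambda>z. f z + g z) has_derivative (\<lambda>h. (f1 z + g1 z) * h$1 + (f2 z + g2 z) * h$2)) (at z)" for z
    by (rule has_derivative_eq_rhs[OF has_derivative_add[OF d]]) (simp add: fun_eq_iff algebra_simps)
  ultimately show ?case
    by (intro exI[of _ "\<lambda>z. f1 z + g1 z"] exI[of _ "\<lambda>z. f2 z + g2 z"]) (simp add: real_polynomial_function.intros(3))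
next
  case (mult f g)
  then obtain f1 f2 g1 g2 where "real_polynomial_function f1" "real_polynomial_function f2"
      "real_polynomial_function g1" "real_polynomial_function g2"
    and d: "\<And>z. (f has_derivative (\<lambda>h. f1 z * h$1 + f2 z * h$2)) (at z)"
      "\<And>z. (g has_derivative (\<lambda>h. g1 z * h$1 + g2 z * h$2)) (at z)"
    by blast
  moreover have "((\<lambda>z. f z * g z) has_derivative (\<lambda>h. (f1 z * g z + f z * g1 z) * h$1 + (f2 z * g z + f z * g2 z) * h$2)) (at z)" for z
    by (rule has_derivative_eq_rhs[OF has_derivative_mult[OF d]]) (simp add: fun_eq_iff algebra_simps)
  ultimately show ?case using mult.hyps
    by (intro exI[of _ "\<lambda>z. f1 z * g z + f z * g1 z"] exI[of _ "\<lambda>z. f2 z * g z + f z * g2 z"])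
      (simp add: real_polynomial_function.intros(3) real_polynomial_function.intros(4))
qed

lemma real_polynomial_function_growth:
  assumes "real_polynomial_function (p :: 'a::real_normed_vector \<Rightarrow> real)"
  shows "\<exists>C n. C \<ge> 0 \<and> (\<forall>x. \<bar>p x\<bar> \<le> C * (1 + norm x) ^ n)"
  using assms
proof induction
  case (linear f)
  obtain K where K: "K > 0" "\<And>x. norm (f x) \<le> norm x * K"
    using bounded_linear.pos_bounded[OF linear] by blast
  have "\<bar>f x\<bar> \<le> K * (1 + norm x) ^ 1" for x
    using K(2)[of x] K(1) by (simp add: algebra_simps)
  then show ?case using K(1) less_imp_le by blast
next
  case (const c)
  then show ?case by (intro exI[of _ "\<bar>c\<bar>"] exI[of _ 0]) auto
next
  case (add f g)
  then obtain C m C' n where *: "C \<ge> 0" "\<And>x. \<bar>f x\<bar> \<le> C * (1 + norm x) ^ m" "C' \<ge> 0" "\<And>x. \<bar>g x\<bar> \<le> C' * (1 + norm x) ^ n"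
    by blast
  have "\<bar>f x + g x\<bar> \<le> (C + C') * (1 + norm x) ^ (m + n)" for x
  proof -
    have "C * (1 + norm x) ^ m \<le> C * (1 + norm x) ^ (m + n)" "C' * (1 + norm x) ^ n \<le> C' * (1 + norm x) ^ (m + n)"
      using * by (auto intro!: mult_left_mono power_increasing)
    then show ?thesis using *(2,4)[of x] by (auto simp: algebra_simps)
  qed
  then show ?case using *(1,3) by (meson add_nonneg_nonneg)
next
  case (mult f g)
  then obtain C m C' n where *: "C \<ge> 0" "\<And>x. \<bar>f x\<bar> \<le> C * (1 + norm x) ^ m" "C' \<ge> 0" "\<And>x. \<bar>g x\<bar> \<le> C' * (1 + norm x) ^ n"
    by blast
  have "\<bar>f x * g x\<bar> \<le> (C * C') * (1 + norm x) ^ (m + n)" for x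
  proof -
    have "\<bar>f x * g x\<bar> \<le> (C * (1 + norm x) ^ m) * (C' * (1 + norm x) ^ n)"
      unfolding abs_mult using * by (intro mult_mono) auto
    then show ?thesis by (simp add: power_add mult_ac)
  qed
  then show ?case using *(1,3) by (meson mult_nonneg_nonneg)
qed

definition gaussian :: "real^2 \<Rightarrow> complex" where
  "gaussian x = of_real (exp (- (norm x)\<^sup>2 / 2))"

text \<open>The family used to differentiate the Gaussian: \<open>p\<close> becomes \<open>partial i p - p * z$i\<close>.\<close>
definition hermite_class :: "(real^2 \<Rightarrow> complex) set" where
  "hermite_class = {f. \<exists>p. real_polynomial_function p \<and> f = (\<lambda>x. of_real (p x * exp (- (norm x)\<^sup>2 / 2)))}"

lemma hermite_class_partial:
  assumes "f \<in> hermite_class"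
  shows "f differentiable (at x)" "partial i f \<in> hermite_class"
proof -
  obtain p where p: "real_polynomial_function p" and f: "f = (\<lambda>x. of_real (p x * exp (- (norm x)\<^sup>2 / 2)))"
    using assms unfolding hermite_class_def by blast
  obtain p1 p2 where p12: "real_polynomial_function p1" "real_polynomial_function p2"
    and d: "\<And>z. (p has_derivative (\<lambda>h. p1 z * h$1 + p2 z * h$2)) (at z)"
    using real_polynomial_function_derivative[OF p] by blast
  have e: "((\<lambda>x. exp (- (norm x)\<^sup>2 / 2)) has_derivative (\<lambda>h. exp (- (norm z)\<^sup>2 / 2) * (- (z$1 * h$1) - z$2 * h$2))) (at z)" for z :: "real^2"
  proof -
    have "((\<lambda>x. - (x \<bullet> x) / 2) has_derivative (\<lambda>h. - (z \<bullet> h))) (at z)"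
      by (auto intro!: derivative_eq_intros simp: fun_eq_iff inner_commute)
    then have q: "((\<lambda>x. - (x \<bullet> x) / 2) has_derivative (\<lambda>h. - (z$1 * h$1) - z$2 * h$2)) (at z)"
      by (simp add: inner_vec_def UNIV_2)
    show ?thesis
      using has_derivative_compose[OF q DERIV_exp[unfolded has_field_derivative_def]]
      by (simp add: power2_norm_eq_inner)
  qed
  have D: "(f has_derivative (\<lambda>h. of_real (((p1 z - p z * z$1) * h$1 + (p2 z - p z * z$2) * h$2) * exp (- (norm z)\<^sup>2 / 2)))) (at z)" for z
    unfolding f
    by (rule has_derivative_of_real[OF has_derivative_eq_rhs[OF has_derivative_mult[OF d e]]])
      (simp add: fun_eq_iff algebra_simps)
  show "f differentiable (at x)" using D unfolding differentiable_def by blast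
  have "partial 1 f = (\<lambda>z. of_real ((p1 z - p z * z$1) * exp (- (norm z)\<^sup>2 / 2)))"
    "partial 2 f = (\<lambda>z. of_real ((p2 z - p z * z$2) * exp (- (norm z)\<^sup>2 / 2)))"
    by (auto simp: fun_eq_iff partial_eq_derivative[OF D] axis_def)
  moreover have "real_polynomial_function (\<lambda>z. p1 z - p z * z$1)" "real_polynomial_function (\<lambda>z. p2 z - p z * z$2)"
    by (intro real_polynomial_function_diff real_polynomial_function.intros(4) p p12 real_polynomial_function.intros(1)[OF bounded_linear_vec_nth])+
  ultimately have "partial 1 f \<in> hermite_class" "partial 2 f \<in> hermite_class"
    unfolding hermite_class_def by auto
  then show "partial i f \<in> hermite_class" using exhaust_2[of i] by auto
qed

text \<open>A polynomial factor is bounded by a power of \<open>1 + norm x \<le> exp (norm x)\<close>, and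
  \<open>M * r - r\<^sup>2 / 2 \<le> M\<^sup>2 / 2\<close>.\<close>
lemma gaussian_schwartz: "schwartz gaussian"
proof -
  have "real_polynomial_function (\<lambda>x::real^2. 1)" by (rule real_polynomial_function.intros(2))
  then have g: "gaussian \<in> hermite_class" unfolding hermite_class_def gaussian_def[abs_def]
    by (intro CollectI exI[of _ "\<lambda>x. 1"]) simp
  have "smooth_on gaussian UNIV"
    by (rule smooth_on_stable_class[OF open_UNIV _ _ g]) (use hermite_class_partial in blast)+
  moreover have "\<exists>M. \<forall>x. norm x ^ N * norm ((partial 1 ^^ a) ((partial 2 ^^ b) gaussian) x) \<le> M" for N a b
  proof -
    have it: "(partial i ^^ n) f \<in> hermite_class" if "f \<in> hermite_class" for i n f
      using that by (induction n) (auto intro: hermite_class_partial)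
    have "(partial 1 ^^ a) ((partial 2 ^^ b) gaussian) \<in> hermite_class" by (intro it g)
    then obtain p where p: "real_polynomial_function p"
      and f: "(partial 1 ^^ a) ((partial 2 ^^ b) gaussian) = (\<lambda>x. of_real (p x * exp (- (norm x)\<^sup>2 / 2)))"
      unfolding hermite_class_def by blast
    obtain C n where C: "C \<ge> 0" "\<And>x. \<bar>p x\<bar> \<le> C * (1 + norm x) ^ n"
      using real_polynomial_function_growth[OF p] by blast
    let ?M = "real (N + n)"
    have "norm x ^ N * norm ((partial 1 ^^ a) ((partial 2 ^^ b) gaussian) x) \<le> C * exp (?M\<^sup>2 / 2)" for x
    proof -
      let ?r = "norm x"
      have "?r ^ N * norm ((partial 1 ^^ a) ((partial 2 ^^ b) gaussian) x) = ?r ^ N * (\<bar>p x\<bar> * exp (- ?r\<^sup>2 / 2))"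
        unfolding f norm_of_real by (simp add: abs_mult)
      also have "\<dots> \<le> (1 + ?r) ^ N * ((C * (1 + ?r) ^ n) * exp (- ?r\<^sup>2 / 2))"
        using C by (intro mult_mono power_mono) auto
      also have "\<dots> = C * ((1 + ?r) ^ (N + n) * exp (- ?r\<^sup>2 / 2))" by (simp add: power_add)
      also have "\<dots> \<le> C * (exp ?r ^ (N + n) * exp (- ?r\<^sup>2 / 2))"
        using C(1) by (intro mult_left_mono mult_right_mono power_mono exp_ge_add_one_self) auto
      also have "exp ?r ^ (N + n) * exp (- ?r\<^sup>2 / 2) = exp (?M * ?r - ?r\<^sup>2 / 2)"
        by (simp add: exp_of_nat_mult[symmetric] exp_add[symmetric])
      also have "\<dots> \<le> exp (?M\<^sup>2 / 2)"
        using zero_le_power2[of "?M - ?r"] by (simp add: power2_eq_square algebra_simps)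
      finally show ?thesis using C(1) by (simp add: mult_left_mono)
    qed
    then show ?thesis by blast
  qed
  ultimately show ?thesis unfolding schwartz_def by blast
qed

section \<open>Trigonometric polynomials\<close>

text \<open>The phase \<open>\<delta>\<close> treats sines and cosines alike.\<close>
inductive_set trig_poly :: "(real \<Rightarrow> real) set" where
  wave: "(\<lambda>\<theta>. cos (real n * \<theta> + \<delta>)) \<in> trig_poly"
| scale: "f \<in> trig_poly \<Longrightarrow> (\<lambda>\<theta>. c * f \<theta>) \<in> trig_poly"
| add: "f \<in> trig_poly \<Longrightarrow> g \<in> trig_poly \<Longrightarrow> (\<lambda>\<theta>. f \<theta> + g \<theta>) \<in> trig_poly"

lemma wave_mult_wave: "(\<lambda>\<theta>. cos (real n * \<theta> + \<delta>) * cos (real m * \<theta> + \<epsilon>)) \<in> trig_poly"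
proof -
  have aux: "(\<lambda>\<theta>. cos (real n * \<theta> + \<delta>) * cos (real m * \<theta> + \<epsilon>)) \<in> trig_poly" if "m \<le> n" for n m \<delta> \<epsilon>
  proof -
    have "(\<lambda>\<theta>. cos (real n * \<theta> + \<delta>) * cos (real m * \<theta> + \<epsilon>))
      = (\<lambda>\<theta>. 1/2 * (cos (real (n - m) * \<theta> + (\<delta> - \<epsilon>)) + cos (real (n + m) * \<theta> + (\<delta> + \<epsilon>))))"
      using that by (auto simp: cos_times_cos of_nat_diff algebra_simps fun_eq_iff)
    then show ?thesis by (simp only:) (intro trig_poly.intros)
  qed
  show ?thesis
    using aux[of m n \<delta> \<epsilon>] aux[of n m \<epsilon> \<delta>] by (cases "m \<le> n") (auto simp: mult.commute)
qed

lemma trig_poly_mult: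
  assumes "f \<in> trig_poly" "g \<in> trig_poly"
  shows "(\<lambda>\<theta>. f \<theta> * g \<theta>) \<in> trig_poly"
  using assms(1)
proof induction
  case (wave n \<delta>)
  show ?case using assms(2)
  proof induction
    case (scale g c)
    then show ?case using trig_poly.scale[OF scale.IH, of c] by (simp add: mult_ac)
  next
    case (add g h)
    then show ?case using trig_poly.add by (simp add: distrib_left)
  qed (rule wave_mult_wave)
next
  case (scale f c)
  then show ?case using trig_poly.scale[OF scale.IH, of c] by (simp add: mult_ac)
next
  case (add f h)
  then show ?case using trig_poly.add by (simp add: distrib_right)
qed

lemma trig_poly_polynomial:
  assumes "real_polynomial_function P"
  shows "(\<lambda>\<theta>. P (plane (cos \<theta>, sin \<theta>))) \<in> trig_poly"
  using assms
proof induction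
  case (linear f)
  have "f (plane (cos \<theta>, sin \<theta>)) = f (axis 1 1) * cos (real 1 * \<theta> + 0) + f (axis 2 1) * cos (real 1 * \<theta> + (- pi / 2))" for \<theta>
  proof -
    have "sin \<theta> = cos (\<theta> - pi / 2)" by (simp add: cos_diff)
    then show ?thesis
      using linear unfolding plane_def by (simp add: bounded_linear.linear linear_add linear_scale mult.commute)
  qed
  then show ?case by (simp only:) (intro trig_poly.intros)
next
  case (const c)
  have "(\<lambda>\<theta>. c * cos (real 0 * \<theta> + 0)) \<in> trig_poly" by (intro trig_poly.intros)
  then show ?case by simp
qed (auto intro: trig_poly.add trig_poly_mult)

section \<open>Fourier coefficients of solutions in logarithmic polar coordinates\<close>

lemma DERIV_chain_plane:
  fixes f :: "real^2 \<Rightarrow> real"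
  assumes f: "f differentiable (at (plane (x t, y t)))"
    and x: "(x has_real_derivative x') (at t)" and y: "(y has_real_derivative y') (at t)"
  shows "((\<lambda>t. f (plane (x t, y t))) has_real_derivative
    x' * partial 1 f (plane (x t, y t)) + y' * partial 2 f (plane (x t, y t))) (at t)"
proof -
  let ?F = "frechet_derivative f (at (plane (x t, y t)))"
  have F: "(f has_derivative ?F) (at (plane (x t, y t)))"
    using f frechet_derivative_works by blast
  have l: "linear ?F" using f by (rule linear_frechet_derivative)
  have c: "((\<lambda>t. plane (x t, y t)) has_derivative (\<lambda>s. (x' * s) *\<^sub>R axis 1 1 + (y' * s) *\<^sub>R axis 2 1)) (at t)"
    unfolding plane_def fst_conv snd_conv using x y unfolding has_field_derivative_def
    by (intro has_derivative_add has_derivative_scaleR_left)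
  have "((\<lambda>t. f (plane (x t, y t))) has_derivative (\<lambda>s. ?F ((x' * s) *\<^sub>R axis 1 1 + (y' * s) *\<^sub>R axis 2 1))) (at t)"
    using has_derivative_compose[OF c F] .
  also have "(\<lambda>s. ?F ((x' * s) *\<^sub>R axis 1 1 + (y' * s) *\<^sub>R axis 2 1)) = (*) (x' * partial 1 f (plane (x t, y t)) + y' * partial 2 f (plane (x t, y t)))"
    by (simp add: fun_eq_iff linear_add[OF l] linear_scale[OF l] partial_def algebra_simps)
  finally show ?thesis unfolding has_field_derivative_def .
qed

lemma integrable_tail_small:
  fixes H :: "real \<Rightarrow> real"
  assumes H: "integrable lborel H" and c: "c > 0"
  shows "\<not> (\<forall>\<^sub>F x in at_top. H x \<ge> c)" "\<not> (\<forall>\<^sub>F x in at_bot. H x \<ge> c)"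
proof -
  have F: False if b: "\<And>n::nat. \<exists>l. \<forall>x\<in>{l..l + real n}. H x \<ge> c"
  proof -
    obtain n :: nat where n: "(LINT x|lborel. \<bar>H x\<bar>) / c < real n" using reals_Archimedean2 by blast
    obtain l where l: "\<And>x. x \<in> {l..l + real n} \<Longrightarrow> H x \<ge> c" using b by blast
    have "(LINT x|lborel. indicator {l..l + real n} x * c) \<le> (LINT x|lborel. \<bar>H x\<bar>)"
    proof (rule integral_mono)
      show "indicator {l..l + real n} x * c \<le> \<bar>H x\<bar>" for x
        using l[of x] by (auto simp: indicator_def)
    qed (use H in auto)
    also have "(LINT x|lborel. indicator {l..l + real n} x * c) = real n * c" by simp
    finally show False using n c by (simp add: divide_less_eq)
  qed
  show "\<not> (\<forall>\<^sub>F x in at_top. H x \<ge> c)"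
  proof
    assume "\<forall>\<^sub>F x in at_top. H x \<ge> c"
    then obtain R where R: "\<And>x. x \<ge> R \<Longrightarrow> H x \<ge> c" by (auto simp: eventually_at_top_linorder)
    have "\<exists>l. \<forall>x\<in>{l..l + real n}. H x \<ge> c" for n
      by (rule exI[of _ R]) (use R in auto)
    then show False using F by blast
  qed
  show "\<not> (\<forall>\<^sub>F x in at_bot. H x \<ge> c)"
  proof
    assume "\<forall>\<^sub>F x in at_bot. H x \<ge> c"
    then obtain R where R: "\<And>x. x \<le> R \<Longrightarrow> H x \<ge> c" by (auto simp: eventually_at_bot_linorder)
    have "\<exists>l. \<forall>x\<in>{l..l + real n}. H x \<ge> c" for n
      by (rule exI[of _ "R - real n"]) (use R in auto)
    then show False using F by blast
  qed
qed

lemma DERIV_zero_const: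
  fixes f :: "real \<Rightarrow> real"
  assumes "\<And>x. (f has_real_derivative 0) (at x)"
  shows "f x = f 0"
  by (rule DERIV_isconst_all) (simp add: assms)

text \<open>The combinations \<open>I' - n * I\<close> and \<open>I' + n * I\<close> solve first-order equations and hence are pure
  exponentials.\<close>
lemma second_order_ode:
  fixes I I' :: "real \<Rightarrow> real"
  assumes 1: "\<And>x. (I has_real_derivative I' x) (at x)" and 2: "\<And>x. (I' has_real_derivative (real n)\<^sup>2 * I x) (at x)"
  shows "n = 0 \<Longrightarrow> \<exists>\<alpha> \<beta>. \<forall>x. I x = \<alpha> + \<beta> * x"
    and "n > 0 \<Longrightarrow> \<exists>\<alpha> \<beta>. \<forall>x. I x = \<alpha> * exp (real n * x) + \<beta> * exp (- (real n * x))"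
proof -
  assume n: "n = 0"
  have d: "(I' has_real_derivative 0) (at x)" for x using 2[of x] unfolding n by simp
  have c: "I' x = I' 0" for x by (rule DERIV_zero_const[OF d])
  have d: "((\<lambda>x. I x - I' 0 * x) has_real_derivative 0) (at x)" for x
    by (rule DERIV_cong[OF DERIV_diff[OF 1 DERIV_cmult[OF DERIV_ident]]]) (simp add: c[of x])
  have "I x = I 0 + I' 0 * x" for x
    using DERIV_zero_const[OF d, of x] by linarith
  then show "\<exists>\<alpha> \<beta>. \<forall>x. I x = \<alpha> + \<beta> * x" by (intro exI allI)
next
  assume n: "n > 0"
  have e: "((\<lambda>x. exp (c * x)) has_real_derivative exp (c * x) * c) (at x)" for c x :: real
    by (auto intro!: derivative_eq_intros)
  define A B where "A x = (I' x - real n * I x) * exp (real n * x)" and "B x = (I' x + real n * I x) * exp (- real n * x)" for x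
  have dA: "(A has_real_derivative 0) (at x)" for x
    unfolding A_def
    by (rule DERIV_cong[OF DERIV_mult[OF DERIV_diff[OF 2 DERIV_cmult[OF 1]] e]]) (simp add: algebra_simps power2_eq_square)
  have A: "A x = A 0" for x by (rule DERIV_zero_const[OF dA])
  have dB: "(B has_real_derivative 0) (at x)" for x
    unfolding B_def
    by (rule DERIV_cong[OF DERIV_mult[OF DERIV_add[OF 2 DERIV_cmult[OF 1]] e]]) (simp add: algebra_simps power2_eq_square)
  have B: "B x = B 0" for x by (rule DERIV_zero_const[OF dB])
  have "I x = B 0 / (2 * real n) * exp (real n * x) + (- A 0 / (2 * real n)) * exp (- (real n * x))" for x
  proof -
    have "exp (real n * x) * exp (- (real n * x)) = 1" by (simp add: exp_minus)
    then have "B x * exp (real n * x) - A x * exp (- (real n * x)) = 2 * real n * I x"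
      unfolding A_def B_def by (simp add: algebra_simps)
    then have "2 * real n * I x = B 0 * exp (real n * x) - A 0 * exp (- (real n * x))"
      using A[of x] B[of x] by simp
    moreover have "I x = (2 * real n * I x) / (2 * real n)" using n by simp
    ultimately have "I x = (B 0 * exp (real n * x) - A 0 * exp (- (real n * x))) / (2 * real n)" by simp
    then show ?thesis by (simp add: diff_divide_distrib)
  qed
  then show "\<exists>\<alpha> \<beta>. \<forall>x. I x = \<alpha> * exp (real n * x) + \<beta> * exp (- (real n * x))" by (intro exI allI)
qed

text \<open>The setting of the uniqueness proof, where \<open>D\<close> is the difference of two admissible solutions. The last
  assumption is admissibility tested on the Gaussian at the origin; the weight is comparable to
  \<open>min 1 ((norm y)\<^sup>2)\<close>.\<close>
locale punctured_harmonic = positive_moduli +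
  fixes D :: "real^2 \<Rightarrow> real"
  assumes D_diff: "z \<noteq> 0 \<Longrightarrow> D differentiable (at z)"
    and D1_diff: "z \<noteq> 0 \<Longrightarrow> partial i D differentiable (at z)"
    and D2_cont: "continuous_on (- {0}) (partial j (partial i D))"
    and pde: "z \<noteq> 0 \<Longrightarrow> b * partial 1 (partial 1 D) z + a * partial 2 (partial 2 D) z = 0"
    and even: "z \<noteq> 0 \<Longrightarrow> D (- z) = D z"
    and int: "integrable lborel (\<lambda>y. D y * (1 - exp (- (norm y)\<^sup>2 / 2)))"
begin

definition p where "p = sqrt b"
definition q where "q = sqrt a"

lemma pq: "p > 0" "q > 0" "p\<^sup>2 = b" "q\<^sup>2 = a"
  using a b by (auto simp: p_def q_def)

text \<open>Logarithmic polar coordinates, stretched so that the ellipses adapted to the operator become circles. In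
  these coordinates the equation for \<open>D\<close> becomes Laplace's equation, with period \<open>2 * pi\<close> in \<open>\<theta>\<close>.\<close>
definition Y :: "real \<Rightarrow> real \<Rightarrow> real^2" where
  "Y \<rho> \<theta> = plane (p * (exp \<rho> * cos \<theta>), q * (exp \<rho> * sin \<theta>))"

lemma Y_nonzero: "Y \<rho> \<theta> \<noteq> 0"
proof -
  have "cos \<theta> \<noteq> 0 \<or> sin \<theta> \<noteq> 0" using sin_zero_abs_cos_one[of \<theta>] by auto
  then show ?thesis using pq by (auto simp: Y_def real2_nonzero_iff)
qed

lemma Y_nth: "Y \<rho> \<theta> $ 1 = p * (exp \<rho> * cos \<theta>)" "Y \<rho> \<theta> $ 2 = q * (exp \<rho> * sin \<theta>)"
  by (simp_all add: Y_def)

lemma continuous_on_Y: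
  fixes f :: "real^2 \<Rightarrow> real" and g h :: "'c::t2_space \<Rightarrow> real"
  assumes "continuous_on (- {0}) f" "continuous_on S g" "continuous_on S h"
  shows "continuous_on S (\<lambda>v. f (Y (g v) (h v)))"
proof (rule continuous_on_compose2[OF assms(1)])
  show "continuous_on S (\<lambda>v. Y (g v) (h v))"
    unfolding Y_def plane_def fst_conv snd_conv by (intro continuous_intros continuous_on_cos continuous_on_sin assms)
qed (use Y_nonzero in auto)

lemma cont: "continuous_on (- {0}) D" "continuous_on (- {0}) (partial i D)"
  using D_diff D1_diff by (auto intro!: continuous_at_imp_continuous_on differentiable_imp_continuous_within)

lemma DERIV_Y:
  fixes f :: "real^2 \<Rightarrow> real"
  assumes "\<And>z. z \<noteq> 0 \<Longrightarrow> f differentiable (at z)"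
  shows "((\<lambda>\<rho>. f (Y \<rho> \<theta>)) has_real_derivative
       p * (exp \<rho> * cos \<theta>) * partial 1 f (Y \<rho> \<theta>) + q * (exp \<rho> * sin \<theta>) * partial 2 f (Y \<rho> \<theta>)) (at \<rho>)"
    and "((\<lambda>\<theta>. f (Y \<rho> \<theta>)) has_real_derivative
       - p * (exp \<rho> * sin \<theta>) * partial 1 f (Y \<rho> \<theta>) + q * (exp \<rho> * cos \<theta>) * partial 2 f (Y \<rho> \<theta>)) (at \<theta>)"
proof -
  note Yd = assms[OF Y_nonzero[of \<rho> \<theta>, unfolded Y_def]]
  show "((\<lambda>\<rho>. f (Y \<rho> \<theta>)) has_real_derivative
       p * (exp \<rho> * cos \<theta>) * partial 1 f (Y \<rho> \<theta>) + q * (exp \<rho> * sin \<theta>) * partial 2 f (Y \<rho> \<theta>)) (at \<rho>)"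
    unfolding Y_def
    by (rule DERIV_chain_plane[where x="\<lambda>\<rho>. p * (exp \<rho> * cos \<theta>)" and y="\<lambda>\<rho>. q * (exp \<rho> * sin \<theta>)"])
      (use Yd in \<open>auto intro!: derivative_eq_intros\<close>)
  show "((\<lambda>\<theta>. f (Y \<rho> \<theta>)) has_real_derivative
       - p * (exp \<rho> * sin \<theta>) * partial 1 f (Y \<rho> \<theta>) + q * (exp \<rho> * cos \<theta>) * partial 2 f (Y \<rho> \<theta>)) (at \<theta>)"
    unfolding Y_def
    by (rule DERIV_chain_plane[where x="\<lambda>\<theta>. p * (exp \<rho> * cos \<theta>)" and y="\<lambda>\<theta>. q * (exp \<rho> * sin \<theta>)"])
      (use Yd in \<open>auto intro!: derivative_eq_intros\<close>)
qed

text \<open>First and second derivatives of \<open>D (Y \<rho> \<theta>)\<close>; each letter \<open>r\<close> or \<open>t\<close> stands for a derivative in \<open>\<rho>\<close>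
  or \<open>\<theta>\<close>.\<close>
definition Ur where "Ur \<rho> \<theta> = p * (exp \<rho> * cos \<theta>) * partial 1 D (Y \<rho> \<theta>) + q * (exp \<rho> * sin \<theta>) * partial 2 D (Y \<rho> \<theta>)"
definition Ut where "Ut \<rho> \<theta> = - p * (exp \<rho> * sin \<theta>) * partial 1 D (Y \<rho> \<theta>) + q * (exp \<rho> * cos \<theta>) * partial 2 D (Y \<rho> \<theta>)"
definition Urr where "Urr \<rho> \<theta> = Ur \<rho> \<theta>
   + p * (exp \<rho> * cos \<theta>) * (p * (exp \<rho> * cos \<theta>) * partial 1 (partial 1 D) (Y \<rho> \<theta>) + q * (exp \<rho> * sin \<theta>) * partial 2 (partial 1 D) (Y \<rho> \<theta>))
   + q * (exp \<rho> * sin \<theta>) * (p * (exp \<rho> * cos \<theta>) * partial 1 (partial 2 D) (Y \<rho> \<theta>) + q * (exp \<rho> * sin \<theta>) * partial 2 (partial 2 D) (Y \<rho> \<theta>))"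

lemma DERIV_U:
  "((\<lambda>\<rho>. D (Y \<rho> \<theta>)) has_real_derivative Ur \<rho> \<theta>) (at \<rho>)"
  "((\<lambda>\<theta>. D (Y \<rho> \<theta>)) has_real_derivative Ut \<rho> \<theta>) (at \<theta>)"
  unfolding Ur_def Ut_def using DERIV_Y[OF D_diff] by auto

lemma DERIV_Ur: "((\<lambda>\<rho>. Ur \<rho> \<theta>) has_real_derivative Urr \<rho> \<theta>) (at \<rho>)"
proof -
  have e: "((\<lambda>\<rho>. k * (exp \<rho> * c)) has_real_derivative k * (exp \<rho> * c)) (at \<rho>)" for k c :: real
    by (auto intro!: derivative_eq_intros)
  note d = DERIV_mult[OF e DERIV_Y(1)[OF D1_diff]]
  show ?thesis
    unfolding Ur_def Urr_def
    by (rule DERIV_cong[OF DERIV_add[OF d d]]) (simp_all add: algebra_simps)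
qed

text \<open>Laplace's equation: in the sum of the second derivatives in \<open>\<rho>\<close> and \<open>\<theta>\<close> the mixed and first-order
  terms cancel, and \<open>exp \<rho> ^ 2\<close> times the equation for \<open>D\<close> is left.\<close>
lemma DERIV_Ut: "((\<lambda>\<theta>. Ut \<rho> \<theta>) has_real_derivative - Urr \<rho> \<theta>) (at \<theta>)"
proof -
  let ?x = "exp \<rho> * cos \<theta>" and ?y = "exp \<rho> * sin \<theta>"
  let ?D = "\<lambda>j i. partial j (partial i D) (Y \<rho> \<theta>)"
  have "((\<lambda>\<theta>. Ut \<rho> \<theta>) has_real_derivative
     - Ur \<rho> \<theta> - p * ?y * (- p * ?y * ?D 1 1 + q * ?x * ?D 2 1) + q * ?x * (- p * ?y * ?D 1 2 + q * ?x * ?D 2 2)) (at \<theta>)"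
  proof -
    have es: "((\<lambda>\<theta>. k * (exp \<rho> * sin \<theta>)) has_real_derivative k * (exp \<rho> * cos \<theta>)) (at \<theta>)" for k :: real
      by (auto intro!: derivative_eq_intros)
    have ec: "((\<lambda>\<theta>. k * (exp \<rho> * cos \<theta>)) has_real_derivative - k * (exp \<rho> * sin \<theta>)) (at \<theta>)" for k :: real
      by (auto intro!: derivative_eq_intros)
    show ?thesis
      unfolding Ut_def Ur_def
      by (rule DERIV_cong[OF DERIV_add[OF DERIV_mult[OF es DERIV_Y(2)[OF D1_diff]] DERIV_mult[OF ec DERIV_Y(2)[OF D1_diff]]]])
        (simp_all add: algebra_simps)
  qed
  also have "- Ur \<rho> \<theta> - p * ?y * (- p * ?y * ?D 1 1 + q * ?x * ?D 2 1) + q * ?x * (- p * ?y * ?D 1 2 + q * ?x * ?D 2 2)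
    = - Urr \<rho> \<theta> + (?x\<^sup>2 + ?y\<^sup>2) * (p\<^sup>2 * ?D 1 1 + q\<^sup>2 * ?D 2 2)"
    unfolding Urr_def by (simp add: algebra_simps power2_eq_square)
  also have "\<dots> = - Urr \<rho> \<theta>" using pde[OF Y_nonzero] pq by simp
  finally show ?thesis .
qed

lemma U_continuous:
  fixes g h :: "'c::t2_space \<Rightarrow> real"
  assumes "continuous_on S g" "continuous_on S h"
  shows "continuous_on S (\<lambda>v. D (Y (g v) (h v)))" "continuous_on S (\<lambda>v. Ur (g v) (h v))" "continuous_on S (\<lambda>v. Urr (g v) (h v))"
  unfolding Urr_def Ur_def by (intro continuous_intros continuous_on_Y cont D2_cont assms)+

definition fourier_coeff :: "nat \<Rightarrow> real \<Rightarrow> real \<Rightarrow> real" where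
  "fourier_coeff n \<delta> \<rho> = integral {0..2*pi} (\<lambda>\<theta>. D (Y \<rho> \<theta>) * cos (real n * \<theta> + \<delta>))"

text \<open>Differentiate twice under the integral, replace the second derivative in \<open>\<rho>\<close> by minus that in \<open>\<theta>\<close>,
  and integrate by parts twice over a full period.\<close>
lemma fourier_coeff_ode:
  "(fourier_coeff n \<delta> has_real_derivative integral {0..2*pi} (\<lambda>\<theta>. Ur \<rho> \<theta> * cos (real n * \<theta> + \<delta>))) (at \<rho>)"
  "((\<lambda>\<rho>. integral {0..2*pi} (\<lambda>\<theta>. Ur \<rho> \<theta> * cos (real n * \<theta> + \<delta>))) has_real_derivative (real n)\<^sup>2 * fourier_coeff n \<delta> \<rho>) (at \<rho>)"
proof -
  let ?c = "\<lambda>\<theta>. cos (real n * \<theta> + \<delta>)"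
  show "(fourier_coeff n \<delta> has_real_derivative integral {0..2*pi} (\<lambda>\<theta>. Ur \<rho> \<theta> * ?c \<theta>)) (at \<rho>)"
    unfolding fourier_coeff_def[abs_def] cbox_interval[symmetric]
  proof (rule leibniz_rule_field_derivative)
    show "((\<lambda>\<rho>. D (Y \<rho> \<theta>) * ?c \<theta>) has_real_derivative Ur \<rho> \<theta> * ?c \<theta>) (at \<rho> within UNIV)" for \<rho> \<theta>
      using DERIV_cmult_right[OF DERIV_U(1)] by simp
    show "(\<lambda>\<theta>. D (Y \<rho> \<theta>) * ?c \<theta>) integrable_on cbox 0 (2 * pi)" for \<rho>
      by (intro integrable_continuous continuous_intros U_continuous)
    show "continuous_on (UNIV \<times> cbox 0 (2 * pi)) (\<lambda>(\<rho>, \<theta>). Ur \<rho> \<theta> * ?c \<theta>)"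
      unfolding case_prod_beta by (intro continuous_intros U_continuous)
  qed auto
  have "((\<lambda>\<rho>. integral {0..2*pi} (\<lambda>\<theta>. Ur \<rho> \<theta> * ?c \<theta>)) has_real_derivative integral {0..2*pi} (\<lambda>\<theta>. Urr \<rho> \<theta> * ?c \<theta>)) (at \<rho>)"
    unfolding cbox_interval[symmetric]
  proof (rule leibniz_rule_field_derivative)
    show "((\<lambda>\<rho>. Ur \<rho> \<theta> * ?c \<theta>) has_real_derivative Urr \<rho> \<theta> * ?c \<theta>) (at \<rho> within UNIV)" for \<rho> \<theta>
      using DERIV_cmult_right[OF DERIV_Ur] by simp
    show "(\<lambda>\<theta>. Ur \<rho> \<theta> * ?c \<theta>) integrable_on cbox 0 (2 * pi)" for \<rho>
      by (intro integrable_continuous continuous_intros U_continuous)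
    show "continuous_on (UNIV \<times> cbox 0 (2 * pi)) (\<lambda>(\<rho>, \<theta>). Urr \<rho> \<theta> * ?c \<theta>)"
      unfolding case_prod_beta by (intro continuous_intros U_continuous)
  qed auto
  also have "integral {0..2*pi} (\<lambda>\<theta>. Urr \<rho> \<theta> * ?c \<theta>) = (real n)\<^sup>2 * fourier_coeff n \<delta> \<rho>"
  proof -
    \<comment> \<open>the boundary term of the double integration by parts, periodic in the angle\<close>
    let ?G = "\<lambda>\<theta>. Ut \<rho> \<theta> * ?c \<theta> + D (Y \<rho> \<theta>) * (real n * sin (real n * \<theta> + \<delta>))"
    have "((\<lambda>\<theta>. (real n)\<^sup>2 * (D (Y \<rho> \<theta>) * ?c \<theta>) - Urr \<rho> \<theta> * ?c \<theta>) has_integral ?G (2*pi) - ?G 0) {0..2*pi}"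
    proof (rule fundamental_theorem_of_calculus)
      show "(?G has_vector_derivative (real n)\<^sup>2 * (D (Y \<rho> \<theta>) * ?c \<theta>) - Urr \<rho> \<theta> * ?c \<theta>) (at \<theta> within {0..2*pi})" for \<theta>
        unfolding has_real_derivative_iff_has_vector_derivative[symmetric]
        by (rule has_field_derivative_at_within, (rule derivative_eq_intros DERIV_U DERIV_Ut refl)+)
          (simp add: algebra_simps power2_eq_square)
    qed simp
    moreover have "?G (2*pi) = ?G 0"
    proof -
      have "cos (real n * (2*pi) + \<delta>) = cos \<delta>" "sin (real n * (2*pi) + \<delta>) = sin \<delta>"
        using sin_npi[of "2 * n"] cos_npi[of "2 * n"] by (simp_all add: cos_add sin_add mult_ac)
      then show ?thesis by (simp add: Ut_def Y_def)
    qed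
    ultimately have z: "integral {0..2*pi} (\<lambda>\<theta>. (real n)\<^sup>2 * (D (Y \<rho> \<theta>) * ?c \<theta>) - Urr \<rho> \<theta> * ?c \<theta>) = 0"
      by (simp add: integral_unique)
    have "integral {0..2*pi} (\<lambda>\<theta>. (real n)\<^sup>2 * (D (Y \<rho> \<theta>) * ?c \<theta>) - Urr \<rho> \<theta> * ?c \<theta>)
      = (real n)\<^sup>2 * fourier_coeff n \<delta> \<rho> - integral {0..2*pi} (\<lambda>\<theta>. Urr \<rho> \<theta> * ?c \<theta>)"
      unfolding fourier_coeff_def integral_mult_right[symmetric]
      by (rule integral_diff) (intro integrable_continuous_interval continuous_intros U_continuous)+
    then show ?thesis using z by simp
  qed
  finally show "((\<lambda>\<rho>. integral {0..2*pi} (\<lambda>\<theta>. Ur \<rho> \<theta> * ?c \<theta>)) has_real_derivative (real n)\<^sup>2 * fourier_coeff n \<delta> \<rho>) (at \<rho>)" .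
qed

text \<open>A half turn changes the sign of an odd wave and maps \<open>y\<close> to \<open>- y\<close>, where the even function \<open>D\<close> has the
  same value.\<close>
lemma fourier_coeff_odd:
  assumes "odd n"
  shows "fourier_coeff n \<delta> \<rho> = 0"
proof -
  let ?f = "\<lambda>\<theta>. D (Y \<rho> \<theta>) * cos (real n * \<theta> + \<delta>)"
  have shift: "?f (pi + \<theta>) = - ?f \<theta>" for \<theta>
  proof -
    have "Y \<rho> (pi + \<theta>) = - Y \<rho> \<theta>"
      by (simp add: vec_eq_iff forall_2 Y_nth)
    moreover have "cos (real n * (pi + \<theta>) + \<delta>) = - cos (real n * \<theta> + \<delta>)"
    proof -
      have "cos (real n * pi) = - 1" "sin (real n * pi) = 0" using assms by auto
      moreover have "real n * (pi + \<theta>) + \<delta> = real n * pi + (real n * \<theta> + \<delta>)" by (simp add: algebra_simps)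
      ultimately show ?thesis by (simp only: cos_add[of "real n * pi"])
    qed
    ultimately show ?thesis using even[OF Y_nonzero] by simp
  qed
  have i: "?f integrable_on {c..d}" for c d
    by (intro integrable_continuous_interval continuous_intros U_continuous)
  have "fourier_coeff n \<delta> \<rho> = integral {0..pi} ?f + integral {pi..2*pi} ?f"
    unfolding fourier_coeff_def by (rule Henstock_Kurzweil_Integration.integral_combine[symmetric]) (use i in auto)
  also have "integral {pi..2*pi} ?f = integral {0..pi} (?f \<circ> ((+) pi))"
    by (subst integral_shift_Icc_real) simp
  also have "?f \<circ> ((+) pi) = (\<lambda>\<theta>. - ?f \<theta>)" using shift by (simp add: fun_eq_iff)
  finally show ?thesis by simp
qed

end

section \<open>Weighted integrability forces the solution to vanish\<close>

lemma angle_unique: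
  assumes "0 < s" "s < 2 * pi" "0 < t" "t < 2 * pi" "cos s = cos t" "sin s = sin t"
  shows "s = t"
proof -
  have "cos (s - t) = 1" using assms(5,6) sin_cos_squared_add3[of t] by (simp add: cos_diff)
  then obtain n :: int where n: "s - t = of_int n * 2 * pi" using cos_one_2pi_int by auto
  have "\<bar>s - t\<bar> < 2 * pi" using assms by auto
  then have "\<bar>of_int n :: real\<bar> < 1" unfolding n by (simp add: abs_mult)
  then have "n = 0" by linarith
  then show ?thesis using n by simp
qed

context punctured_harmonic
begin

text \<open>The open strip leaves out one ray, so that \<open>polar\<close> is injective on it.\<close>
definition strip :: "(real^2) set" where
  "strip = {v. 0 < v$2 \<and> v$2 < 2 * pi}"

definition polar :: "real^2 \<Rightarrow> real^2" where
  "polar v = Y (v$1) (v$2)"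

lemma open_strip: "open strip"
  unfolding strip_def by (intro open_Collect_conj open_Collect_less continuous_intros)

lemma inj_polar: "inj_on polar strip"
proof (rule inj_onI)
  fix v w assume vw: "v \<in> strip" "w \<in> strip" "polar v = polar w"
  then have c: "exp (v$1) * cos (v$2) = exp (w$1) * cos (w$2)" and s: "exp (v$1) * sin (v$2) = exp (w$1) * sin (w$2)"
    using pq by (auto simp: polar_def vec_eq_iff forall_2 Y_nth)
  have n: "(exp r * cos t)\<^sup>2 + (exp r * sin t)\<^sup>2 = (exp r)\<^sup>2" for r t :: real
    by (simp add: power_mult_distrib flip: distrib_left)
  have "(exp (v$1))\<^sup>2 = (exp (w$1))\<^sup>2"
    using n[of "v$1" "v$2"] n[of "w$1" "w$2"] unfolding c s by simp
  then have e: "v$1 = w$1" by (simp add: power2_eq_iff_nonneg)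
  then have "v$2 = w$2"
    using vw c s angle_unique[of "v$2" "w$2"] unfolding strip_def by simp
  with e show "v = w" by (simp add: vec_eq_iff forall_2)
qed

definition polar_deriv :: "real^2 \<Rightarrow> real^2 \<Rightarrow> real^2" where
  "polar_deriv v h = plane (p * (exp (v$1) * (cos (v$2) * h$1 - sin (v$2) * h$2)), q * (exp (v$1) * (sin (v$2) * h$1 + cos (v$2) * h$2)))"

lemma polar_has_derivative: "(polar has_derivative polar_deriv v) (at v within T)"
proof -
  have c: "((\<lambda>v::real^2. v$i) has_derivative (\<lambda>h. h$i)) (at v within T)" for i
    by (rule bounded_linear_imp_has_derivative) (rule bounded_linear_vec_nth)
  have e: "((\<lambda>v::real^2. exp (v$1)) has_derivative (\<lambda>h. h$1 * exp (v$1))) (at v within T)"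
    using DERIV_compose_FDERIV[OF DERIV_exp c] by (simp add: mult.commute)
  have co: "((\<lambda>v::real^2. cos (v$2)) has_derivative (\<lambda>h. h$2 * - sin (v$2))) (at v within T)"
    using DERIV_compose_FDERIV[OF DERIV_cos c] by simp
  have si: "((\<lambda>v::real^2. sin (v$2)) has_derivative (\<lambda>h. h$2 * cos (v$2))) (at v within T)"
    using DERIV_compose_FDERIV[OF DERIV_sin c] by simp
  have 1: "((\<lambda>v::real^2. p * (exp (v$1) * cos (v$2))) has_derivative (\<lambda>h. p * (exp (v$1) * (cos (v$2) * h$1 - sin (v$2) * h$2)))) (at v within T)"
    by (rule has_derivative_eq_rhs[OF has_derivative_mult_right[OF has_derivative_mult[OF e co]]])
      (simp add: fun_eq_iff algebra_simps)
  have 2: "((\<lambda>v::real^2. q * (exp (v$1) * sin (v$2))) has_derivative (\<lambda>h. q * (exp (v$1) * (sin (v$2) * h$1 + cos (v$2) * h$2)))) (at v within T)"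
    by (rule has_derivative_eq_rhs[OF has_derivative_mult_right[OF has_derivative_mult[OF e si]]])
      (simp add: fun_eq_iff algebra_simps)
  show ?thesis
    unfolding polar_def[abs_def] polar_deriv_def[abs_def] Y_def plane_def fst_conv snd_conv
    by (intro has_derivative_add has_derivative_scaleR_left 1 2)
qed

lemma det_polar_deriv: "det (matrix (polar_deriv v)) = p * q * exp (2 * v$1)"
proof -
  have "exp (2 * v$1) = exp (v$1) * exp (v$1)" by (simp add: mult_exp_exp)
  moreover have "cos (v$2) * cos (v$2) + sin (v$2) * sin (v$2) = 1" by (rule sin_cos_squared_add3)
  ultimately have "p * q * exp (2 * v$1) = p * (exp (v$1) * cos (v$2)) * (q * (exp (v$1) * cos (v$2))) + p * (exp (v$1) * sin (v$2)) * (q * (exp (v$1) * sin (v$2)))"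
    by algebra
  then show ?thesis
    unfolding det_2 matrix_def polar_deriv_def by (simp add: axis_def)
qed

definition damped :: "real^2 \<Rightarrow> real" where
  "damped y = D y * (1 - exp (- (norm y)\<^sup>2 / 2))"

text \<open>The change of variables \<open>y = polar v\<close>, with Jacobian \<open>p * q * exp (2 * v$1)\<close>. The theorem on
  changes of variables is about vector-valued functions, hence the detour through \<open>real ^ 1\<close>.\<close>
lemma polar_integrable:
  "integrable lborel (\<lambda>v. indicator strip v * (p * q * exp (2 * v$1) * damped (polar v)))"
proof -
  let ?f = "\<lambda>y. vec (damped y) :: real^1"
  have ls: "strip \<in> sets lebesgue" using open_strip by (intro sets_completionI_sets) simp
  have "integrable lborel damped" using int by (simp add: damped_def[abs_def])
  then have "integrable lebesgue damped" by (rule integrable_completion[THEN iffD2, rotated]) (use \<open>integrable lborel damped\<close> in \<open>auto dest: borel_measurable_integrable\<close>)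
  then have "damped absolutely_integrable_on UNIV" by (simp add: set_integrable_def)
  moreover have cp: "continuous_on strip polar"
    using polar_has_derivative by (meson has_derivative_continuous continuous_on_eq_continuous_within)
  have "open (polar ` strip)" by (rule invariance_of_domain[OF cp open_strip inj_polar])
  then have "polar ` strip \<in> sets lebesgue" by (intro sets_completionI_sets) simp
  ultimately have "damped absolutely_integrable_on polar ` strip"
    using set_integrable_subset[of lebesgue UNIV damped "polar ` strip"] by simp
  then have "?f absolutely_integrable_on polar ` strip"
    by (subst absolutely_integrable_componentwise_iff) (auto simp: Basis_vec_def inner_axis)
  then have "(\<lambda>v. \<bar>det (matrix (polar_deriv v))\<bar> *\<^sub>R ?f (polar v)) absolutely_integrable_on strip"
    by (rule iffD1[OF absolutely_integrable_change_of_variables[OF ls polar_has_derivative inj_polar]])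
  then have "(\<lambda>v. (\<bar>det (matrix (polar_deriv v))\<bar> *\<^sub>R ?f (polar v)) \<bullet> axis 1 1) absolutely_integrable_on strip"
    by (rule absolutely_integrable_component)
  also have "(\<lambda>v. (\<bar>det (matrix (polar_deriv v))\<bar> *\<^sub>R ?f (polar v)) \<bullet> axis 1 1) = (\<lambda>v. p * q * exp (2 * v$1) * damped (polar v))"
    using pq unfolding det_polar_deriv by (simp add: inner_axis abs_mult fun_eq_iff)
  finally have "integrable lebesgue (\<lambda>v. indicator strip v * (p * q * exp (2 * v$1) * damped (polar v)))"
    by (simp add: set_integrable_def)
  moreover have "(\<lambda>v. indicator strip v * (p * q * exp (2 * v$1) * damped (polar v))) \<in> borel_measurable lborel"
  proof -
    have [measurable]: "strip \<in> sets borel" using open_strip by simp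
    have cY: "continuous_on UNIV (\<lambda>v::real^2. Y (v$1) (v$2))"
      unfolding Y_def plane_def fst_conv snd_conv by (intro continuous_intros)
    have "continuous_on UNIV (\<lambda>v::real^2. damped (polar v))"
      unfolding damped_def polar_def by (intro continuous_intros U_continuous cY) auto
    then have [measurable]: "(\<lambda>v. damped (polar v)) \<in> borel_measurable borel" by (rule borel_measurable_continuous_onI)
    show ?thesis by measurable
  qed
  ultimately show ?thesis by (simp add: integrable_completion)
qed

text \<open>As \<open>(norm (Y \<rho> \<theta>))\<^sup>2 \<ge> m * exp (2 * \<rho>)\<close>, the weight bounds the Jacobian times the damping factor from
  below, uniformly in \<open>\<theta>\<close>. It grows like \<open>exp (2 * \<rho>)\<close> at infinity and decays like \<open>exp (4 * \<rho>)\<close> at the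
  puncture.\<close>
definition m where "m = min a b"

definition weight :: "real \<Rightarrow> real" where
  "weight \<rho> = p * q * exp (2 * \<rho>) * (1 - exp (- (m * exp (2 * \<rho>) / 2)))"

lemma m_pos: "m > 0" using a b by (simp add: m_def)

lemma weight_nonneg: "weight \<rho> \<ge> 0"
  using pq m_pos by (simp add: weight_def)

lemma weight_le: "weight \<rho> \<le> p * q * exp (2 * \<rho>) * (1 - exp (- (norm (Y \<rho> \<theta>))\<^sup>2 / 2))"
proof -
  have "(norm (Y \<rho> \<theta>))\<^sup>2 = b * (exp \<rho> * cos \<theta>)\<^sup>2 + a * (exp \<rho> * sin \<theta>)\<^sup>2"
    unfolding norm_real2 Y_nth using pq a b by (simp add: power_mult_distrib add_nonneg_nonneg)
  also have "\<dots> \<ge> m * (exp \<rho> * cos \<theta>)\<^sup>2 + m * (exp \<rho> * sin \<theta>)\<^sup>2"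
    by (intro add_mono mult_right_mono) (auto simp: m_def)
  also have "m * (exp \<rho> * cos \<theta>)\<^sup>2 + m * (exp \<rho> * sin \<theta>)\<^sup>2 = m * exp (2 * \<rho>)"
    by (simp add: power_mult_distrib exp_double flip: distrib_left)
  finally have "m * exp (2 * \<rho>) \<le> (norm (Y \<rho> \<theta>))\<^sup>2" .
  then show ?thesis unfolding weight_def using pq by (intro mult_left_mono) auto
qed

definition radial_mass :: "real \<Rightarrow> real" where
  "radial_mass \<rho> = (LINT \<theta>|lborel. indicator {0<..<2*pi} \<theta> * (\<bar>D (Y \<rho> \<theta>)\<bar> * weight \<rho>))"

lemma radial_mass_integrable: "integrable lborel radial_mass"
proof -
  let ?U = "\<lambda>x. D (Y (fst x) (snd x))"
  let ?h = "\<lambda>x. indicator {0<..<2*pi} (snd x) * (\<bar>?U x\<bar> * weight (fst x))"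
  have m1: "(\<lambda>x. ?h x) \<in> borel_measurable lborel2"
  proof -
    have "continuous_on UNIV (\<lambda>x::real\<times>real. ?U x)" by (intro U_continuous continuous_intros)
    then have [measurable]: "(\<lambda>x::real\<times>real. ?U x) \<in> borel_measurable lborel2"
      by (simp add: lborel_prod borel_measurable_continuous_onI)
    have [measurable]: "weight \<in> borel_measurable borel" unfolding weight_def[abs_def] by measurable
    show ?thesis by measurable
  qed
  have "integrable (distr lborel2 borel plane) (\<lambda>v. indicator strip v * (p * q * exp (2 * v$1) * damped (polar v)))"
    using polar_integrable by (simp add: lborel_plane[symmetric])
  then have "integrable lborel2 (\<lambda>x. indicator strip (plane x) * (p * q * exp (2 * plane x$1) * damped (polar (plane x))))"
    by (subst (asm) integrable_distr_eq) (use polar_integrable in \<open>auto dest: borel_measurable_integrable\<close>)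
  then have "integrable lborel2 (\<lambda>x. ?h x)"
  proof (rule Bochner_Integration.integrable_bound[OF _ m1], intro AE_I2)
    fix x :: "real \<times> real"
    let ?e = "p * q * exp (2 * fst x) * (1 - exp (- (norm (Y (fst x) (snd x)))\<^sup>2 / 2))"
    have "\<bar>?U x\<bar> * weight (fst x) \<le> \<bar>?U x\<bar> * ?e"
      by (intro mult_left_mono weight_le) auto
    moreover have "?e \<ge> 0" using weight_nonneg weight_le order_trans by blast
    ultimately have "\<bar>?U x\<bar> * weight (fst x) \<le> \<bar>?U x * ?e\<bar>"
      by (simp only: abs_mult[of "?U x"] abs_of_nonneg)
    then have "\<bar>?U x\<bar> * weight (fst x) \<le> \<bar>p * q * exp (2 * fst x) * damped (Y (fst x) (snd x))\<bar>"
      by (simp add: damped_def mult_ac)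
    then show "norm (?h x)
      \<le> norm (indicator strip (plane x) * (p * q * exp (2 * plane x$1) * damped (polar (plane x))))"
      using weight_nonneg[of "fst x"] by (auto simp: indicator_def strip_def polar_def abs_mult)
  qed
  from lborel_pair.integrable_fst'[OF this] show ?thesis by (simp add: radial_mass_def[abs_def])
qed

lemma fourier_coeff_bound: "\<bar>fourier_coeff n \<delta> \<rho>\<bar> * weight \<rho> \<le> radial_mass \<rho>"
proof -
  let ?f = "\<lambda>\<theta>. D (Y \<rho> \<theta>) * cos (real n * \<theta> + \<delta>)"
  have c: "continuous_on S ?f" "continuous_on S (\<lambda>\<theta>. \<bar>D (Y \<rho> \<theta>)\<bar>)" for S
    by (intro continuous_intros U_continuous)+
  have i: "set_integrable lborel {0..2*pi} ?f" "set_integrable lborel {0..2*pi} (\<lambda>\<theta>. \<bar>D (Y \<rho> \<theta>)\<bar>)"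
    by (intro borel_integrable_atLeastAtMost' c)+
  have fc: "fourier_coeff n \<delta> \<rho> = (LINT \<theta>|lborel. indicator {0..2*pi} \<theta> *\<^sub>R ?f \<theta>)"
    unfolding fourier_coeff_def set_borel_integral_eq_integral(2)[OF i(1), symmetric] set_lebesgue_integral_def ..
  have "\<bar>fourier_coeff n \<delta> \<rho>\<bar> \<le> (LINT \<theta>|lborel. \<bar>indicator {0..2*pi} \<theta> *\<^sub>R ?f \<theta>\<bar>)"
    unfolding fc by (rule integral_abs_bound)
  also have "\<dots> \<le> (LINT \<theta>|lborel. indicator {0..2*pi} \<theta> *\<^sub>R \<bar>D (Y \<rho> \<theta>)\<bar>)"
  proof (rule integral_mono)
    show "\<bar>indicator {0..2*pi} \<theta> *\<^sub>R ?f \<theta>\<bar> \<le> indicator {0..2*pi} \<theta> *\<^sub>R \<bar>D (Y \<rho> \<theta>)\<bar>" for \<theta>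
      using mult_left_mono[OF abs_cos_le_one[of "real n * \<theta> + \<delta>"], of "\<bar>D (Y \<rho> \<theta>)\<bar>"] by (simp add: indicator_def abs_mult)
    show "integrable lborel (\<lambda>\<theta>. \<bar>indicator {0..2*pi} \<theta> *\<^sub>R ?f \<theta>\<bar>)"
      by (rule integrable_abs[OF i(1)[unfolded set_integrable_def]])
    show "integrable lborel (\<lambda>\<theta>. indicator {0..2*pi} \<theta> *\<^sub>R \<bar>D (Y \<rho> \<theta>)\<bar>)"
      by (rule i(2)[unfolded set_integrable_def])
  qed
  also have "\<dots> = (LINT \<theta>|lborel. indicator {0<..<2*pi} \<theta> * \<bar>D (Y \<rho> \<theta>)\<bar>)"
  proof (rule integral_cong_AE)
    have meas: "(\<lambda>\<theta>. \<bar>D (Y \<rho> \<theta>)\<bar>) \<in> borel_measurable borel" by (rule borel_measurable_continuous_onI[OF c(2)])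
    show "(\<lambda>\<theta>. indicator {0..2*pi} \<theta> *\<^sub>R \<bar>D (Y \<rho> \<theta>)\<bar>) \<in> borel_measurable lborel"
      "(\<lambda>\<theta>. indicator {0<..<2*pi} \<theta> * \<bar>D (Y \<rho> \<theta>)\<bar>) \<in> borel_measurable lborel"
      unfolding real_scaleR_def measurable_lborel1
      by (intro borel_measurable_times borel_measurable_indicator meas; simp)+
    show "AE \<theta> in lborel. indicator {0..2*pi} \<theta> *\<^sub>R \<bar>D (Y \<rho> \<theta>)\<bar> = indicator {0<..<2*pi} \<theta> * \<bar>D (Y \<rho> \<theta>)\<bar>"
      using AE_lborel_singleton[of "0::real"] AE_lborel_singleton[of "2*pi"]
      by eventually_elim (auto simp: indicator_def)
  qed
  finally have X: "\<bar>fourier_coeff n \<delta> \<rho>\<bar> \<le> (LINT \<theta>|lborel. indicator {0<..<2*pi} \<theta> * \<bar>D (Y \<rho> \<theta>)\<bar>)" .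
  have "\<bar>fourier_coeff n \<delta> \<rho>\<bar> * weight \<rho> \<le> (LINT \<theta>|lborel. indicator {0<..<2*pi} \<theta> * \<bar>D (Y \<rho> \<theta>)\<bar>) * weight \<rho>"
    by (rule mult_right_mono[OF X weight_nonneg])
  also have "\<dots> = radial_mass \<rho>"
    unfolding radial_mass_def mult.assoc[symmetric] integral_mult_left_zero ..
  finally show ?thesis .
qed

text \<open>The weighted coefficients are dominated by an integrable function, which cannot stay above a positive
  constant near either end of the line.\<close>
lemma fourier_coeff_tail:
  assumes "c > 0"
  shows "\<not> (\<forall>\<^sub>F \<rho> in at_top. c \<le> \<bar>fourier_coeff n \<delta> \<rho>\<bar> * weight \<rho>)"
    "\<not> (\<forall>\<^sub>F \<rho> in at_bot. c \<le> \<bar>fourier_coeff n \<delta> \<rho>\<bar> * weight \<rho>)"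
proof -
  have E: "\<forall>\<^sub>F \<rho> in F. c \<le> radial_mass \<rho>" if "\<forall>\<^sub>F \<rho> in F. c \<le> \<bar>fourier_coeff n \<delta> \<rho>\<bar> * weight \<rho>" for F
    using that by (rule eventually_mono) (rule order_trans[OF _ fourier_coeff_bound])
  show "\<not> (\<forall>\<^sub>F \<rho> in at_top. c \<le> \<bar>fourier_coeff n \<delta> \<rho>\<bar> * weight \<rho>)"
    "\<not> (\<forall>\<^sub>F \<rho> in at_bot. c \<le> \<bar>fourier_coeff n \<delta> \<rho>\<bar> * weight \<rho>)"
    by (rule contrapos_nn[OF integrable_tail_small(1)[OF radial_mass_integrable assms] E],
        assumption)
      (rule contrapos_nn[OF integrable_tail_small(2)[OF radial_mass_integrable assms] E])
qed

lemma weight_asymp: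
  "\<forall>\<^sub>F \<rho> in at_top. 1 \<le> weight \<rho>"
  "((\<lambda>\<rho>. exp (- (2 * \<rho>)) * weight \<rho>) \<longlongrightarrow> p * q) at_top"
  "((\<lambda>\<rho>. exp (- (4 * \<rho>)) * weight \<rho>) \<longlongrightarrow> p * q * m / 2) at_bot"
proof -
  have c: "p * q > 0" using pq by simp
  define k where "k = p * q"
  have k: "k > 0" using c by (simp add: k_def)
  have "filterlim weight at_top at_top"
    unfolding weight_def[abs_def] k_def[symmetric] using k m_pos by real_asymp
  then show "\<forall>\<^sub>F \<rho> in at_top. 1 \<le> weight \<rho>" by (simp add: filterlim_at_top)
  show "((\<lambda>\<rho>. exp (- (2 * \<rho>)) * weight \<rho>) \<longlongrightarrow> p * q) at_top"
    unfolding weight_def[abs_def] k_def[symmetric] using k m_pos by real_asymp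
  show "((\<lambda>\<rho>. exp (- (4 * \<rho>)) * weight \<rho>) \<longlongrightarrow> p * q * m / 2) at_bot"
    unfolding weight_def[abs_def] k_def[symmetric] using k m_pos by real_asymp
qed

lemma fourier_coeff_zero_mode: "fourier_coeff 0 \<delta> \<rho> = 0"
proof -
  obtain \<alpha> \<beta> where I: "\<And>\<rho>. fourier_coeff 0 \<delta> \<rho> = \<alpha> + \<beta> * \<rho>"
    using second_order_ode(1)[OF fourier_coeff_ode[of 0 \<delta>] refl] by blast
  have no: False if "c > 0" "\<forall>\<^sub>F \<rho> in at_top. c \<le> \<bar>\<alpha> + \<beta> * \<rho>\<bar>" for c
  proof -
    have "\<forall>\<^sub>F \<rho> in at_top. c \<le> \<bar>fourier_coeff 0 \<delta> \<rho>\<bar> * weight \<rho>"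
      using that(2) weight_asymp(1)
    proof eventually_elim
      case (elim \<rho>)
      then have "c * 1 \<le> \<bar>\<alpha> + \<beta> * \<rho>\<bar> * weight \<rho>" by (intro mult_mono) (use that(1) in auto)
      then show ?case by (simp add: I)
    qed
    then show False using fourier_coeff_tail(1)[OF that(1)] by blast
  qed
  have "\<beta> = 0"
  proof (rule ccontr)
    assume \<beta>: "\<beta> \<noteq> 0"
    have "\<forall>\<^sub>F \<rho> in at_top. 1 \<le> \<bar>\<alpha> + \<beta> * \<rho>\<bar>"
      using eventually_ge_at_top[of "(1 + \<bar>\<alpha>\<bar>) / \<bar>\<beta>\<bar>"]
    proof eventually_elim
      case (elim \<rho>)
      then have "1 + \<bar>\<alpha>\<bar> \<le> \<bar>\<beta>\<bar> * \<rho>" using \<beta> by (simp add: pos_divide_le_eq mult.commute)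
      also have "\<dots> \<le> \<bar>\<beta> * \<rho>\<bar>" by (simp add: abs_mult mult_left_mono)
      finally show ?case by linarith
    qed
    then show False using no[of 1] by simp
  qed
  moreover have "\<alpha> = 0"
  proof (rule ccontr)
    assume "\<alpha> \<noteq> 0"
    moreover have "\<forall>\<^sub>F \<rho> in at_top. \<bar>\<alpha>\<bar> \<le> \<bar>\<alpha> + \<beta> * \<rho>\<bar>" by (simp add: \<open>\<beta> = 0\<close>)
    ultimately show False using no[of "\<bar>\<alpha>\<bar>"] by simp
  qed
  ultimately show ?thesis by (simp add: I)
qed

text \<open>The solution \<open>exp (n * \<rho>)\<close> is excluded at infinity. The solution \<open>exp (- n * \<rho>)\<close>, multiplied by the
  weight, stays away from \<open>0\<close> at infinity if \<open>n \<le> 2\<close>, and at the puncture if \<open>n \<ge> 4\<close>. Only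
  \<open>n = 3\<close> would survive both tests.\<close>
lemma fourier_coeff_even_mode:
  assumes "even n" "n > 0"
  shows "fourier_coeff n \<delta> \<rho> = 0"
proof -
  obtain \<alpha> \<beta> where I: "\<And>\<rho>. fourier_coeff n \<delta> \<rho> = \<alpha> * exp (real n * \<rho>) + \<beta> * exp (- (real n * \<rho>))"
    using second_order_ode(2)[OF fourier_coeff_ode[of n \<delta>] assms(2)] by blast
  let ?A = "\<lambda>\<rho>. \<alpha> + \<beta> * exp (- (2 * real n * \<rho>))"
  have n: "real n > 0" using assms(2) by simp
  have \<alpha>: "\<alpha> = 0"
  proof (rule ccontr)
    assume "\<alpha> \<noteq> 0"
    have "((\<lambda>\<rho>. ?A \<rho>) \<longlongrightarrow> \<alpha> + \<beta> * 0) at_top"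
    proof (intro tendsto_intros)
      have "((\<lambda>\<rho>. exp (- (2 * N * \<rho>))) \<longlongrightarrow> 0) at_top" if "N > 0" for N :: real
        using that by real_asymp
      from this[OF n] show "((\<lambda>\<rho>. exp (- (2 * real n * \<rho>))) \<longlongrightarrow> 0) at_top" .
    qed
    then have "((\<lambda>\<rho>. \<bar>?A \<rho>\<bar>) \<longlongrightarrow> \<bar>\<alpha>\<bar>) at_top"
      by (intro tendsto_rabs) simp
    then have "\<forall>\<^sub>F \<rho> in at_top. \<bar>\<alpha>\<bar> / 2 < \<bar>?A \<rho>\<bar>"
      by (rule order_tendstoD) (use \<open>\<alpha> \<noteq> 0\<close> in simp)
    then have "\<forall>\<^sub>F \<rho> in at_top. \<bar>\<alpha>\<bar> / 2 \<le> \<bar>fourier_coeff n \<delta> \<rho>\<bar> * weight \<rho>"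
      using weight_asymp(1) eventually_ge_at_top[of 0]
    proof eventually_elim
      case (elim \<rho>)
      have "fourier_coeff n \<delta> \<rho> = exp (real n * \<rho>) * (?A \<rho>)"
      proof -
        have "exp (real n * \<rho>) * exp (- (2 * real n * \<rho>)) = exp (- (real n * \<rho>))"
          by (simp add: mult_exp_exp)
        then show ?thesis unfolding I distrib_left by (simp only: mult.left_commute[of _ \<beta>] mult.commute[of _ \<alpha>])
      qed
      then have "\<bar>fourier_coeff n \<delta> \<rho>\<bar> = exp (real n * \<rho>) * \<bar>?A \<rho>\<bar>"
        by (simp add: abs_mult)
      also have "\<dots> \<ge> 1 * (\<bar>\<alpha>\<bar> / 2)" using elim n by (intro mult_mono) auto
      finally have "(\<bar>\<alpha>\<bar> / 2) * 1 \<le> \<bar>fourier_coeff n \<delta> \<rho>\<bar> * weight \<rho>"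
        using elim by (intro mult_mono) auto
      then show ?case by simp
    qed
    then show False using fourier_coeff_tail(1)[of "\<bar>\<alpha>\<bar> / 2"] \<open>\<alpha> \<noteq> 0\<close> by simp
  qed
  have \<beta>: "\<beta> = 0"
  proof (rule ccontr)
    assume "\<beta> \<noteq> 0"
    have J: "\<bar>fourier_coeff n \<delta> \<rho>\<bar> = \<bar>\<beta>\<bar> * exp (- (real n * \<rho>))" for \<rho>
      unfolding I \<alpha> by (simp add: abs_mult)
    show False
    proof (cases "n = 2")
      case True
      then have J2: "\<bar>fourier_coeff n \<delta> \<rho>\<bar> = \<bar>\<beta>\<bar> * exp (- (2 * \<rho>))" for \<rho>
        using J[of \<rho>] by simp
      have "((\<lambda>\<rho>. \<bar>\<beta>\<bar> * (exp (- (2 * \<rho>)) * weight \<rho>)) \<longlongrightarrow> \<bar>\<beta>\<bar> * (p * q)) at_top"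
        by (intro tendsto_intros weight_asymp)
      then have "\<forall>\<^sub>F \<rho> in at_top. \<bar>\<beta>\<bar> * (p * q) / 2 < \<bar>\<beta>\<bar> * (exp (- (2 * \<rho>)) * weight \<rho>)"
        by (rule order_tendstoD) (use \<open>\<beta> \<noteq> 0\<close> pq in simp)
      then have "\<forall>\<^sub>F \<rho> in at_top. \<bar>\<beta>\<bar> * (p * q) / 2 \<le> \<bar>fourier_coeff n \<delta> \<rho>\<bar> * weight \<rho>"
        unfolding J2 mult.assoc by (rule eventually_mono) (rule less_imp_le)
      then show False using fourier_coeff_tail(1)[of "\<bar>\<beta>\<bar> * (p * q) / 2"] \<open>\<beta> \<noteq> 0\<close> pq by simp
    next
      case False
      then have n4: "real n \<ge> 4" using assms by (auto elim!: evenE)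
      have "((\<lambda>\<rho>. \<bar>\<beta>\<bar> * (exp (- (4 * \<rho>)) * weight \<rho>)) \<longlongrightarrow> \<bar>\<beta>\<bar> * (p * q * m / 2)) at_bot"
        by (intro tendsto_intros weight_asymp)
      then have "\<forall>\<^sub>F \<rho> in at_bot. \<bar>\<beta>\<bar> * (p * q * m / 2) / 2 < \<bar>\<beta>\<bar> * (exp (- (4 * \<rho>)) * weight \<rho>)"
        by (rule order_tendstoD) (use \<open>\<beta> \<noteq> 0\<close> pq m_pos in simp)
      then have "\<forall>\<^sub>F \<rho> in at_bot. \<bar>\<beta>\<bar> * (p * q * m / 2) / 2 \<le> \<bar>fourier_coeff n \<delta> \<rho>\<bar> * weight \<rho>"
        using eventually_le_at_bot[of 0]
      proof eventually_elim
        case (elim \<rho>)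
        have "exp (- (4 * \<rho>)) \<le> exp (- (real n * \<rho>))"
          using mult_right_mono_neg[OF n4, of \<rho>] elim by simp
        then have "\<bar>\<beta>\<bar> * (exp (- (4 * \<rho>)) * weight \<rho>) \<le> \<bar>\<beta>\<bar> * (exp (- (real n * \<rho>)) * weight \<rho>)"
          using weight_nonneg by (intro mult_left_mono mult_right_mono) auto
        then show ?case using elim by (simp add: J mult.assoc)
      qed
      then show False using fourier_coeff_tail(2)[of "\<bar>\<beta>\<bar> * (p * q * m / 2) / 2"] \<open>\<beta> \<noteq> 0\<close> pq m_pos by simp
    qed
  qed
  show ?thesis by (simp add: I \<alpha> \<beta>)
qed

lemma fourier_coeff_eq_0: "fourier_coeff n \<delta> \<rho> = 0"
  using fourier_coeff_odd fourier_coeff_even_mode fourier_coeff_zero_mode by (cases "n = 0"; cases "even n") auto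

lemma trig_poly_continuous: "f \<in> trig_poly \<Longrightarrow> continuous_on S f"
  by (induction rule: trig_poly.induct) (auto intro!: continuous_intros)

lemma trig_poly_orthogonal:
  assumes "f \<in> trig_poly"
  shows "integral {0..2*pi} (\<lambda>\<theta>. D (Y \<rho> \<theta>) * f \<theta>) = 0"
  using assms
proof induction
  case (wave n \<delta>)
  show ?case using fourier_coeff_eq_0 unfolding fourier_coeff_def .
next
  case (scale f c)
  have "(\<lambda>\<theta>. D (Y \<rho> \<theta>) * (c * f \<theta>)) = (\<lambda>\<theta>. c * (D (Y \<rho> \<theta>) * f \<theta>))" by (simp add: mult_ac)
  then show ?case using scale by simp
next
  case (add f g)
  have "(\<lambda>\<theta>. D (Y \<rho> \<theta>) * f \<theta>) integrable_on {0..2*pi}" if "f \<in> trig_poly" for f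
    by (intro integrable_continuous_interval continuous_intros U_continuous trig_poly_continuous that)
  then show ?case using add by (simp add: distrib_left Henstock_Kurzweil_Integration.integral_add)
qed

text \<open>A continuous function on the circle that is orthogonal to all trigonometric polynomials is orthogonal to
  its own uniform approximations by polynomials, hence to itself.\<close>
lemma vanishes_on_ellipse:
  assumes "\<theta> \<in> {0..2*pi}"
  shows "D (Y \<rho> \<theta>) = 0"
proof -
  let ?u = "\<lambda>\<theta>. D (Y \<rho> \<theta>)"
  have cu: "continuous_on S ?u" for S by (intro continuous_intros U_continuous)
  let ?P = "\<lambda>x::real^2. plane (p * (exp \<rho> * x$1), q * (exp \<rho> * x$2))"
  define F where "F = (\<lambda>x::real^2. D (?P x))"
  have uF: "?u \<theta> = F (plane (cos \<theta>, sin \<theta>))" for \<theta> by (simp add: F_def Y_def)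
  have "continuous_on (sphere 0 1) F"
    unfolding F_def
  proof (rule continuous_on_compose2[OF cont(1)])
    show "continuous_on (sphere 0 1) ?P"
      unfolding plane_def fst_conv snd_conv by (intro continuous_intros)
    have "?P x \<noteq> 0" if "x \<in> sphere 0 1" for x :: "real^2"
    proof -
      have "x \<noteq> 0" using that by auto
      then show ?thesis using pq by (auto simp: real2_nonzero_iff)
    qed
    note nz = this
    show "?P ` sphere 0 1 \<subseteq> - {0}"
    proof (rule image_subsetI)
      fix x :: "real^2" assume "x \<in> sphere 0 1"
      from nz[OF this] show "?P x \<in> - {0}" by simp
    qed
  qed
  let ?S = "integral {0..2*pi} (\<lambda>\<theta>. (?u \<theta>)\<^sup>2)"
  define L where "L = integral {0..2*pi} (\<lambda>\<theta>. \<bar>?u \<theta>\<bar>)"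
  have small: "?S \<le> e * L" if e: "e > 0" for e
  proof -
    obtain g where g: "real_polynomial_function g" "\<And>x. x \<in> sphere 0 1 \<Longrightarrow> \<bar>F x - g x\<bar> < e"
      using Stone_Weierstrass_real_polynomial_function[OF compact_sphere \<open>continuous_on (sphere 0 1) F\<close> e] by blast
    let ?g = "\<lambda>\<theta>. g (plane (cos \<theta>, sin \<theta>))"
    have tg: "?g \<in> trig_poly" by (rule trig_poly_polynomial[OF g(1)])
    have d: "\<bar>?u \<theta> - ?g \<theta>\<bar> < e" for \<theta>
      unfolding uF by (rule g(2)) (simp add: norm_real2)
    have cg: "continuous_on S ?g" for S by (rule trig_poly_continuous[OF tg])
    have i: "(\<lambda>\<theta>. (?u \<theta>)\<^sup>2) integrable_on {0..2*pi}" "(\<lambda>\<theta>. ?u \<theta> * ?g \<theta>) integrable_on {0..2*pi}"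
      "(\<lambda>\<theta>. e * \<bar>?u \<theta>\<bar>) integrable_on {0..2*pi}" "(\<lambda>\<theta>. (?u \<theta>)\<^sup>2 - ?u \<theta> * ?g \<theta>) integrable_on {0..2*pi}"
      by (intro integrable_continuous_interval continuous_intros cu cg)+
    have "?S = integral {0..2*pi} (\<lambda>\<theta>. (?u \<theta>)\<^sup>2 - ?u \<theta> * ?g \<theta>)"
      using trig_poly_orthogonal[OF tg] by (simp add: Henstock_Kurzweil_Integration.integral_diff i)
    also have "\<dots> \<le> integral {0..2*pi} (\<lambda>\<theta>. e * \<bar>?u \<theta>\<bar>)"
    proof (rule integral_le[OF i(4) i(3)])
      fix \<theta>
      have "(?u \<theta>)\<^sup>2 - ?u \<theta> * ?g \<theta> = ?u \<theta> * (?u \<theta> - ?g \<theta>)" by (simp add: power2_eq_square algebra_simps)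
      also have "\<dots> \<le> \<bar>?u \<theta>\<bar> * \<bar>?u \<theta> - ?g \<theta>\<bar>" by (simp only: abs_ge_self flip: abs_mult)
      also have "\<dots> \<le> \<bar>?u \<theta>\<bar> * e" using d[of \<theta>] by (intro mult_left_mono) auto
      finally show "(?u \<theta>)\<^sup>2 - ?u \<theta> * ?g \<theta> \<le> e * \<bar>?u \<theta>\<bar>" by (simp add: mult.commute)
    qed
    also have "\<dots> = e * L" by (simp add: L_def)
    finally show ?thesis .
  qed
  have L: "L \<ge> 0" unfolding L_def
    by (intro Henstock_Kurzweil_Integration.integral_nonneg integrable_continuous_interval continuous_intros cu) auto
  have "?S \<le> 0"
  proof (rule field_le_epsilon)
    fix e :: real assume e: "e > 0"
    \<comment> \<open>dividing by L + 1, as L may be 0\<close>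
    have "?S \<le> e / (L + 1) * L" by (rule small) (use e L in simp)
    also have "\<dots> = e * (L / (L + 1))" by simp
    also have "\<dots> \<le> e * 1" using e L by (intro mult_left_mono) auto
    finally show "?S \<le> 0 + e" by simp
  qed
  moreover have "?S \<ge> 0"
    by (intro Henstock_Kurzweil_Integration.integral_nonneg integrable_continuous_interval continuous_intros cu) auto
  ultimately have "?S = 0" by simp
  then have "\<forall>\<theta>\<in>{0..2*pi}. (?u \<theta>)\<^sup>2 = 0"
    by (subst (asm) integral_eq_0_iff) (auto intro!: continuous_intros cu)
  then show ?thesis using assms by simp
qed

theorem vanishes:
  assumes "z \<noteq> 0"
  shows "D z = 0"
proof -
  define x y where "x = z$1 / p" and "y = z$2 / q"
  have "x \<noteq> 0 \<or> y \<noteq> 0" using assms pq by (auto simp: real2_nonzero_iff x_def y_def)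
  then have r: "x\<^sup>2 + y\<^sup>2 > 0" by (simp add: sum_power2_gt_zero_iff)
  define r where "r = sqrt (x\<^sup>2 + y\<^sup>2)"
  have rp: "r > 0" "r\<^sup>2 = x\<^sup>2 + y\<^sup>2" using r by (auto simp: r_def)
  have "(x / r)\<^sup>2 + (y / r)\<^sup>2 = 1"
  proof -
    have "(x / r)\<^sup>2 + (y / r)\<^sup>2 = (x\<^sup>2 + y\<^sup>2) / r\<^sup>2" by (simp add: power_divide add_divide_distrib)
    also have "\<dots> = 1" using rp(1) unfolding rp(2)[symmetric] by simp
    finally show ?thesis .
  qed
  then obtain \<theta> where \<theta>: "0 \<le> \<theta>" "\<theta> < 2 * pi" "x / r = cos \<theta>" "y / r = sin \<theta>"
    using sincos_total_2pi by blast
  have "exp (ln r) * cos \<theta> = x" "exp (ln r) * sin \<theta> = y"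
    unfolding \<theta>(3,4)[symmetric] using rp(1) by simp_all
  then have "Y (ln r) \<theta> = z"
    using pq by (simp add: vec_eq_iff forall_2 Y_nth x_def y_def)
  then show ?thesis using vanishes_on_ellipse[of \<theta> "ln r"] \<theta> by auto
qed

end

section \<open>Uniqueness of the kernel\<close>

lemma partial_diff:
  assumes "f differentiable (at z)" "g differentiable (at z)"
  shows "partial i (\<lambda>x. f x - g x) z = partial i f z - partial i g z"
proof -
  have "(f has_derivative frechet_derivative f (at z)) (at z)" "(g has_derivative frechet_derivative g (at z)) (at z)"
    using assms frechet_derivative_works by blast+
  from partial_eq_derivative[OF has_derivative_diff[OF this]] show ?thesis
    by (simp add: partial_def)
qed

lemma partial_partial_diff:
  assumes "smooth_on f S" "smooth_on g S" "open S" "z \<in> S"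
  shows "partial j (partial i (\<lambda>x. f x - g x)) z = partial j (partial i f) z - partial j (partial i g) z"
proof -
  have "partial j (partial i (\<lambda>x. f x - g x)) z = partial j (\<lambda>x. partial i f x - partial i g x) z"
    using assms smooth_on_differentiable_at
    by (intro partial_transform_open[OF \<open>open S\<close> \<open>z \<in> S\<close>] partial_diff) auto
  also have "\<dots> = partial j (partial i f) z - partial j (partial i g) z"
    using assms by (intro partial_diff smooth_on_differentiable_at[OF smooth_on_partial])
  finally show ?thesis .
qed

lemma Ck_on_diff:
  assumes "open S" "smooth_on f S" "smooth_on g S"
  shows "Ck_on n (\<lambda>x. f x - g x) S"
  using assms(2,3)
proof (induction n arbitrary: f g)
  case 0
  then show ?case by (simp add: continuous_on_diff smooth_on_continuous_on)
next
  case (Suc n)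
  have "Ck_on n (partial i (\<lambda>x. f x - g x)) S" for i
  proof -
    have "Ck_on n (\<lambda>x. partial i f x - partial i g x) S"
      using Suc by (intro Suc.IH smooth_on_partial)
    moreover have "partial i (\<lambda>x. f x - g x) x = partial i f x - partial i g x" if "x \<in> S" for x
      using Suc.prems \<open>open S\<close> that by (intro partial_diff smooth_on_differentiable_at)
    ultimately show ?thesis
      using Ck_on_transform_open[OF \<open>open S\<close>, of "partial i (\<lambda>x. f x - g x)" "\<lambda>x. partial i f x - partial i g x" n] by blast
  qed
  moreover have "(\<lambda>x. f x - g x) differentiable_on S"
    using Suc.prems by (intro differentiable_on_diff) (metis Ck_on.simps(2) smooth_on_def)+
  ultimately show ?case by simp
qed

lemma smooth_on_diff: "open S \<Longrightarrow> smooth_on f S \<Longrightarrow> smooth_on g S \<Longrightarrow> smooth_on (\<lambda>x. f x - g x) S"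
  by (simp add: smooth_on_def[of "\<lambda>x. f x - g x"] Ck_on_diff)

lemma admissible_kernel_gaussian_integrable:
  assumes "admissible_kernel K"
  shows "integrable lborel (\<lambda>y. K y * (1 - exp (- (norm y)\<^sup>2 / 2)))"
proof -
  have "integrable lborel (second_difference_integrand K gaussian 0)"
    using assms gaussian_schwartz unfolding admissible_kernel_def by blast
  also have "second_difference_integrand K gaussian 0 = (\<lambda>y. complex_of_real (- 2 * (K y * (1 - exp (- (norm y)\<^sup>2 / 2)))))"
    by (auto simp: second_difference_integrand_def gaussian_def fun_eq_iff algebra_simps)
  finally have "integrable lborel (\<lambda>y. - 2 * (K y * (1 - exp (- (norm y)\<^sup>2 / 2))))"
    by (subst (asm) complex_of_real_integrable_eq)
  then have "integrable lborel (\<lambda>y. (- 1 / 2) * (- 2 * (K y * (1 - exp (- (norm y)\<^sup>2 / 2)))))"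
    by (rule integrable_mult_right)
  then show ?thesis by simp
qed

text \<open>The difference of the two kernels is even, solves the homogeneous equation and inherits the Gaussian
  integrability, so it vanishes.\<close>
lemma admissible_solution_unique:
  assumes "a > 0" "b > 0"
    and "smooth_kernel_solution a b K" "admissible_kernel K"
    and "smooth_kernel_solution a b L" "admissible_kernel L"
    and "z \<noteq> 0"
  shows "K z = L z"
proof -
  let ?D = "\<lambda>x. K x - L x"
  have op: "open (- {0::real^2})" by (rule open_Compl) simp
  have s: "smooth_on K (- {0})" "smooth_on L (- {0})"
    using assms by (auto simp: smooth_kernel_solution_def)
  have sD: "smooth_on ?D (- {0})" by (rule smooth_on_diff[OF op s])
  interpret punctured_harmonic a b ?D
  proof
    show "?D differentiable (at z)" "partial i ?D differentiable (at z)" if "z \<noteq> 0" for z i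
      using smooth_on_differentiable_at[OF sD op] smooth_on_differentiable_at[OF smooth_on_partial[OF sD] op] that by auto
    show "continuous_on (- {0}) (partial j (partial i ?D))" for i j
      by (intro smooth_on_continuous_on smooth_on_partial sD)
    show "b * partial 1 (partial 1 ?D) z + a * partial 2 (partial 2 ?D) z = 0" if "z \<noteq> 0" for z
    proof -
      have z: "z \<in> - {0}" using that by simp
      have "b * partial 1 (partial 1 K) z + a * partial 2 (partial 2 K) z = b * partial 1 (partial 1 L) z + a * partial 2 (partial 2 L) z"
        using assms(3,5) that unfolding smooth_kernel_solution_def by simp
      then show ?thesis unfolding partial_partial_diff[OF s op z] by (simp add: algebra_simps)
    qed
    show "K (- z) - L (- z) = K z - L z" if "z \<noteq> 0" for z
      using assms(4,6) that unfolding admissible_kernel_def by simp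
    have "integrable lborel (\<lambda>y. K y * (1 - exp (- (norm y)\<^sup>2 / 2)) - L y * (1 - exp (- (norm y)\<^sup>2 / 2)))"
      by (intro Bochner_Integration.integrable_diff admissible_kernel_gaussian_integrable assms)
    then show "integrable lborel (\<lambda>y. (K y - L y) * (1 - exp (- (norm y)\<^sup>2 / 2)))"
      by (simp only: left_diff_distrib)
  qed (use assms in auto)
  show ?thesis using vanishes[OF assms(7)] by simp
qed

theorem proposition5p4:
  fixes C11 C13 C33 C44 C66 \<eta>1 \<eta>2 :: real
  assumes "0 < C66" and "C66 < C11"
    and "C13\<^sup>2 < C33 * (C11 - C66)"
    and "0 < C44"
    and "\<eta>1 = eta1 C44 C66"
    and "\<eta>2 = eta2 C11 C13 C33 C44"
    and "0 < \<eta>1" and "0 < \<eta>2"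
  shows "(\<forall>w. schwartz w \<longrightarrow>
            integrable lborel (\<lambda>k. complex_of_real (symbol \<eta>1 \<eta>2 k) * fourier w k) \<and>
            (\<forall>x. fourier_multiplier (symbol \<eta>1 \<eta>2) w x =
               complex_of_real (- 1 / (4 * pi)) *
                 (LINT y|lborel. (w (x - y) + w (x + y) - 2 * w x)
                                   * complex_of_real (elastic_kernel \<eta>1 \<eta>2 y))))
       \<and> smooth_kernel_solution \<eta>1 \<eta>2 (elastic_kernel \<eta>1 \<eta>2)
       \<and> admissible_kernel (elastic_kernel \<eta>1 \<eta>2)
       \<and> (\<forall>K. smooth_kernel_solution \<eta>1 \<eta>2 K \<and> admissible_kernel K \<longrightarrow>
              (\<forall>z. z \<noteq> 0 \<longrightarrow> K z = elastic_kernel \<eta>1 \<eta>2 z))"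
proof -
  interpret positive_moduli \<eta>1 \<eta>2 by unfold_locales (rule assms)+
  have solution: "smooth_kernel_solution \<eta>1 \<eta>2 (elastic_kernel \<eta>1 \<eta>2)"
    by (rule elastic_kernel_solution[OF a b])
  show ?thesis
    using elastic_operator(1,3)[unfolded second_difference_integrand_def] solution elastic_kernel_admissible
      admissible_solution_unique[OF a b _ _ solution elastic_kernel_admissible]
    by blast
qed

end
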